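(* The Kalton--Swanson map $\Lambda$ induces an isometric $*$-algebra homomorphism $\hat\Lambda$ from $(L(Z_2)/S(Z_2),\|\cdot\|_S)$ into $(L(H),\|\cdot\|)$.
   Context: The scalar field is either $\mathbb{R}$ or $\mathbb{C}$. The Kalton--Peck space $Z_2$ is the twisted sum $\ell_2\oplus_{\Omega}\ell_2$, where $\Omega=\Omega_2$ is the quasi-linear map given on finitely supported vectors by $\Omega(x)(n)=x(n)\log\frac{\|x\|_2}{|x(n)|}$ (with value $0$ where $x(n)=0$); i.e. $Z_2$ is the space of pairs $(x,y)$ of sequences with $y\in\ell_2$, $x-\Omega y\in\ell_2$, with quasi-norm $\|(x,y)\|=\|x-\Omega y\|_2+\|y\|_2$ (equivalent to a Banach space norm); in particular $x\mapsto(x,0)$ embeds $\ell_2$ isometrically. $L(Z_2)$ is the algebra of bounded linear operators on $Z_2$ and $S(Z_2)$ the ideal of strictly singular operators (operators whose restriction to any infinite dimensional closed subspace is not an isomorphism onto its range). For an operator $T$ on $Z_2$, $\|T\|_S$ is the infimum of those $\varepsilon>0$ such that every infinite dimensional closed subspace of $Z_2$ contains a further infinite dimensional closed subspace $Z$ with $\|T_{|Z}\|\le\varepsilon$; it vanishes exactly on $S(Z_2)$ and induces a norm, still denoted $\|\cdot\|_S$, on $L(Z_2)/S(Z_2)$. The form $\omega((x,y),(x',y'))=\langle x,y'\rangle-\langle y,x'\rangle$ (with the $\ell_2$ inner product, on finitely supported vectors, extended by continuity) is a symplectic form on $Z_2$, and the involution $*$ on $L(Z_2)$ is defined by $\omega(Tu,v)=\omega(u,T^*v)$;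 since $T$ is strictly singular iff $T^*$ is, it induces an involution on $L(Z_2)/S(Z_2)$. $L(H)$ carries the Hilbert space adjoint as involution and the operator norm. Let $\mathcal U$ be a non-trivial ultrafilter on $\mathbb{N}$ and $(e_n)$ the canonical basis of $\ell_2$. There is a symmetric bilinear (Hermitian sesquilinear in the complex case) positive form $(\cdot,\cdot)$ on $L(Z_2)$ determined by $(T,T)=\lim_{\mathcal U}\|T(e_n,0)\|_{Z_2}^2$. The Hilbert space $H$ is the completion of the quotient of $L(Z_2)$ by $\{T:(T,T)=0\}$, and $\widetilde T\in H$ denotes the element corresponding to $T$. For $A\in L(Z_2)$, $\Lambda(A)\in L(H)$ is the bounded operator determined by $\Lambda(A)\widetilde T=\widetilde{AT}$ for $T\in L(Z_2)$. It is known (Kalton--Swanson) that $\Lambda$ is a well-defined norm one algebra homomorphism whose kernel is $S(Z_2)$. *)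

theory Defs
  imports "HOL-Analysis.Analysis" "HOL-Algebra.QuotRing" "HOL-Algebra.Module"
begin

text \<open>The axiom \<open>real_or_complex\<close> leaves exactly the two models of the reals
  (where \<open>scnj\<close> is the identity) and the complex numbers (where \<open>scnj\<close> is conjugation);
  a statement about \<open>'k::rc_field\<close> thus covers precisely these two scalar fields.\<close>

class rc_field = real_normed_field +
  fixes scnj :: "'a \<Rightarrow> 'a"
  assumes scnj_add: "scnj (x + y) = scnj x + scnj y"
    and mult_scnj: "x * scnj x = (norm x)\<^sup>2 *\<^sub>R 1"
    and real_or_complex: "(\<forall>z. \<exists>a. z = a *\<^sub>R 1) \<or>
      (\<exists>i. i * i = - 1 \<and> (\<forall>z. \<exists>a b. z = a *\<^sub>R 1 + b *\<^sub>R i))"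

instantiation real :: rc_field
begin
definition scnj_real :: "real \<Rightarrow> real" where "scnj_real x = x"
instance
  by standard (auto simp: scnj_real_def power2_eq_square)
end

instantiation complex :: rc_field
begin
definition scnj_complex :: "complex \<Rightarrow> complex" where "scnj_complex = cnj"
instance
proof
  fix x y :: complex
  show "scnj (x + y) = scnj x + scnj y" by (simp add: scnj_complex_def)
  show "x * scnj x = (norm x)\<^sup>2 *\<^sub>R 1"
    by (simp add: scnj_complex_def scaleR_conv_of_real complex_norm_square[symmetric])
  have "\<forall>z::complex. \<exists>a b. z = a *\<^sub>R 1 + b *\<^sub>R \<i>"
    by (metis complex_eq mult.commute mult.right_neutral scaleR_conv_of_real)
  then show "(\<forall>z::complex. \<exists>a. z = a *\<^sub>R 1) \<or>
      (\<exists>i::complex. i * i = - 1 \<and> (\<forall>z. \<exists>a b. z = a *\<^sub>R 1 + b *\<^sub>R i))"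
    by (intro disjI2 exI[of _ \<i>]) simp
qed
end

definition ell2 :: "(nat \<Rightarrow> 'k::real_normed_field) set" where
  "ell2 = {x. summable (\<lambda>n. (norm (x n))\<^sup>2)}"

definition ell2_norm :: "(nat \<Rightarrow> 'k::real_normed_field) \<Rightarrow> real" where
  "ell2_norm x = sqrt (\<Sum>n. (norm (x n))\<^sup>2)"

definition ell2_inner :: "(nat \<Rightarrow> 'k::rc_field) \<Rightarrow> (nat \<Rightarrow> 'k) \<Rightarrow> 'k" where
  "ell2_inner x y = (\<Sum>n. x n * scnj (y n))"

lemma ell2_L2_set_le:
  assumes "x \<in> ell2"
  shows "L2_set (\<lambda>n. norm (x n)) {..<N} \<le> ell2_norm x"
  using assms unfolding ell2_def ell2_norm_def L2_set_def
  by (auto intro!: sum_le_suminf)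

lemma ell2_boundI:
  assumes "\<And>N. L2_set (\<lambda>n. norm (x n)) {..<N} \<le> K"
  shows "x \<in> ell2" and "ell2_norm x \<le> K"
proof -
  have K: "0 \<le> K" using assms[of 0] by simp
  have b: "(\<Sum>n<N. (norm (x n))\<^sup>2) \<le> K\<^sup>2" for N
    using assms[of N] K unfolding L2_set_def
    by (metis real_le_rsqrt real_sqrt_le_iff real_sqrt_unique)
  have s: "summable (\<lambda>n. (norm (x n))\<^sup>2)"
    by (rule summableI_nonneg_bounded[where x = "K\<^sup>2"]) (use b in auto)
  then show "x \<in> ell2" by (simp add: ell2_def)
  have "(\<Sum>n. (norm (x n))\<^sup>2) \<le> K\<^sup>2"
    by (rule suminf_le_const[OF s]) (use b in auto)
  then show "ell2_norm x \<le> K"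
    unfolding ell2_norm_def using K by (metis real_sqrt_le_mono real_sqrt_unique)
qed

lemma ell2_norm_nonneg: "x \<in> ell2 \<Longrightarrow> 0 \<le> ell2_norm x"
  using ell2_L2_set_le[of x 0] by simp

lemma ell2_dom:
  assumes "y \<in> ell2" "\<And>n. norm (x n) \<le> norm (y n)"
  shows "x \<in> ell2" and "ell2_norm x \<le> ell2_norm y"
proof -
  have "L2_set (\<lambda>n. norm (x n)) {..<N} \<le> ell2_norm y" for N
    using L2_set_mono[of "{..<N}" "\<lambda>n. norm (x n)" "\<lambda>n. norm (y n)"]
      ell2_L2_set_le[OF assms(1), of N] assms(2) by force
  then show "x \<in> ell2" "ell2_norm x \<le> ell2_norm y"
    by (rule ell2_boundI)+
qed

lemma ell2_add:
  assumes "x \<in> ell2" "y \<in> ell2"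
  shows "(\<lambda>n. x n + y n) \<in> ell2" and "ell2_norm (\<lambda>n. x n + y n) \<le> ell2_norm x + ell2_norm y"
proof -
  have "L2_set (\<lambda>n. norm (x n + y n)) {..<N} \<le> ell2_norm x + ell2_norm y" for N
  proof -
    have "L2_set (\<lambda>n. norm (x n + y n)) {..<N} \<le> L2_set (\<lambda>n. norm (x n) + norm (y n)) {..<N}"
      by (rule L2_set_mono) (auto intro: norm_triangle_ineq)
    also have "\<dots> \<le> L2_set (\<lambda>n. norm (x n)) {..<N} + L2_set (\<lambda>n. norm (y n)) {..<N}"
      by (rule L2_set_triangle_ineq)
    finally show ?thesis
      using ell2_L2_set_le[OF assms(1), of N] ell2_L2_set_le[OF assms(2), of N] by linarith
  qed
  then show "(\<lambda>n. x n + y n) \<in> ell2" "ell2_norm (\<lambda>n. x n + y n) \<le> ell2_norm x + ell2_norm y"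
    by (rule ell2_boundI)+
qed

lemma ell2_scale:
  assumes "x \<in> ell2"
  shows "(\<lambda>n. c * x n) \<in> ell2" and "ell2_norm (\<lambda>n. c * x n) = norm c * ell2_norm x"
proof -
  have s: "summable (\<lambda>n. (norm (x n))\<^sup>2)" using assms by (simp add: ell2_def)
  show "(\<lambda>n. c * x n) \<in> ell2"
    using s by (auto simp: ell2_def norm_mult power_mult_distrib intro: summable_mult)
  show "ell2_norm (\<lambda>n. c * x n) = norm c * ell2_norm x"
    unfolding ell2_norm_def norm_mult power_mult_distrib suminf_mult[OF s]
    by (simp add: real_sqrt_mult)
qed

lemma ell2_diff:
  assumes "x \<in> ell2" "y \<in> ell2"
  shows "(\<lambda>n. x n - y n) \<in> ell2" and "ell2_norm (\<lambda>n. x n - y n) \<le> ell2_norm x + ell2_norm y"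
  using ell2_add[OF assms(1) ell2_scale(1)[OF assms(2), of "-1"]]
    ell2_scale(2)[OF assms(2), of "-1"] by simp_all

lemma ell2_coord_le:
  assumes "x \<in> ell2"
  shows "norm (x n) \<le> ell2_norm x"
  using member_le_L2_set[of "{..<Suc n}" n "\<lambda>n. norm (x n)"]
    ell2_L2_set_le[OF assms, of "Suc n"] by simp

lemma ell2_norm_eq_0D: "x \<in> ell2 \<Longrightarrow> ell2_norm x = 0 \<Longrightarrow> x n = 0"
  using ell2_coord_le[of x n] by simp

lemma ell2_zero: "(\<lambda>n. 0) \<in> ell2" "ell2_norm (\<lambda>n. 0) = 0"
  by (auto simp: ell2_def ell2_norm_def)

text \<open>At coordinates with \<open>x n = 0\<close> the formula below has the value \<open>0\<close>.\<close>

definition Omega :: "(nat \<Rightarrow> 'k::real_normed_field) \<Rightarrow> nat \<Rightarrow> 'k" where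
  "Omega x n = x n * of_real (ln (ell2_norm x / norm (x n)))"

lemma Omega_zero: "Omega (\<lambda>n. 0) = (\<lambda>n. 0)"
  by (rule ext) (simp add: Omega_def)

lemma Omega_scale:
  assumes "x \<in> ell2"
  shows "Omega (\<lambda>n. c * x n) n = c * Omega x n"
  by (cases "c = 0") (simp_all add: Omega_def ell2_scale(2)[OF assms] norm_mult)

lemma mult_ln_bound:
  fixes a s :: real
  assumes "0 \<le> a" "a \<le> s"
  shows "a * \<bar>ln (a / s)\<bar> \<le> s"
proof (cases "a = 0")
  case True
  then show ?thesis using assms by simp
next
  case False
  then have a: "0 < a" "0 < s" using assms by auto
  have "ln (a / s) \<le> 0" using a assms by simp
  then have "a * \<bar>ln (a / s)\<bar> = a * ln (s / a)"
    using a by (simp add: ln_div)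
  also have "\<dots> \<le> a * (s / a - 1)"
    using a by (intro mult_left_mono ln_le_minus_one) auto
  also have "\<dots> \<le> s" using a by (simp add: field_simps)
  finally show ?thesis .
qed

lemma Omega_quasilinear:
  fixes x y :: "nat \<Rightarrow> 'k::real_normed_field"
  assumes "x \<in> ell2" "y \<in> ell2"
  defines "D \<equiv> (\<lambda>n. Omega (\<lambda>n. x n + y n) n - Omega x n - Omega y n)"
  shows "D \<in> ell2" and "ell2_norm D \<le> 6 * (ell2_norm x + ell2_norm y)"
proof -
  define P Q R S where "P = ell2_norm x" and "Q = ell2_norm y"
    and "R = ell2_norm (\<lambda>n. x n + y n)" and "S = P + Q"
  note xy = ell2_add[OF assms(1,2)]
  have PQ: "0 \<le> P" "0 \<le> Q" "0 \<le> R" "R \<le> S"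
    using ell2_norm_nonneg assms(1,2) xy by (auto simp: P_def Q_def R_def S_def)
  define s where "s = (\<lambda>n. norm (x n) + norm (y n))"
  define A1 A2 A3 where "A1 = (\<lambda>n. of_real (ln (R / S)) * (x n + y n))"
    and "A2 = (\<lambda>n. of_real (ln (P / S)) * x n)" and "A3 = (\<lambda>n. of_real (ln (Q / S)) * y n)"
  define E where "E = (\<lambda>n. x n * of_real (ln (norm (x n) / s n))
    + y n * of_real (ln (norm (y n) / s n))
    - (x n + y n) * of_real (ln (norm (x n + y n) / s n)))"
  have A1: "A1 \<in> ell2" "ell2_norm A1 \<le> S"
    using ell2_scale[OF xy(1), of "of_real (ln (R / S))"] mult_ln_bound[of R S] PQ
    by (simp_all add: A1_def R_def mult.commute)
  have A2: "A2 \<in> ell2" "ell2_norm A2 \<le> S"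
    using ell2_scale[OF assms(1), of "of_real (ln (P / S))"] mult_ln_bound[of P S] PQ
    by (simp_all add: A2_def P_def S_def mult.commute)
  have A3: "A3 \<in> ell2" "ell2_norm A3 \<le> S"
    using ell2_scale[OF assms(2), of "of_real (ln (Q / S))"] mult_ln_bound[of Q S] PQ
    by (simp_all add: A3_def Q_def S_def mult.commute)
  have Eb: "norm (E n) \<le> 3 * s n" for n
  proof -
    have 1: "norm (x n * of_real (ln (norm (x n) / s n))) \<le> s n"
      using mult_ln_bound[of "norm (x n)" "s n"] by (simp add: s_def norm_mult)
    have 2: "norm (y n * of_real (ln (norm (y n) / s n))) \<le> s n"
      using mult_ln_bound[of "norm (y n)" "s n"] by (simp add: s_def norm_mult)
    have 3: "norm ((x n + y n) * of_real (ln (norm (x n + y n) / s n))) \<le> s n"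
      using mult_ln_bound[of "norm (x n + y n)" "s n"] norm_triangle_ineq[of "x n" "y n"]
      by (simp add: s_def norm_mult)
    show ?thesis unfolding E_def
      using norm_triangle_le_diff[OF add_mono[OF norm_triangle_le[OF add_mono[OF 1 2]] 3]]
      by simp
  qed
  have E: "E \<in> ell2" "ell2_norm E \<le> 3 * S"
  proof -
    have "L2_set (\<lambda>n. norm (E n)) {..<N} \<le> 3 * S" for N
    proof -
      have "L2_set (\<lambda>n. norm (E n)) {..<N} \<le> L2_set (\<lambda>n. 3 * s n) {..<N}"
        by (rule L2_set_mono) (use Eb in auto)
      also have "\<dots> = 3 * L2_set s {..<N}"
        by (simp add: L2_set_right_distrib)
      also have "L2_set s {..<N} \<le> L2_set (\<lambda>n. norm (x n)) {..<N} + L2_set (\<lambda>n. norm (y n)) {..<N}"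
        unfolding s_def by (rule L2_set_triangle_ineq)
      finally show ?thesis
        using ell2_L2_set_le[OF assms(1), of N] ell2_L2_set_le[OF assms(2), of N]
        by (simp add: S_def P_def Q_def)
    qed
    then show "E \<in> ell2" "ell2_norm E \<le> 3 * S" by (rule ell2_boundI)+
  qed
  have split: "z * of_real (ln (M / norm z)) =
      z * of_real (ln (M / S)) - z * of_real (ln (norm z / s n)) + z * of_real (ln (S / s n))"
    if "z = 0 \<or> 0 < M" "0 < S" "0 < s n" for z :: 'k and M n
  proof (cases "z = 0")
    case False
    then have "ln (M / norm z) = ln (M / S) - ln (norm z / s n) + ln (S / s n)"
      using that by (simp add: ln_div)
    then show ?thesis by (simp only: of_real_add of_real_diff distrib_left right_diff_distrib)
  qed simp
  have Deq: "D n = (A1 n - A2 n) - A3 n + E n" for n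
  proof (cases "s n = 0")
    case True
    then have "x n = 0" "y n = 0" by (auto simp: s_def add_nonneg_eq_0_iff)
    then show ?thesis by (simp add: D_def A1_def A2_def A3_def E_def Omega_def)
  next
    case False
    then have sn: "0 < s n" by (simp add: s_def add_nonneg_nonneg less_le)
    have x0: "x n = 0 \<or> 0 < P" and y0: "y n = 0 \<or> 0 < Q"
      and xy0: "x n + y n = 0 \<or> 0 < R"
      using ell2_norm_eq_0D[OF assms(1), of n] ell2_norm_eq_0D[OF assms(2), of n]
        ell2_norm_eq_0D[OF xy(1), of n] PQ by (auto simp: P_def Q_def R_def less_le)
    have S: "0 < S"
      using x0 y0 sn PQ unfolding S_def s_def
      by (metis add_pos_nonneg add_nonneg_pos add.left_neutral less_irrefl norm_zero)
    show ?thesis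
      unfolding D_def Omega_def P_def[symmetric] Q_def[symmetric] R_def[symmetric]
        split[of "x n" P n, OF x0 S sn] split[of "y n" Q n, OF y0 S sn]
        split[of "x n + y n" R n, OF xy0 S sn]
      by (simp add: A1_def A2_def A3_def E_def algebra_simps)
  qed
  then have D: "D = (\<lambda>n. (A1 n - A2 n) - A3 n + E n)" by auto
  note d1 = ell2_diff[OF A1(1) A2(1)]
  note d2 = ell2_diff[OF d1(1) A3(1)]
  note d3 = ell2_add[OF d2(1) E(1)]
  show "D \<in> ell2" using d3(1) D by simp
  show "ell2_norm D \<le> 6 * (ell2_norm x + ell2_norm y)"
    using d3(2) d2(2) d1(2) A1(2) A2(2) A3(2) E(2)
    unfolding D S_def P_def Q_def by simp
qed

definition z2_set :: "((nat \<Rightarrow> 'k::real_normed_field) \<times> (nat \<Rightarrow> 'k)) set" where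
  "z2_set = {(x, y). y \<in> ell2 \<and> (\<lambda>n. x n - Omega y n) \<in> ell2}"

typedef (overloaded) 'k z2 = "z2_set :: ((nat \<Rightarrow> 'k::rc_field) \<times> (nat \<Rightarrow> 'k)) set"
  by (rule exI[of _ "(\<lambda>n. 0, \<lambda>n. 0)"]) (simp add: z2_set_def Omega_zero ell2_zero)

setup_lifting type_definition_z2

lemma z2_set_add:
  assumes "(x, y) \<in> z2_set" "(x', y') \<in> z2_set"
  shows "(\<lambda>n. x n + x' n, \<lambda>n. y n + y' n) \<in> z2_set"
    and "ell2_norm (\<lambda>n. x n + x' n - Omega (\<lambda>n. y n + y' n) n)
      \<le> ell2_norm (\<lambda>n. x n - Omega y n) + ell2_norm (\<lambda>n. x' n - Omega y' n)
        + 6 * (ell2_norm y + ell2_norm y')"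
proof -
  have a: "y \<in> ell2" "(\<lambda>n. x n - Omega y n) \<in> ell2" "y' \<in> ell2" "(\<lambda>n. x' n - Omega y' n) \<in> ell2"
    using assms by (auto simp: z2_set_def)
  note q = Omega_quasilinear[OF a(1,3)]
  note s = ell2_add[OF a(2,4)]
  note d = ell2_diff[OF s(1) q(1)]
  have eq: "(\<lambda>n. x n + x' n - Omega (\<lambda>n. y n + y' n) n) = (\<lambda>n. (x n - Omega y n + (x' n - Omega y' n))
      - (Omega (\<lambda>n. y n + y' n) n - Omega y n - Omega y' n))"
    by (auto simp: algebra_simps)
  show "(\<lambda>n. x n + x' n, \<lambda>n. y n + y' n) \<in> z2_set"
    using d(1)[folded eq] ell2_add(1)[OF a(1,3)] unfolding z2_set_def by blast
  show "ell2_norm (\<lambda>n. x n + x' n - Omega (\<lambda>n. y n + y' n) n)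
      \<le> ell2_norm (\<lambda>n. x n - Omega y n) + ell2_norm (\<lambda>n. x' n - Omega y' n)
        + 6 * (ell2_norm y + ell2_norm y')"
    using d(2) s(2) q(2) unfolding eq by simp
qed

lemma z2_set_scale:
  assumes "(x, y) \<in> z2_set"
  shows "(\<lambda>n. c * x n, \<lambda>n. c * y n) \<in> z2_set"
    and "(\<lambda>n. c * x n - Omega (\<lambda>n. c * y n) n) = (\<lambda>n. c * (x n - Omega y n))"
proof -
  have a: "y \<in> ell2" "(\<lambda>n. x n - Omega y n) \<in> ell2"
    using assms by (auto simp: z2_set_def)
  show eq: "(\<lambda>n. c * x n - Omega (\<lambda>n. c * y n) n) = (\<lambda>n. c * (x n - Omega y n))"
    by (auto simp: Omega_scale[OF a(1)] algebra_simps)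
  show "(\<lambda>n. c * x n, \<lambda>n. c * y n) \<in> z2_set"
    unfolding z2_set_def by (simp add: eq ell2_scale(1)[OF a(1)] ell2_scale(1)[OF a(2)])
qed

lift_definition z2_scale :: "'k::rc_field \<Rightarrow> 'k z2 \<Rightarrow> 'k z2"
  is "\<lambda>c (x, y). (\<lambda>n. c * x n, \<lambda>n. c * y n)"
  using z2_set_scale(1) by auto

lift_definition z2_norm :: "'k::rc_field z2 \<Rightarrow> real"
  is "\<lambda>(x, y). ell2_norm (\<lambda>n. x n - Omega y n) + ell2_norm y" .

instantiation z2 :: (rc_field) ab_group_add
begin

lift_definition zero_z2 :: "'a z2" is "(\<lambda>n. 0, \<lambda>n. 0)"
  by (simp add: z2_set_def Omega_zero ell2_zero)

lift_definition plus_z2 :: "'a z2 \<Rightarrow> 'a z2 \<Rightarrow> 'a z2"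
  is "\<lambda>(x, y) (x', y'). (\<lambda>n. x n + x' n, \<lambda>n. y n + y' n)"
  using z2_set_add(1) by auto

lift_definition uminus_z2 :: "'a z2 \<Rightarrow> 'a z2" is "\<lambda>(x, y). (\<lambda>n. - x n, \<lambda>n. - y n)"
  using z2_set_scale(1)[of _ _ "- 1"] by auto

definition minus_z2 :: "'a z2 \<Rightarrow> 'a z2 \<Rightarrow> 'a z2" where "minus_z2 u v = u + - v"

instance
  by standard (auto simp: minus_z2_def, (transfer, auto simp: algebra_simps)+)

end

global_interpretation z2: vector_space "z2_scale :: 'k::rc_field \<Rightarrow> 'k z2 \<Rightarrow> 'k z2"
  by standard (transfer, auto simp: algebra_simps)+

lemma z2_norm_nonneg: "0 \<le> z2_norm u"
  by transfer (auto simp: z2_set_def intro!: add_nonneg_nonneg ell2_norm_nonneg)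

lemma z2_norm_zero: "z2_norm 0 = 0"
  by transfer (simp add: Omega_zero ell2_zero)

lemma z2_norm_add: "z2_norm (u + v) \<le> 8 * (z2_norm u + z2_norm v)"
proof transfer
  fix u v :: "(nat \<Rightarrow> 'a) \<times> (nat \<Rightarrow> 'a)"
  assume uv: "u \<in> z2_set" "v \<in> z2_set"
  obtain x y x' y' where e: "u = (x, y)" "v = (x', y')" by fastforce
  have a: "y \<in> ell2" "(\<lambda>n. x n - Omega y n) \<in> ell2" "y' \<in> ell2" "(\<lambda>n. x' n - Omega y' n) \<in> ell2"
    using uv e by (auto simp: z2_set_def)
  show "(case (case u of (x, y) \<Rightarrow> \<lambda>(x', y'). (\<lambda>n. x n + x' n, \<lambda>n. y n + y' n)) v of
         (x, y) \<Rightarrow> ell2_norm (\<lambda>n. x n - Omega y n) + ell2_norm y)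
        \<le> 8 * ((case u of (x, y) \<Rightarrow> ell2_norm (\<lambda>n. x n - Omega y n) + ell2_norm y)
          + (case v of (x, y) \<Rightarrow> ell2_norm (\<lambda>n. x n - Omega y n) + ell2_norm y))"
    using z2_set_add(2)[OF uv[unfolded e]] ell2_add(2)[OF a(1,3)] a[THEN ell2_norm_nonneg]
    unfolding e by (simp only: prod.case) argo
qed

lemma z2_norm_scale: "z2_norm (z2_scale c u) = norm c * z2_norm u"
proof transfer
  fix c :: 'a and u :: "(nat \<Rightarrow> 'a) \<times> (nat \<Rightarrow> 'a)"
  assume u: "u \<in> z2_set"
  obtain x y where e: "u = (x, y)" by fastforce
  have a: "y \<in> ell2" "(\<lambda>n. x n - Omega y n) \<in> ell2" using u e by (auto simp: z2_set_def)
  show "(case case u of (x, y) \<Rightarrow> (\<lambda>n. c * x n, \<lambda>n. c * y n) of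
          (x, y) \<Rightarrow> ell2_norm (\<lambda>n. x n - Omega y n) + ell2_norm y)
        = norm c * (case u of (x, y) \<Rightarrow> ell2_norm (\<lambda>n. x n - Omega y n) + ell2_norm y)"
    using u unfolding e prod.case
    by (simp only: z2_set_scale(2) ell2_scale(2)[OF a(1)] ell2_scale(2)[OF a(2)] distrib_left)
qed

text \<open>The vectors \<open>(e n, 0)\<close>, where \<open>(e n)\<close> is the canonical basis of \<open>ell2\<close>.\<close>

lift_definition z2_e :: "nat \<Rightarrow> 'k::rc_field z2"
  is "\<lambda>n. (\<lambda>m. if m = n then 1 else 0, \<lambda>m. 0)"
proof -
  fix n :: nat
  have "(\<lambda>m. if m = n then 1 else 0 :: 'k) \<in> ell2"
    unfolding ell2_def mem_Collect_eq by (rule summable_finite[of "{n}"]) auto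
  then show "(\<lambda>m. if m = n then 1 else 0 :: 'k, \<lambda>m. 0) \<in> z2_set"
    by (simp add: z2_set_def Omega_zero ell2_zero)
qed

definition z2_tendsto :: "(nat \<Rightarrow> 'k::rc_field z2) \<Rightarrow> 'k z2 \<Rightarrow> bool" where
  "z2_tendsto us u \<longleftrightarrow> (\<lambda>n. z2_norm (us n - u)) \<longlonglongrightarrow> 0"

definition infdim_closed_subspace :: "'k::rc_field z2 set \<Rightarrow> bool" where
  "infdim_closed_subspace Z \<longleftrightarrow>
     z2.subspace Z \<and>
     (\<forall>us u. (\<forall>n. us n \<in> Z) \<and> z2_tendsto us u \<longrightarrow> u \<in> Z) \<and>
     (\<nexists>B. finite B \<and> Z \<subseteq> z2.span B)"

lift_definition z2_finsupp :: "'k::rc_field z2 \<Rightarrow> bool"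
  is "\<lambda>(x, y). finite {n. x n \<noteq> 0 \<or> y n \<noteq> 0}" .

lift_definition omega0 :: "'k::rc_field z2 \<Rightarrow> 'k z2 \<Rightarrow> 'k"
  is "\<lambda>(x, y) (x', y'). ell2_inner x y' - ell2_inner y x'" .

text \<open>Only the values of \<open>omega0\<close> at finitely supported vectors are meaningful;
  \<open>omega\<close> is their unique continuous extension.\<close>

definition omega :: "'k::rc_field z2 \<Rightarrow> 'k z2 \<Rightarrow> 'k" where
  "omega = (THE w.
     (\<forall>u v. z2_finsupp u \<and> z2_finsupp v \<longrightarrow> w u v = omega0 u v) \<and>
     (\<forall>us u vs v. z2_tendsto us u \<and> z2_tendsto vs v \<longrightarrow>
        (\<lambda>n. w (us n) (vs n)) \<longlonglongrightarrow> w u v))"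

typedef (overloaded) 'k z2_op =
  "{T :: 'k::rc_field z2 \<Rightarrow> 'k z2. Vector_Spaces.linear z2_scale z2_scale T \<and>
      (\<exists>K. \<forall>u. z2_norm (T u) \<le> K * z2_norm u)}"
  morphisms z2_app Abs_z2_op
  by (rule exI[of _ "\<lambda>u. u"])
    (auto intro!: exI[of _ 1] simp: z2.linear_id[unfolded id_def])

setup_lifting type_definition_z2_op

lemma z2_linear_iff:
  "Vector_Spaces.linear z2_scale z2_scale T \<longleftrightarrow>
     (\<forall>u v. T (u + v) = T u + T v) \<and> (\<forall>c u. T (z2_scale c u) = z2_scale c (T u))"
  by (simp add: Vector_Spaces.linear_iff z2.vector_space_axioms)

lemma z2_bound_add:
  assumes "\<And>u. z2_norm (S u) \<le> K * z2_norm u" "\<And>u. z2_norm (T u) \<le> L * z2_norm u"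
  shows "z2_norm (S u + T u) \<le> (8 * (K + L)) * z2_norm u"
  using z2_norm_add[of "S u" "T u"] assms(1)[of u] assms(2)[of u] by (simp add: algebra_simps)

lift_definition op_scale :: "'k::rc_field \<Rightarrow> 'k z2_op \<Rightarrow> 'k z2_op"
  is "\<lambda>c T u. z2_scale c (T u)"
proof safe
  fix c :: 'k and T :: "'k z2 \<Rightarrow> 'k z2" and K
  assume T: "Vector_Spaces.linear z2_scale z2_scale T" and K: "\<forall>u. z2_norm (T u) \<le> K * z2_norm u"
  show "Vector_Spaces.linear z2_scale z2_scale (\<lambda>u. z2_scale c (T u))"
    using T by (auto simp: z2_linear_iff z2.scale_right_distrib z2.scale_left_commute)
  have "z2_norm (z2_scale c (T u)) \<le> (norm c * K) * z2_norm u" for u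
    using K by (simp add: z2_norm_scale mult.assoc mult_left_mono)
  then show "\<exists>K. \<forall>u. z2_norm (z2_scale c (T u)) \<le> K * z2_norm u" by blast
qed

instantiation z2_op :: (rc_field) ring_1
begin

lift_definition zero_z2_op :: "'a z2_op" is "\<lambda>u. 0"
  by (auto simp: z2_linear_iff z2_norm_zero intro!: exI[of _ 0])

lift_definition one_z2_op :: "'a z2_op" is "\<lambda>u. u"
  by (auto simp: z2_linear_iff intro!: exI[of _ 1])

lift_definition plus_z2_op :: "'a z2_op \<Rightarrow> 'a z2_op \<Rightarrow> 'a z2_op" is "\<lambda>S T u. S u + T u"
proof safe
  fix S T :: "'a z2 \<Rightarrow> 'a z2" and K L
  assume lin: "Vector_Spaces.linear z2_scale z2_scale S" "Vector_Spaces.linear z2_scale z2_scale T"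
    and b: "\<forall>u. z2_norm (S u) \<le> K * z2_norm u" "\<forall>u. z2_norm (T u) \<le> L * z2_norm u"
  show "Vector_Spaces.linear z2_scale z2_scale (\<lambda>u. S u + T u)"
    using lin by (auto simp: z2_linear_iff z2.scale_right_distrib)
  show "\<exists>K. \<forall>u. z2_norm (S u + T u) \<le> K * z2_norm u"
    using z2_bound_add[of S K T L] b by blast
qed

lift_definition uminus_z2_op :: "'a z2_op \<Rightarrow> 'a z2_op" is "\<lambda>T u. - T u"
proof safe
  fix T :: "'a z2 \<Rightarrow> 'a z2" and K
  assume T: "Vector_Spaces.linear z2_scale z2_scale T" and K: "\<forall>u. z2_norm (T u) \<le> K * z2_norm u"
  show "Vector_Spaces.linear z2_scale z2_scale (\<lambda>u. - T u)"
    using T by (auto simp: z2_linear_iff)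
  have "z2_norm (- v) = z2_norm v" for v :: "'a z2"
    using z2_norm_scale[of "- 1" v] by simp
  then show "\<exists>K. \<forall>u. z2_norm (- T u) \<le> K * z2_norm u" using K by auto
qed

lift_definition times_z2_op :: "'a z2_op \<Rightarrow> 'a z2_op \<Rightarrow> 'a z2_op" is "\<lambda>S T u. S (T u)"
proof safe
  fix S T :: "'a z2 \<Rightarrow> 'a z2" and K L
  assume lin: "Vector_Spaces.linear z2_scale z2_scale S" "Vector_Spaces.linear z2_scale z2_scale T"
    and b: "\<forall>u. z2_norm (S u) \<le> K * z2_norm u" "\<forall>u. z2_norm (T u) \<le> L * z2_norm u"
  show "Vector_Spaces.linear z2_scale z2_scale (\<lambda>u. S (T u))"
    using lin by (auto simp: z2_linear_iff)
  have "z2_norm (S (T u)) \<le> (\<bar>K\<bar> * L) * z2_norm u" for u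
  proof -
    have "z2_norm (S (T u)) \<le> K * z2_norm (T u)" using b by blast
    also have "\<dots> \<le> \<bar>K\<bar> * z2_norm (T u)" by (intro mult_right_mono z2_norm_nonneg) auto
    also have "\<dots> \<le> \<bar>K\<bar> * (L * z2_norm u)" using b by (intro mult_left_mono) auto
    finally show ?thesis by (simp add: mult.assoc)
  qed
  then show "\<exists>K. \<forall>u. z2_norm (S (T u)) \<le> K * z2_norm u" by blast
qed

definition minus_z2_op :: "'a z2_op \<Rightarrow> 'a z2_op \<Rightarrow> 'a z2_op" where "minus_z2_op S T = S + - T"

instance
proof
  fix a b c :: "'a z2_op"
  show "a - b = a + - b" by (simp add: minus_z2_op_def)
  show "(0::'a z2_op) \<noteq> 1"
  proof transfer
    have "z2_e 0 \<noteq> (0 :: 'a z2)" by transfer (auto simp: fun_eq_iff)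
    then show "(\<lambda>u. 0 :: 'a z2) \<noteq> (\<lambda>u. u)" by metis
  qed
qed (transfer; auto simp: z2_linear_iff algebra_simps fun_eq_iff)+

end

definition op_star :: "'k::rc_field z2_op \<Rightarrow> 'k z2_op" where
  "op_star T = (THE S. \<forall>u v. omega (z2_app T u) v = omega u (z2_app S v))"

text \<open>The restriction of \<open>T\<close> to \<open>Z\<close> is an isomorphism onto its range iff it is bounded below,
  i.e. injective with a bounded inverse.\<close>

definition strictly_singular :: "'k::rc_field z2_op set" where
  "strictly_singular = {T. \<forall>Z. infdim_closed_subspace Z \<longrightarrow>
     \<not> (\<exists>K. \<forall>u\<in>Z. z2_norm u \<le> K * z2_norm (z2_app T u))}"

definition norm_S :: "'k::rc_field z2_op \<Rightarrow> real" where
  "norm_S T = Inf {\<epsilon>. \<epsilon> > 0 \<and>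
     (\<forall>Y. infdim_closed_subspace Y \<longrightarrow>
       (\<exists>Z\<subseteq>Y. infdim_closed_subspace Z \<and> (\<forall>u\<in>Z. z2_norm (z2_app T u) \<le> \<epsilon> * z2_norm u)))}"

record ('k, 'a) normed_star_algebra = "('k, 'a) module" +
  star :: "'a \<Rightarrow> 'a"
  alg_norm :: "'a \<Rightarrow> real"

definition isometric_star_hom ::
    "('k, 'a) normed_star_algebra \<Rightarrow> ('k, 'b) normed_star_algebra \<Rightarrow> ('a \<Rightarrow> 'b) set" where
  "isometric_star_hom A B = {h \<in> ring_hom A B.
     (\<forall>c. \<forall>a\<in>carrier A. h (c \<odot>\<^bsub>A\<^esub> a) = c \<odot>\<^bsub>B\<^esub> h a) \<and>
     (\<forall>a\<in>carrier A. h (star A a) = star B (h a)) \<and>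
     (\<forall>a\<in>carrier A. alg_norm B (h a) = alg_norm A a)}"

definition L_Z2 :: "'k::rc_field z2_op ring" where
  "L_Z2 = \<lparr>carrier = UNIV, mult = (*), one = 1, zero = 0, add = (+)\<rparr>"

text \<open>The quotient of \<open>L_Z2\<close> by the ideal of strictly singular operators; as for the
  multiplication of \<open>FactRing\<close>, the operations are defined as unions over all representatives.\<close>

definition L_mod_S :: "('k::rc_field, 'k z2_op set) normed_star_algebra" where
  "L_mod_S = \<lparr>
     carrier = carrier (L_Z2 Quot strictly_singular),
     mult = mult (L_Z2 Quot strictly_singular),
     one = one (L_Z2 Quot strictly_singular),
     zero = zero (L_Z2 Quot strictly_singular),
     add = add (L_Z2 Quot strictly_singular),
     smult = (\<lambda>c a. \<Union>A\<in>a. strictly_singular +>\<^bsub>L_Z2\<^esub> op_scale c A),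
     star = (\<lambda>a. \<Union>A\<in>a. strictly_singular +>\<^bsub>L_Z2\<^esub> op_star A),
     alg_norm = (\<lambda>a. the_elem (norm_S ` a))\<rparr>"

record ('k, 'h) ip_space =
  vec :: "'h set"
  vadd :: "'h \<Rightarrow> 'h \<Rightarrow> 'h"
  vscale :: "'k \<Rightarrow> 'h \<Rightarrow> 'h"
  inner_prod :: "'h \<Rightarrow> 'h \<Rightarrow> 'k"

definition vnorm :: "('k::rc_field, 'h) ip_space \<Rightarrow> 'h \<Rightarrow> real" where
  "vnorm H h = sqrt (norm (inner_prod H h h))"

definition bounded_ops :: "('k::rc_field, 'h) ip_space \<Rightarrow> ('h \<Rightarrow> 'h) set" where
  "bounded_ops H = {F \<in> vec H \<rightarrow>\<^sub>E vec H.
     (\<forall>h\<in>vec H. \<forall>k\<in>vec H. F (vadd H h k) = vadd H (F h) (F k)) \<and>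
     (\<forall>c. \<forall>h\<in>vec H. F (vscale H c h) = vscale H c (F h)) \<and>
     (\<exists>K. \<forall>h\<in>vec H. vnorm H (F h) \<le> K * vnorm H h)}"

definition op_norm :: "('k::rc_field, 'h) ip_space \<Rightarrow> ('h \<Rightarrow> 'h) \<Rightarrow> real" where
  "op_norm H F = Inf {K. 0 \<le> K \<and> (\<forall>h\<in>vec H. vnorm H (F h) \<le> K * vnorm H h)}"

definition hilbert_adjoint :: "('k::rc_field, 'h) ip_space \<Rightarrow> ('h \<Rightarrow> 'h) \<Rightarrow> 'h \<Rightarrow> 'h" where
  "hilbert_adjoint H F = (THE G. G \<in> bounded_ops H \<and>
     (\<forall>h\<in>vec H. \<forall>k\<in>vec H. inner_prod H (F h) k = inner_prod H h (G k)))"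

definition L_alg :: "('k::rc_field, 'h) ip_space \<Rightarrow> ('k, 'h \<Rightarrow> 'h) normed_star_algebra" where
  "L_alg H = \<lparr>
     carrier = bounded_ops H,
     mult = (\<lambda>F G. compose (vec H) F G),
     one = (\<lambda>h\<in>vec H. h),
     zero = (\<lambda>h\<in>vec H. vscale H 0 h),
     add = (\<lambda>F G. \<lambda>h\<in>vec H. vadd H (F h) (G h)),
     smult = (\<lambda>c F. \<lambda>h\<in>vec H. vscale H c (F h)),
     star = hilbert_adjoint H,
     alg_norm = op_norm H\<rparr>"

text \<open>For a positive semidefinite form \<open>B\<close>, the completion of the quotient by the null space
  of \<open>B\<close> is realised as the space of Cauchy sequences modulo null sequences. In particular,
  elements of the null space of \<open>B\<close> are identified with \<open>0\<close>.\<close>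

definition cauchy_seqs :: "('v::ab_group_add \<Rightarrow> 'v \<Rightarrow> 'k::rc_field) \<Rightarrow> (nat \<Rightarrow> 'v) set" where
  "cauchy_seqs B = {X. \<forall>\<epsilon>>0. \<exists>N. \<forall>m\<ge>N. \<forall>n\<ge>N. norm (B (X m - X n) (X m - X n)) < \<epsilon>}"

definition null_rel ::
    "('v::ab_group_add \<Rightarrow> 'v \<Rightarrow> 'k::rc_field) \<Rightarrow> ((nat \<Rightarrow> 'v) \<times> (nat \<Rightarrow> 'v)) set" where
  "null_rel B = {(X, Y). X \<in> cauchy_seqs B \<and> Y \<in> cauchy_seqs B \<and>
     (\<lambda>n. B (X n - Y n) (X n - Y n)) \<longlonglongrightarrow> 0}"

definition hilbert_completion ::
    "('k::rc_field \<Rightarrow> 'v::ab_group_add \<Rightarrow> 'v) \<Rightarrow> ('v \<Rightarrow> 'v \<Rightarrow> 'k) \<Rightarrow> ('k, (nat \<Rightarrow> 'v) set) ip_space"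
  where
  "hilbert_completion smul B = \<lparr>
     vec = cauchy_seqs B // null_rel B,
     vadd = (\<lambda>h k. \<Union>X\<in>h. \<Union>Y\<in>k. null_rel B `` {\<lambda>n. X n + Y n}),
     vscale = (\<lambda>c h. \<Union>X\<in>h. null_rel B `` {\<lambda>n. smul c (X n)}),
     inner_prod = (\<lambda>h k. THE l. \<forall>X\<in>h. \<forall>Y\<in>k. (\<lambda>n. B (X n) (Y n)) \<longlonglongrightarrow> l)\<rparr>"

definition nontrivial_ultrafilter :: "nat filter \<Rightarrow> bool" where
  "nontrivial_ultrafilter U \<longleftrightarrow> U \<noteq> bot \<and>
     (\<forall>P. eventually P U \<or> eventually (\<lambda>n. \<not> P n) U) \<and>
     (\<forall>n. \<not> eventually (\<lambda>m. m = n) U)"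

text \<open>A positive symmetric bilinear (Hermitian sesquilinear) form is determined by its
  quadratic form, by polarization.\<close>

definition ks_form :: "nat filter \<Rightarrow> 'k::rc_field z2_op \<Rightarrow> 'k z2_op \<Rightarrow> 'k" where
  "ks_form U = (THE B.
     (\<forall>S T R. B (S + T) R = B S R + B T R) \<and>
     (\<forall>c T R. B (op_scale c T) R = c * B T R) \<and>
     (\<forall>T R. B R T = scnj (B T R)) \<and>
     (\<forall>T. B T T = of_real (Lim U (\<lambda>n. (z2_norm (z2_app T (z2_e n)))\<^sup>2))))"

definition ks_H :: "nat filter \<Rightarrow> ('k::rc_field, (nat \<Rightarrow> 'k z2_op) set) ip_space" where
  "ks_H U = hilbert_completion op_scale (ks_form U)"

definition ks_tilde :: "nat filter \<Rightarrow> 'k::rc_field z2_op \<Rightarrow> (nat \<Rightarrow> 'k z2_op) set" where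
  "ks_tilde U T = null_rel (ks_form U) `` {\<lambda>_. T}"

definition ks_Lambda ::
    "nat filter \<Rightarrow> 'k::rc_field z2_op \<Rightarrow> (nat \<Rightarrow> 'k z2_op) set \<Rightarrow> (nat \<Rightarrow> 'k z2_op) set" where
  "ks_Lambda U A = (THE F. F \<in> bounded_ops (ks_H U) \<and>
     (\<forall>T. F (ks_tilde U T) = ks_tilde U (A * T)))"

end

theory Submission
  imports Defs
begin

text \<open>Write a vector of the twisted sum as \<open>u = (d, 0) + (Omega y, y)\<close>, so that its quasi-norm is
  \<open>norm d + norm y\<close>. If the \<open>y k\<close> are disjoint blocks, the normalised sums of the vectors
  \<open>(Omega (y k), y k)\<close> over \<open>k < n\<close> contain the term \<open>- ln (sqrt n)\<close> times the normalised sum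
  of the \<open>(y k, 0)\<close>, up to a bounded error. This logarithmic growth has three consequences: the
  second component of \<open>T (e n, 0)\<close> tends to \<open>0\<close>; the quotient map onto the second component is
  strictly singular; and if \<open>A (b n, 0)\<close> is close to \<open>(d n, 0)\<close> for blocks \<open>b n\<close>, then the second
  component of \<open>A (Omega (b n), b n)\<close> is close to \<open>d n\<close> along a subsequence.

  By the first one, the form is the ultralimit of the \<open>ell2\<close> inner products of the components \<open>d\<close> of
  \<open>S (e n, 0)\<close> and \<open>T (e n, 0)\<close>, hence sesquilinear, and a subsequence of \<open>T (e n, 0)\<close> spans an almost
  isometric multiple of a block subspace of \<open>ell2\<close>, on which \<open>A\<close> acts almost as a multiple of an
  isometry. By the second one, every infinite dimensional closed subspace contains almost a block
  subspace of \<open>ell2\<close>, and the latter is spanned by the \<open>T (e n, 0)\<close> for an isometric operator \<open>T\<close>.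
  Together these identify \<open>norm_S A\<close> with the norm of \<open>Lambda A\<close>. The third one turns the identity
  \<open>omega (A u) v = omega u (A* v)\<close> for \<open>u = (a n, 0)\<close>, \<open>v = (Omega (b n), b n)\<close> into
  \<open>(A T, R) = (T, A* R)\<close>.\<close>

section \<open>Scalars and limits along ultrafilters\<close>

text \<open>Two obstacles shape the estimates. First, \<open>z2_norm\<close> obeys the triangle
  inequality only up to the factor 8, so a sum of \<open>n\<close> errors may cost
  \<open>8 ^ n\<close>. Perturbations are therefore kept geometrically small, of size
  \<open>(1/16) ^ k\<close> at step \<open>k\<close>, and of size \<open>(1/256) ^ k\<close> where
  they pass through the section \<open>z2_sec\<close>, which reacts to truncation like a square
  root. The constants 16, 128 and 512 below come from summing such errors; the main terms avoid the
  factor 8 because they lie in the embedded copy of \<open>ell2\<close>. Second, weakly null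
  sequences have to be handled in nonlinear coordinates. They are taken to be bounded sequences
  whose coordinates tend to 0; operators preserve them because linear coordinates are values of the
  symplectic form and every operator has a symplectic adjoint. Finally, \<open>omega\<close>, the
  form, \<open>Lambda\<close> and both adjoints are definite descriptions, so each of them needs
  existence together with uniqueness. The fact that the kernel of \<open>Lambda\<close> is the ideal
  of strictly singular operators is proved here as well.\<close>

lemma scnj_0 [simp]: "scnj 0 = (0::'k::rc_field)"
  using scnj_add[of 0 "0::'k"] by simp

lemma scnj_minus [simp]: "scnj (- x) = - scnj (x::'k::rc_field)"
  using scnj_add[of x "- x"] by (simp add: eq_neg_iff_add_eq_0 add.commute)

lemma scnj_diff: "scnj (x - y) = scnj x - scnj (y::'k::rc_field)"
  using scnj_add[of x "- y"] by simp

text \<open>The class postulates only additivity and \<open>mult_scnj\<close>; cancelling a nonzero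
  factor in \<open>mult_scnj\<close> yields this law, and likewise that \<open>scnj\<close> is
  involutive, multiplicative and fixes real scalars.\<close>

lemma norm_scnj [simp]: "norm (scnj x) = norm (x::'k::rc_field)"
proof (cases "x = 0")
  case False
  have "norm x * norm (scnj x) = norm x * norm x"
    using arg_cong[OF mult_scnj[of x], of norm] by (simp add: norm_mult power2_eq_square)
  with False show ?thesis by simp
qed simp

lemma scnj_scnj [simp]: "scnj (scnj x) = (x::'k::rc_field)"
proof (cases "x = 0")
  case False
  then have nz: "scnj x \<noteq> 0" by (metis norm_scnj norm_eq_zero)
  have "scnj x * scnj (scnj x) = scnj x * x"
    using mult_scnj[of "scnj x"] mult_scnj[of x] by (simp add: mult.commute)
  with nz show ?thesis by simp
qed simp

lemma scnj_mult: "scnj (x * y) = scnj x * scnj (y::'k::rc_field)"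
proof (cases "x = 0 \<or> y = 0")
  case False
  have "(x * y) * scnj (x * y) = (x * scnj x) * (y * scnj y)"
    unfolding mult_scnj by (simp add: norm_mult power_mult_distrib)
  also have "\<dots> = (x * y) * (scnj x * scnj y)" by (simp add: mult_ac)
  finally show ?thesis using False by simp
qed auto

lemma scnj_of_real [simp]: "scnj (of_real r) = (of_real r :: 'k::rc_field)"
proof (cases "r = 0")
  case False
  have "of_real r * scnj (of_real r) = (of_real r * of_real r :: 'k)"
    unfolding mult_scnj by (simp add: scaleR_conv_of_real power2_eq_square)
  with False show ?thesis by simp
qed simp

lemma scnj_1 [simp]: "scnj 1 = (1::'k::rc_field)"
  using scnj_of_real[of 1] by simp

lemma scnj_scaleR: "scnj (r *\<^sub>R x) = r *\<^sub>R scnj (x::'k::rc_field)"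
  by (simp add: scaleR_conv_of_real scnj_mult)

lemma bounded_linear_scnj: "bounded_linear (scnj :: 'k::rc_field \<Rightarrow> 'k)"
  by (rule bounded_linear_intro[of _ 1]) (simp_all add: scnj_add scnj_scaleR)

lemmas tendsto_scnj = bounded_linear.tendsto[OF bounded_linear_scnj]

text \<open>The bounds on \<open>a\<close> and \<open>b\<close> are what makes closed balls compact:
  a ball lies in the linear image of a square.\<close>

lemma rc_field_basis:
  obtains i :: "'k::rc_field"
  where "\<And>z. \<exists>a b. z = a *\<^sub>R 1 + b *\<^sub>R i \<and> \<bar>a\<bar> \<le> norm z \<and> \<bar>b\<bar> \<le> norm z"
proof (cases "\<forall>z::'k. \<exists>a. z = a *\<^sub>R 1")
  case True
  \<comment> \<open>In the real case \<open>i = 0\<close> serves.\<close>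
  have "\<exists>a b. z = a *\<^sub>R 1 + b *\<^sub>R 0 \<and> \<bar>a\<bar> \<le> norm z \<and> \<bar>b\<bar> \<le> norm z" for z :: 'k
  proof -
    obtain a where "z = a *\<^sub>R 1" using True by blast
    then show ?thesis by (intro exI[of _ a] exI[of _ 0]) simp
  qed
  then show ?thesis by (rule that)
next
  case False
  then obtain i :: 'k where i: "i * i = - 1" "\<forall>z. \<exists>a b. z = a *\<^sub>R 1 + b *\<^sub>R i"
    using real_or_complex[where 'a='k] by blast
  have "norm i * norm i = 1" using arg_cong[OF i(1), of norm] by (simp add: norm_mult)
  then have "i * scnj i = 1" by (simp add: mult_scnj power2_eq_square)
  moreover have "i * (- i) = 1" using i(1) by simp
  moreover have "i \<noteq> 0" using i(1) by auto
  \<comment> \<open>\<open>scnj i\<close> and \<open>- i\<close> are both inverse to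
    \<open>i\<close>.\<close>
  ultimately have ci: "scnj i = - i" by (metis mult_left_cancel)
  have "\<exists>a b. z = a *\<^sub>R 1 + b *\<^sub>R i \<and> \<bar>a\<bar> \<le> norm z \<and> \<bar>b\<bar> \<le> norm z" for z
  proof -
    obtain a b where z: "z = a *\<^sub>R 1 + b *\<^sub>R i" using i(2) by blast
    have "(of_real a + of_real b * i) * (of_real a - of_real b * i)
        = of_real a * of_real a - of_real b * of_real b * (i * i)"
      by (simp add: algebra_simps)
    then have "z * scnj z = of_real (a\<^sup>2 + b\<^sup>2)"
      unfolding z using i(1) by (simp add: scaleR_conv_of_real scnj_add scnj_mult ci power2_eq_square)
    then have "(norm z)\<^sup>2 = a\<^sup>2 + b\<^sup>2"
      unfolding mult_scnj by (simp add: scaleR_conv_of_real flip: of_real_power of_real_add)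
    then have "\<bar>a\<bar> \<le> norm z" "\<bar>b\<bar> \<le> norm z"
      by (simp_all add: abs_le_square_iff[of _ "norm z", simplified])
    then show ?thesis using z by blast
  qed
  then show ?thesis by (rule that)
qed

lemma compact_cball_rc_field: "compact (cball 0 r :: 'k::rc_field set)"
proof -
  obtain i :: 'k where i: "\<And>z. \<exists>a b. z = a *\<^sub>R 1 + b *\<^sub>R i \<and> \<bar>a\<bar> \<le> norm z \<and> \<bar>b\<bar> \<le> norm z"
    by (rule rc_field_basis) blast
  define S where "S = (\<lambda>(a, b). a *\<^sub>R 1 + b *\<^sub>R i) ` ({-r..r} \<times> {-r..r})"
  have "compact S" unfolding S_def
    by (intro compact_continuous_image compact_Times compact_Icc)
      (auto intro!: continuous_intros simp: case_prod_unfold)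
  moreover have "cball 0 r \<subseteq> S"
  proof
    fix z :: 'k assume z: "z \<in> cball 0 r"
    obtain a b where ab: "z = a *\<^sub>R 1 + b *\<^sub>R i" "\<bar>a\<bar> \<le> norm z" "\<bar>b\<bar> \<le> norm z"
      using i by blast
    with z have "(a, b) \<in> {-r..r} \<times> {-r..r}" by auto
    with ab(1) show "z \<in> S" unfolding S_def by force
  qed
  ultimately show ?thesis
    using compact_Int_closed[of S "cball 0 r"] by (simp add: Int_absorb1)
qed

instance rc_field \<subseteq> heine_borel
proof
  fix f :: "nat \<Rightarrow> 'a" assume "bounded (range f)"
  then obtain r where "\<And>n. norm (f n) \<le> r" by (auto simp: bounded_iff)
  then have "\<forall>n. f n \<in> cball 0 r" by simp
  then show "\<exists>l r. strict_mono r \<and> (f \<circ> r) \<longlonglongrightarrow> l"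
    using compact_imp_seq_compact[OF compact_cball_rc_field[of r]]
    unfolding seq_compact_def by blast
qed

instance rc_field \<subseteq> banach ..

text \<open>An ultrafilter without singletons contains the complement of every point, hence every
  cofinite set. Ordinary limits are therefore limits along \<open>U\<close>.\<close>

lemma ultrafilter_le_sequentially:
  assumes "nontrivial_ultrafilter U" shows "U \<le> sequentially"
proof (rule filter_leI)
  fix P :: "nat \<Rightarrow> bool" assume "eventually P sequentially"
  then obtain N where N: "\<And>n. n \<ge> N \<Longrightarrow> P n" by (auto simp: eventually_sequentially)
  have ne: "eventually (\<lambda>m. m \<noteq> n) U" for n
    using assms unfolding nontrivial_ultrafilter_def by blast
  have "eventually (\<lambda>m. \<forall>n\<in>{..<N}. m \<noteq> n) U"
    by (rule eventually_ball_finite) (auto simp: ne)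
  then show "eventually P U"
  proof (rule eventually_mono)
    fix m assume "\<forall>n\<in>{..<N}. m \<noteq> n"
    then have "\<not> m < N" by blast
    then show "P m" using N by simp
  qed
qed

lemma ultrafilter_tendsto:
  "nontrivial_ultrafilter U \<Longrightarrow> f \<longlonglongrightarrow> l \<Longrightarrow> (f \<longlongrightarrow> l) U"
  using tendsto_mono[OF ultrafilter_le_sequentially] .

text \<open>Turns an event of \<open>U\<close> into one that occurs arbitrarily late, the form in
  which \<open>gliding_hump\<close> takes its side condition \<open>Q\<close>.\<close>

lemma ultrafilter_frequently:
  assumes "nontrivial_ultrafilter U" "eventually P U"
  shows "\<exists>n\<ge>m. P n"
proof -
  have "eventually (\<lambda>n. n \<ge> m) U"
    by (rule filter_leD[OF ultrafilter_le_sequentially[OF assms(1)] eventually_ge_at_top])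
  with assms(2) have "eventually (\<lambda>n. n \<ge> m \<and> P n) U" by (simp add: eventually_conj_iff)
  moreover have "U \<noteq> bot" using assms(1) by (simp add: nontrivial_ultrafilter_def)
  ultimately show ?thesis using eventually_happens[of "\<lambda>n. n \<ge> m \<and> P n" U] by simp
qed

text \<open>The image filter has a cluster point in the compact closure of the range, and for an
  ultrafilter a cluster point is a limit. Hence \<open>Lim U f\<close> is a genuine limit.\<close>

lemma ultrafilter_tendsto_Lim:
  fixes f :: "nat \<Rightarrow> 'a::heine_borel"
  assumes U: "nontrivial_ultrafilter U" and b: "bounded (range f)"
  shows "(f \<longlongrightarrow> Lim U f) U"
proof -
  have nb: "U \<noteq> bot" using U by (simp add: nontrivial_ultrafilter_def)
  define C where "C = closure (range f)"
  have "compact C" using b by (simp add: C_def compact_closure)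
  moreover have "eventually (\<lambda>x. x \<in> C) (filtermap f U)"
    by (simp add: eventually_filtermap C_def closure_subset[THEN subsetD])
  moreover have "filtermap f U \<noteq> bot" using nb by (simp add: filtermap_bot_iff)
  ultimately obtain l where l: "inf (nhds l) (filtermap f U) \<noteq> bot"
    unfolding compact_filter by blast
  have "(f \<longlongrightarrow> l) U"
  proof (rule topological_tendstoI)
    fix S assume S: "open S" "l \<in> S"
    show "eventually (\<lambda>x. f x \<in> S) U"
    proof (rule ccontr)
      assume "\<not> ?thesis"
      then have "eventually (\<lambda>x. f x \<notin> S) U"
        using U unfolding nontrivial_ultrafilter_def by blast
      then have "eventually (\<lambda>x. x \<notin> S) (filtermap f U)" by (simp add: eventually_filtermap)
      moreover have "eventually (\<lambda>x. x \<in> S) (nhds l)" using S by (simp add: eventually_nhds_in_open)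
      ultimately have "eventually (\<lambda>x. False) (inf (nhds l) (filtermap f U))"
        unfolding eventually_inf by blast
      with l show False by (simp add: trivial_limit_def)
    qed
  qed
  then show ?thesis using tendsto_Lim[OF nb] by metis
qed

section \<open>The Hilbert space of square summable sequences\<close>

text \<open>A type copy of \<open>ell2\<close>, so that the theory of real Banach spaces applies to
  its elements.\<close>

typedef (overloaded) 'k l2 = "ell2 :: (nat \<Rightarrow> 'k::rc_field) set"
  morphisms l2_nth Abs_l2
  using ell2_zero(1) by blast

setup_lifting type_definition_l2

lemma l2_eqI: "(\<And>n. l2_nth x n = l2_nth y n) \<Longrightarrow> x = y"
  by (simp add: l2_nth_inject[symmetric] fun_eq_iff)

lemma ell2_norm_eq_0_iff: "x \<in> ell2 \<Longrightarrow> ell2_norm x = 0 \<longleftrightarrow> x = (\<lambda>n. 0)"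
  using ell2_norm_eq_0D[of x] ell2_zero(2) by (metis ext)

instantiation l2 :: (rc_field) real_normed_vector
begin

lift_definition zero_l2 :: "'a l2" is "\<lambda>n. 0" by (rule ell2_zero)
lift_definition plus_l2 :: "'a l2 \<Rightarrow> 'a l2 \<Rightarrow> 'a l2" is "\<lambda>x y n. x n + y n" by (rule ell2_add)
lift_definition minus_l2 :: "'a l2 \<Rightarrow> 'a l2 \<Rightarrow> 'a l2" is "\<lambda>x y n. x n - y n" by (rule ell2_diff)
lift_definition uminus_l2 :: "'a l2 \<Rightarrow> 'a l2" is "\<lambda>x n. - x n"
  using ell2_scale(1)[of _ "- 1"] by simp
lift_definition scaleR_l2 :: "real \<Rightarrow> 'a l2 \<Rightarrow> 'a l2" is "\<lambda>r x n. r *\<^sub>R x n"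
  unfolding scaleR_conv_of_real by (rule ell2_scale)
lift_definition norm_l2 :: "'a l2 \<Rightarrow> real" is ell2_norm .

definition dist_l2 :: "'a l2 \<Rightarrow> 'a l2 \<Rightarrow> real" where "dist_l2 x y = norm (x - y)"
definition sgn_l2 :: "'a l2 \<Rightarrow> 'a l2" where "sgn_l2 x = scaleR (inverse (norm x)) x"
definition uniformity_l2 :: "('a l2 \<times> 'a l2) filter" where
  "uniformity_l2 = (INF e\<in>{0 <..}. principal {(x, y). dist x y < e})"
definition open_l2 :: "'a l2 set \<Rightarrow> bool" where
  "open_l2 S = (\<forall>x\<in>S. \<forall>\<^sub>F (x', y) in uniformity. x' = x \<longrightarrow> y \<in> S)"

instance
proof
  fix x y z :: "'a l2" and a b :: real
  show "norm (x + y) \<le> norm x + norm y" by transfer (rule ell2_add)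
  show "norm (a *\<^sub>R x) = \<bar>a\<bar> * norm x"
    by transfer (simp add: scaleR_conv_of_real ell2_scale)
  show "norm x = 0 \<longleftrightarrow> x = 0" by transfer (rule ell2_norm_eq_0_iff)
qed ((simp only: dist_l2_def sgn_l2_def uniformity_l2_def open_l2_def; fail)
      | (transfer; simp add: algebra_simps; fail))+

end

lift_definition l2_scale :: "'k::rc_field \<Rightarrow> 'k l2 \<Rightarrow> 'k l2" is "\<lambda>c x n. c * x n"
  by (rule ell2_scale)

lift_definition l2_inner :: "'k::rc_field l2 \<Rightarrow> 'k l2 \<Rightarrow> 'k" is ell2_inner .

lemma l2_nth_simps [simp]:
  "l2_nth 0 n = 0" "l2_nth (x + y) n = l2_nth x n + l2_nth y n"
  "l2_nth (x - y) n = l2_nth x n - l2_nth y n" "l2_nth (- x) n = - l2_nth x n"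
  "l2_nth (r *\<^sub>R x) n = r *\<^sub>R l2_nth x n" "l2_nth (l2_scale c x) n = c * l2_nth x n"
  by (transfer; simp)+

global_interpretation l2: vector_space "l2_scale :: 'k::rc_field \<Rightarrow> 'k l2 \<Rightarrow> 'k l2"
  by standard (auto intro!: l2_eqI simp: algebra_simps)

lemma l2_nth_sum [simp]: "l2_nth (sum f A) n = (\<Sum>i\<in>A. l2_nth (f i) n)"
  by (induction A rule: infinite_finite_induct) auto

lemma norm_l2_scale [simp]: "norm (l2_scale c x) = norm c * norm x"
  by transfer (rule ell2_scale)

lemma scaleR_l2_conv: "r *\<^sub>R x = l2_scale (of_real r) (x::'k::rc_field l2)"
  by (rule l2_eqI) (simp add: scaleR_conv_of_real)

lemma norm_l2_nth_le: "norm (l2_nth x n) \<le> norm x"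
  by transfer (rule ell2_coord_le)

lemma l2_summable: "summable (\<lambda>n. (norm (l2_nth x n))\<^sup>2)"
  using l2_nth[of x] by (simp add: ell2_def)

lemma norm_l2_power2: "(norm x)\<^sup>2 = (\<Sum>n. (norm (l2_nth x n))\<^sup>2)"
proof -
  have "0 \<le> (\<Sum>n. (norm (l2_nth x n))\<^sup>2)" by (intro suminf_nonneg l2_summable) auto
  then show ?thesis by (simp add: norm_l2.rep_eq ell2_norm_def)
qed

lemma norm_l2_le_dom: "(\<And>n. norm (l2_nth x n) \<le> norm (l2_nth y n)) \<Longrightarrow> norm x \<le> norm y"
  unfolding norm_l2.rep_eq by (rule ell2_dom(2)[OF l2_nth])

lemma l2_boundI:
  assumes "\<And>N. L2_set (\<lambda>n. norm (l2_nth x n)) {..<N} \<le> K" shows "norm x \<le> K"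
  unfolding norm_l2.rep_eq by (rule ell2_boundI(2)[OF assms])

lemma L2_set_l2_le: "L2_set (\<lambda>n. norm (l2_nth x n)) {..<N} \<le> norm x"
  unfolding norm_l2.rep_eq by (rule ell2_L2_set_le[OF l2_nth])

text \<open>The coordinatewise limit is compared with \<open>X m\<close> on finite sections,
  uniformly in their length \<open>N\<close>; this gives square summability and norm convergence at
  once.\<close>

instance l2 :: (rc_field) banach
proof
  fix X :: "nat \<Rightarrow> 'a l2" assume X: "Cauchy X"
  have bl: "bounded_linear (\<lambda>x. l2_nth x i)" for i
    by (auto intro!: bounded_linear_intro[of _ 1] norm_l2_nth_le)
  have "convergent (\<lambda>n. l2_nth (X n) i)" for i
    by (rule Cauchy_convergent) (rule bounded_linear.Cauchy[OF bl X])
  then obtain y where y: "\<And>i. (\<lambda>n. l2_nth (X n) i) \<longlonglongrightarrow> y i"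
    unfolding convergent_def by metis
  have key: "\<exists>M. \<forall>m\<ge>M. \<forall>N. L2_set (\<lambda>i. norm (l2_nth (X m) i - y i)) {..<N} \<le> e" if e: "0 < e" for e
  proof -
    obtain M where M: "\<And>m n. m \<ge> M \<Longrightarrow> n \<ge> M \<Longrightarrow> norm (X m - X n) < e"
      using X e unfolding Cauchy_iff by blast
    have "L2_set (\<lambda>i. norm (l2_nth (X m) i - y i)) {..<N} \<le> e" if m: "m \<ge> M" for m N
    proof (rule tendsto_upperbound)
      show "(\<lambda>n. L2_set (\<lambda>i. norm (l2_nth (X m) i - l2_nth (X n) i)) {..<N}) \<longlonglongrightarrow>
        L2_set (\<lambda>i. norm (l2_nth (X m) i - y i)) {..<N}"
        unfolding L2_set_def by (intro tendsto_intros y)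
      show "\<forall>\<^sub>F n in sequentially. L2_set (\<lambda>i. norm (l2_nth (X m) i - l2_nth (X n) i)) {..<N} \<le> e"
        unfolding eventually_sequentially
      proof (intro exI[of _ M] allI impI)
        fix n assume "n \<ge> M"
        then show "L2_set (\<lambda>i. norm (l2_nth (X m) i - l2_nth (X n) i)) {..<N} \<le> e"
          using L2_set_l2_le[of "X m - X n" N] M[OF m, of n] by simp
      qed
    qed simp
    then show ?thesis by blast
  qed
  obtain M where M: "\<And>m N. m \<ge> M \<Longrightarrow> L2_set (\<lambda>i. norm (l2_nth (X m) i - y i)) {..<N} \<le> 1"
    using key[of 1] by auto
  have "(\<lambda>i. l2_nth (X M) i - y i) \<in> ell2" by (rule ell2_boundI(1)[OF M]) simp
  from ell2_diff(1)[OF l2_nth[of "X M"] this] have y2: "y \<in> ell2" by simp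
  define Y where "Y = Abs_l2 y"
  have nY: "l2_nth Y = y" by (simp add: Y_def Abs_l2_inverse y2)
  have "X \<longlonglongrightarrow> Y"
  proof (rule LIMSEQ_I)
    fix r :: real assume r: "0 < r"
    obtain M where "\<And>m N. m \<ge> M \<Longrightarrow> L2_set (\<lambda>i. norm (l2_nth (X m) i - y i)) {..<N} \<le> r/2"
      using key[of "r/2"] r by auto
    then have "norm (X m - Y) \<le> r/2" if "m \<ge> M" for m
      by (intro l2_boundI) (simp add: nY that)
    then show "\<exists>no. \<forall>n\<ge>no. norm (X n - Y) < r" using r by force
  qed
  then show "convergent X" by (auto simp: convergent_def)
qed

lemma summable_l2_mult: "summable (\<lambda>n. norm (l2_nth x n) * norm (l2_nth y n))"
  and suminf_l2_mult_le: "(\<Sum>n. norm (l2_nth x n) * norm (l2_nth y n)) \<le> norm x * norm y"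
proof -
  have b: "(\<Sum>n<N. norm (l2_nth x n) * norm (l2_nth y n)) \<le> norm x * norm y" for N
  proof -
    have "(\<Sum>n<N. norm (l2_nth x n) * norm (l2_nth y n))
        \<le> L2_set (\<lambda>n. norm (l2_nth x n)) {..<N} * L2_set (\<lambda>n. norm (l2_nth y n)) {..<N}"
      using L2_set_mult_ineq[of "\<lambda>n. norm (l2_nth x n)" "\<lambda>n. norm (l2_nth y n)" "{..<N}"] by simp
    also have "\<dots> \<le> norm x * norm y"
      by (intro mult_mono L2_set_l2_le) (auto simp: L2_set_nonneg)
    finally show ?thesis .
  qed
  show s: "summable (\<lambda>n. norm (l2_nth x n) * norm (l2_nth y n))"
    by (rule summableI_nonneg_bounded[OF _ b]) auto
  show "(\<Sum>n. norm (l2_nth x n) * norm (l2_nth y n)) \<le> norm x * norm y"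
    by (rule suminf_le_const[OF s b])
qed

lemma summable_l2_inner: "summable (\<lambda>n. l2_nth x n * scnj (l2_nth y n))"
  by (rule summable_norm_cancel) (simp add: norm_mult summable_l2_mult)

lemma l2_inner_eq: "l2_inner x y = (\<Sum>n. l2_nth x n * scnj (l2_nth y n))"
  by (simp add: l2_inner.rep_eq ell2_inner_def)

lemma norm_l2_inner_le: "norm (l2_inner x y) \<le> norm x * norm y"
proof -
  have "norm (l2_inner x y) \<le> (\<Sum>n. norm (l2_nth x n) * norm (l2_nth y n))"
    unfolding l2_inner_eq using summable_norm[of "\<lambda>n. l2_nth x n * scnj (l2_nth y n)"]
    by (simp add: norm_mult summable_l2_mult)
  then show ?thesis using suminf_l2_mult_le[of x y] by linarith
qed

lemma l2_inner_commute: "l2_inner y x = scnj (l2_inner x y)"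
proof -
  have "scnj (l2_inner x y) = (\<Sum>n. scnj (l2_nth x n * scnj (l2_nth y n)))"
    unfolding l2_inner_eq
    by (rule bounded_linear.suminf[OF bounded_linear_scnj summable_l2_inner])
  then show ?thesis by (simp add: l2_inner_eq scnj_mult mult.commute)
qed

lemma l2_inner_add_left: "l2_inner (x + y) z = l2_inner x z + l2_inner y z"
  unfolding l2_inner_eq by (simp add: suminf_add summable_l2_inner algebra_simps)

lemma l2_inner_scale_left: "l2_inner (l2_scale c x) y = c * l2_inner x y"
  unfolding l2_inner_eq by (simp add: suminf_mult summable_l2_inner mult.assoc)

lemma l2_inner_add_right: "l2_inner x (y + z) = l2_inner x y + l2_inner x z"
  by (simp add: l2_inner_commute[of x] l2_inner_add_left scnj_add)

lemma l2_inner_0 [simp]: "l2_inner 0 x = 0" "l2_inner x 0 = 0"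
  by (simp_all add: l2_inner_eq)

lemma l2_inner_minus: "l2_inner (- x) y = - l2_inner x y" "l2_inner x (- y) = - l2_inner x y"
  by (simp_all add: l2_inner_eq suminf_minus summable_l2_inner)

lemma l2_inner_diff:
  "l2_inner (x - y) z = l2_inner x z - l2_inner y z" "l2_inner x (y - z) = l2_inner x y - l2_inner x z"
  using l2_inner_add_left[of x "- y" z] l2_inner_add_right[of x y "- z"]
  by (simp_all add: l2_inner_minus)

lemma l2_inner_self: "l2_inner x x = of_real ((norm x)\<^sup>2)"
  unfolding l2_inner_eq norm_l2_power2 mult_scnj
  by (simp add: suminf_of_real l2_summable scaleR_conv_of_real)

lift_definition l2_proj :: "nat set \<Rightarrow> 'k::rc_field l2 \<Rightarrow> 'k l2" is "\<lambda>I x n. if n \<in> I then x n else 0"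
  by (erule ell2_dom(1)) auto

lift_definition l2_e :: "nat \<Rightarrow> 'k::rc_field l2" is "\<lambda>n m. if m = n then 1 else 0"
  unfolding ell2_def mem_Collect_eq by (rule summable_finite[of "{n}" for n]) auto

lemma l2_nth_proj [simp]: "l2_nth (l2_proj I x) n = (if n \<in> I then l2_nth x n else 0)"
  by transfer simp

lemma l2_nth_e [simp]: "l2_nth (l2_e n) m = (if m = n then 1 else 0)"
  by transfer simp

lemma l2_proj_0 [simp]: "l2_proj I 0 = 0"
  by (rule l2_eqI) simp

lemma norm_l2_proj_le: "norm (l2_proj I x) \<le> norm x"
  by (rule norm_l2_le_dom) auto

lemma norm_l2_power2_add:
  assumes "\<And>n. l2_nth x n = 0 \<or> l2_nth y n = 0"
  shows "(norm (x + y))\<^sup>2 = (norm x)\<^sup>2 + (norm y)\<^sup>2"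
proof -
  have "(norm (l2_nth (x + y) n))\<^sup>2 = (norm (l2_nth x n))\<^sup>2 + (norm (l2_nth y n))\<^sup>2" for n
    using assms[of n] by auto
  then show ?thesis unfolding norm_l2_power2 by (simp add: suminf_add l2_summable)
qed

lemma norm_l2_power2_sum:
  assumes "finite A" "\<And>j k n. j \<in> A \<Longrightarrow> k \<in> A \<Longrightarrow> j \<noteq> k \<Longrightarrow> l2_nth (f j) n = 0 \<or> l2_nth (f k) n = 0"
  shows "(norm (\<Sum>k\<in>A. f k))\<^sup>2 = (\<Sum>k\<in>A. (norm (f k))\<^sup>2)"
  using assms
proof (induction A rule: finite_induct)
  case (insert j A)
  have "l2_nth (f j) n = 0 \<or> l2_nth (\<Sum>k\<in>A. f k) n = 0" for n
  proof (cases "l2_nth (f j) n = 0")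
    case False
    then have "\<forall>k\<in>A. l2_nth (f k) n = 0" using insert.prems[of j] insert.hyps by blast
    then show ?thesis by simp
  qed simp
  from norm_l2_power2_add[OF this] insert show ?case by simp
qed simp

lemma norm_l2_proj_split: "(norm x)\<^sup>2 = (norm (l2_proj I x))\<^sup>2 + (norm (x - l2_proj I x))\<^sup>2"
  using norm_l2_power2_add[of "l2_proj I x" "x - l2_proj I x"] by simp

lemma norm_l2_diff_proj_le: "norm (x - l2_proj I x) \<le> norm x"
  by (rule norm_l2_le_dom) auto

lemma norm_l2_e [simp]: "norm (l2_e n :: 'k::rc_field l2) = 1"
proof -
  have "(\<lambda>m. (norm (l2_nth (l2_e n :: 'k l2) m))\<^sup>2) = (\<lambda>m. if m = n then 1 else 0)" by auto
  then have "(norm (l2_e n :: 'k l2))\<^sup>2 = 1"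
    unfolding norm_l2_power2 using sums_single[of n "\<lambda>_. 1::real", THEN sums_unique] by simp
  then show ?thesis using power2_eq_imp_eq[of "norm (l2_e n :: 'k l2)" 1] by simp
qed

lemma l2_inner_e: "l2_inner x (l2_e n) = l2_nth x n" "l2_inner (l2_e n) x = scnj (l2_nth x n)"
proof -
  have "(\<lambda>m. l2_nth x m * scnj (l2_nth (l2_e n) m)) = (\<lambda>m. if m = n then l2_nth x m else 0)" by auto
  then show "l2_inner x (l2_e n) = l2_nth x n"
    unfolding l2_inner_eq using sums_single[of n "l2_nth x", THEN sums_unique] by simp
  then show "l2_inner (l2_e n) x = scnj (l2_nth x n)" by (simp add: l2_inner_commute[of "l2_e n"])
qed

lemma l2_proj_lessThan: "l2_proj {..<N} x = (\<Sum>n<N. l2_scale (l2_nth x n) (l2_e n))"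
  by (rule l2_eqI) (simp add: if_distrib[of "(*) _"] cong: if_cong)

lemma norm_l2_proj_lessThan: "(norm (l2_proj {..<N} x))\<^sup>2 = (\<Sum>n<N. (norm (l2_nth x n))\<^sup>2)"
  unfolding l2_proj_lessThan by (subst norm_l2_power2_sum) auto

lemma l2_proj_tendsto: "(\<lambda>N. l2_proj {..<N} x) \<longlonglongrightarrow> x"
proof -
  have "(\<lambda>N. (norm (l2_proj {..<N} x))\<^sup>2) \<longlonglongrightarrow> (norm x)\<^sup>2"
    unfolding norm_l2_proj_lessThan norm_l2_power2[of x] by (rule summable_LIMSEQ[OF l2_summable])
  then have "(\<lambda>N. (norm x)\<^sup>2 - (norm (l2_proj {..<N} x))\<^sup>2) \<longlonglongrightarrow> (norm x)\<^sup>2 - (norm x)\<^sup>2"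
    by (intro tendsto_diff tendsto_const)
  moreover have "(norm x)\<^sup>2 - (norm (l2_proj {..<N} x))\<^sup>2 = (norm (x - l2_proj {..<N} x))\<^sup>2" for N
    using norm_l2_proj_split[of x "{..<N}"] by simp
  ultimately have "(\<lambda>N. sqrt ((norm (x - l2_proj {..<N} x))\<^sup>2)) \<longlonglongrightarrow> sqrt 0"
    by (intro tendsto_real_sqrt) simp
  then have "(\<lambda>N. norm (l2_proj {..<N} x - x)) \<longlonglongrightarrow> 0" by (simp add: norm_minus_commute)
  then show ?thesis by (rule LIM_zero_cancel[OF tendsto_norm_zero_cancel])
qed

section \<open>Weakly null sequences and gliding humps\<close>

text \<open>In \<open>ell2\<close> this is weak convergence to 0, stated through coordinates because
  gliding humps involve only finitely many of them at a time.\<close>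

definition l2_null :: "(nat \<Rightarrow> 'k::rc_field l2) \<Rightarrow> bool" where
  "l2_null x \<longleftrightarrow> (\<exists>C. \<forall>n. norm (x n) \<le> C) \<and> (\<forall>i. (\<lambda>n. l2_nth (x n) i) \<longlonglongrightarrow> 0)"

lemma l2_null_subseq: "l2_null x \<Longrightarrow> strict_mono r \<Longrightarrow> l2_null (\<lambda>k. x (r k))"
  unfolding l2_null_def using LIMSEQ_subseq_LIMSEQ[of "\<lambda>n. l2_nth (x n) _" 0 r] by (auto simp: o_def)

lemma l2_null_e: "l2_null l2_e"
  unfolding l2_null_def
proof (intro conjI allI exI[of _ 1])
  fix i show "(\<lambda>n. l2_nth (l2_e n) i) \<longlonglongrightarrow> (0::'a)"
    by (rule tendsto_eventually) (auto simp: eventually_sequentially intro!: exI[of _ "Suc i"])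
qed simp

lemma l2_null_proj_tendsto:
  assumes "l2_null x" shows "(\<lambda>n. l2_proj {..<N} (x n)) \<longlonglongrightarrow> 0"
proof -
  have "(\<lambda>n. l2_scale (l2_nth (x n) i) (l2_e i)) \<longlonglongrightarrow> 0" for i
  proof (rule tendsto_norm_zero_cancel)
    show "(\<lambda>n. norm (l2_scale (l2_nth (x n) i) (l2_e i))) \<longlonglongrightarrow> 0"
      using assms unfolding l2_null_def by (simp add: tendsto_norm_zero)
  qed
  then show ?thesis unfolding l2_proj_lessThan by (intro tendsto_null_sum) simp
qed

text \<open>The vectors may be zero or leave part of their interval empty; this lets a subsequence
  be a block sequence again, for longer intervals.\<close>

definition blocks :: "(nat \<Rightarrow> nat) \<Rightarrow> (nat \<Rightarrow> 'k::rc_field l2) \<Rightarrow> bool" where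
  "blocks N w \<longleftrightarrow> strict_mono N \<and> (\<forall>k i. i \<notin> {N k..<N (Suc k)} \<longrightarrow> l2_nth (w k) i = 0)"

lemma strict_mono_blocks_disjoint:
  assumes "strict_mono (N :: nat \<Rightarrow> nat)" "j < k" "i < N (Suc j)" shows "\<not> N k \<le> i"
  using strict_mono_less_eq[OF assms(1), of "Suc j" k] assms by simp

lemma blocks_disjoint:
  assumes "blocks N v" "blocks N w" "j \<noteq> k"
  shows "l2_nth (v j) i = 0 \<or> l2_nth (w k) i = 0"
  using assms strict_mono_blocks_disjoint[of N] unfolding blocks_def
  by (metis atLeastLessThan_iff linorder_neqE_nat)

lemma blocks_subseq:
  assumes "blocks N w" "strict_mono r" shows "blocks (\<lambda>k. N (r k)) (\<lambda>k. w (r k))"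
  unfolding blocks_def
proof (intro conjI allI impI)
  show "strict_mono (\<lambda>k. N (r k))" using assms by (auto simp: blocks_def strict_mono_def)
  fix k i assume i: "i \<notin> {N (r k)..<N (r (Suc k))}"
  have "N (Suc (r k)) \<le> N (r (Suc k))"
    using assms unfolding blocks_def by (metis Suc_leI lessI strict_mono_less strict_mono_less_eq)
  with i have "i \<notin> {N (r k)..<N (Suc (r k))}" by auto
  then show "l2_nth (w (r k)) i = 0" using assms by (simp add: blocks_def)
qed

lemma blocks_proj: "strict_mono N \<Longrightarrow> blocks N (\<lambda>k. l2_proj {N k..<N (Suc k)} (x k))"
  by (simp add: blocks_def)

lemma blocks_scale: "blocks N w \<Longrightarrow> blocks N (\<lambda>k. l2_scale (c k) (w k))"
  by (simp add: blocks_def)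

lemma blocks_diff: "blocks N v \<Longrightarrow> blocks N w \<Longrightarrow> blocks N (\<lambda>k. v k - w k)"
  by (simp add: blocks_def)

lemma blocks_norm_sum:
  assumes "blocks N w" "finite A"
  shows "(norm (\<Sum>k\<in>A. w k))\<^sup>2 = (\<Sum>k\<in>A. (norm (w k))\<^sup>2)"
  using norm_l2_power2_sum[OF assms(2)] blocks_disjoint[OF assms(1,1)] by blast

lemma blocks_norm_sum_le:
  assumes "blocks N w" "\<And>k. norm (w k) \<le> C"
  shows "norm (\<Sum>k<n. w k) \<le> sqrt (real n) * C"
proof -
  have C: "0 \<le> C" using assms(2)[of 0] norm_ge_zero order_trans by blast
  have "(norm (\<Sum>k<n. w k))\<^sup>2 \<le> (\<Sum>k<n. C\<^sup>2)"
    unfolding blocks_norm_sum[OF assms(1) finite_lessThan]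
    by (intro sum_mono power_mono assms) auto
  also have "\<dots> = (sqrt (real n) * C)\<^sup>2" by (simp add: power_mult_distrib)
  finally show ?thesis by (rule power2_le_imp_le) (simp add: C)
qed

lemma blocks_norm_sum_ge:
  assumes "blocks N w" "\<And>k. C \<le> norm (w k)" "0 \<le> C"
  shows "sqrt (real n) * C \<le> norm (\<Sum>k<n. w k)"
proof -
  have "(sqrt (real n) * C)\<^sup>2 = (\<Sum>k<n. C\<^sup>2)" by (simp add: power_mult_distrib)
  also have "\<dots> \<le> (norm (\<Sum>k<n. w k))\<^sup>2"
    unfolding blocks_norm_sum[OF assms(1) finite_lessThan]
    by (intro sum_mono power_mono assms)
  finally show ?thesis by (rule power2_le_imp_le) simp
qed

lemma blocks_null:
  assumes "blocks N w" "\<And>k. norm (w k) \<le> C" shows "l2_null w"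
  unfolding l2_null_def
proof (intro conjI allI)
  show "\<exists>C. \<forall>n. norm (w n) \<le> C" using assms(2) by blast
  fix i
  have "l2_nth (w n) i = 0" if "n > i" for n
  proof -
    have "n \<le> N n" using assms(1) by (simp add: blocks_def strict_mono_imp_increasing)
    then show ?thesis using assms(1) that by (simp add: blocks_def)
  qed
  then show "(\<lambda>n. l2_nth (w n) i) \<longlonglongrightarrow> 0"
    by (intro tendsto_eventually) (auto simp: eventually_sequentially intro!: exI[of _ "Suc i"])
qed

text \<open>Finitely many null sequences become almost blocks along one subsequence and with common
  intervals. The condition \<open>Q\<close>, available arbitrarily late, carries along whatever else
  the subsequence has to satisfy, in particular conditions that hold along \<open>U\<close>.\<close>

lemma gliding_hump:
  fixes f :: "'j \<Rightarrow> nat \<Rightarrow> 'k::rc_field l2"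
  assumes J: "finite J" and null: "\<And>j. j \<in> J \<Longrightarrow> l2_null (f j)" and eta: "\<And>k. 0 < \<eta> k"
    and Q: "\<And>k m. \<exists>n\<ge>m. Q k n"
  obtains r N :: "nat \<Rightarrow> nat" where "strict_mono r" "strict_mono N" "\<And>k. Q k (r k)"
    "\<And>k j. j \<in> J \<Longrightarrow> norm (f j (r k) - l2_proj {N k..<N (Suc k)} (f j (r k))) \<le> \<eta> k"
proof -
  have step: "\<exists>n N'. n > m \<and> N' > N \<and> Q k n \<and>
      (\<forall>j\<in>J. norm (f j n - l2_proj {N..<N'} (f j n)) \<le> \<eta> k)" for k m N
  proof -
    have "\<forall>\<^sub>F n in sequentially. \<forall>j\<in>J. norm (l2_proj {..<N} (f j n)) < \<eta> k / 2"
    proof (rule eventually_ball_finite[OF J ballI])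
      fix j assume "j \<in> J"
      from tendsto_norm_zero[OF l2_null_proj_tendsto[OF null[OF this], of N]]
      show "\<forall>\<^sub>F n in sequentially. norm (l2_proj {..<N} (f j n)) < \<eta> k / 2"
        by (rule order_tendstoD) (use eta[of k] in simp)
    qed
    then obtain n0 where n0: "\<And>n j. n \<ge> n0 \<Longrightarrow> j \<in> J \<Longrightarrow> norm (l2_proj {..<N} (f j n)) < \<eta> k / 2"
      unfolding eventually_sequentially by blast
    \<comment> \<open>Late members are small on the coordinates below \<open>N\<close>. The index
      \<open>n\<close> is fixed before the right end \<open>M\<close> is chosen to cut off the tail;
      each of the two errors takes half of \<open>\<eta> k\<close>.\<close>
    obtain n where n: "n \<ge> max n0 (Suc m)" "Q k n" using Q by blast
    have "\<forall>\<^sub>F M in sequentially. \<forall>j\<in>J. norm (l2_proj {..<M} (f j n) - f j n) < \<eta> k / 2"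
    proof (rule eventually_ball_finite[OF J ballI])
      fix j
      from tendsto_norm_zero[OF LIM_zero[OF l2_proj_tendsto[of "f j n"]]]
      show "\<forall>\<^sub>F M in sequentially. norm (l2_proj {..<M} (f j n) - f j n) < \<eta> k / 2"
        by (rule order_tendstoD) (use eta[of k] in simp)
    qed
    then obtain M0 where M0: "\<And>M j. M \<ge> M0 \<Longrightarrow> j \<in> J \<Longrightarrow> norm (l2_proj {..<M} (f j n) - f j n) < \<eta> k / 2"
      unfolding eventually_sequentially by blast
    define M where "M = max M0 (Suc N)"
    have "norm (f j n - l2_proj {N..<M} (f j n)) \<le> \<eta> k" if j: "j \<in> J" for j
    proof -
      have "f j n - l2_proj {N..<M} (f j n) = l2_proj {..<N} (f j n) - (l2_proj {..<M} (f j n) - f j n)"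
        by (rule l2_eqI) (auto simp: M_def)
      then have "norm (f j n - l2_proj {N..<M} (f j n)) \<le> norm (l2_proj {..<N} (f j n)) + norm (l2_proj {..<M} (f j n) - f j n)"
        by (metis norm_triangle_ineq4)
      also have "\<dots> \<le> \<eta> k / 2 + \<eta> k / 2"
        using n0[of n j] M0[of M j] n(1) j by (intro add_mono) (auto simp: M_def)
      finally show ?thesis by simp
    qed
    moreover have "M > N" by (simp add: M_def)
    ultimately show ?thesis using n by (intro exI[of _ n] exI[of _ M]) auto
  qed
  \<comment> \<open>States are triples of an index and the two ends of its interval;
    \<open>R\<close> makes consecutive intervals adjacent.\<close>
  define P where "P = (\<lambda>k (n, M, M'). Q k n \<and> (M::nat) < M' \<and>
      (\<forall>j\<in>J. norm (f j n - l2_proj {M..<M'} (f j n)) \<le> \<eta> k))"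
  define R where "R = (\<lambda>(n::nat, M::nat, M'::nat) (m, L::nat, L'::nat). n < m \<and> L = M')"
  have "\<exists>x. P 0 x" using step[of 0 0 0] unfolding P_def by auto
  moreover have "\<exists>y. P (Suc k) y \<and> R x y" for x k
  proof -
    obtain n M M' where x: "x = (n, M, M')" by (cases x)
    from step[of n M' "Suc k"] obtain m L where "m > n" "L > M'" "Q (Suc k) m"
      "\<forall>j\<in>J. norm (f j m - l2_proj {M'..<L} (f j m)) \<le> \<eta> (Suc k)" by blast
    then show ?thesis unfolding x P_def R_def by (intro exI[of _ "(m, M', L)"]) simp
  qed
  ultimately obtain g where g: "\<And>k. P k (g k)" "\<And>k. R (g k) (g (Suc k))"
    using dependent_nat_choice[of P "\<lambda>_. R"] by blast
  define r where "r = (\<lambda>k. fst (g k))"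
  define N where "N = (\<lambda>k. fst (snd (g k)))"
  have NS: "snd (snd (g k)) = N (Suc k)" and rS: "r k < r (Suc k)" for k
    using g(2)[of k] by (auto simp: R_def N_def r_def split: prod.splits)
  have P: "Q k (r k)" "N k < N (Suc k)"
    "\<forall>j\<in>J. norm (f j (r k) - l2_proj {N k..<N (Suc k)} (f j (r k))) \<le> \<eta> k" for k
    using g(1)[of k] NS[of k] by (auto simp: P_def N_def r_def split: prod.splits)
  show ?thesis
    by (rule that[of r N]) (use rS P in \<open>auto simp: strict_mono_Suc_iff\<close>)
qed

section \<open>Embeddings of the sequence space along blocks\<close>

text \<open>The k-th block vanishes below \<open>N k\<close>, and \<open>k \<le> N k\<close>; so
  coordinate \<open>i\<close> of the series of all \<open>c k\<close> times \<open>w k\<close>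
  involves only \<open>k \<le> i\<close>, and no convergence question arises in the formula.\<close>

definition block_map :: "(nat \<Rightarrow> 'k::rc_field l2) \<Rightarrow> 'k l2 \<Rightarrow> 'k l2" where
  "block_map w c = Abs_l2 (\<lambda>i. \<Sum>k\<le>i. l2_nth c k * l2_nth (w k) i)"

context
  fixes N and w :: "nat \<Rightarrow> 'k::rc_field l2" and hi
  assumes w: "blocks N w" and hi: "\<And>k. norm (w k) \<le> hi"
begin

lemma block_nth_0: "i < k \<Longrightarrow> l2_nth (w k) i = 0"
  using w strict_mono_imp_increasing[of N k] by (simp add: blocks_def)

lemma block_sum_power2:
  "(norm (\<Sum>k<M. l2_scale (l2_nth c k) (w k)))\<^sup>2 = (\<Sum>k<M. (norm (l2_nth c k) * norm (w k))\<^sup>2)"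
  using blocks_norm_sum[OF blocks_scale[OF w], of "{..<M}" "l2_nth c"] by simp

lemma block_sum_le: "norm (\<Sum>k<M. l2_scale (l2_nth c k) (w k)) \<le> hi * norm (l2_proj {..<M} c)"
proof -
  have 0: "0 \<le> hi" using hi[of 0] norm_ge_zero order_trans by blast
  have "(norm (\<Sum>k<M. l2_scale (l2_nth c k) (w k)))\<^sup>2 \<le> (\<Sum>k<M. (norm (l2_nth c k) * hi)\<^sup>2)"
    unfolding block_sum_power2 using hi by (intro sum_mono power_mono mult_left_mono) auto
  also have "\<dots> = (hi * norm (l2_proj {..<M} c))\<^sup>2"
    by (simp add: power_mult_distrib norm_l2_proj_lessThan sum_distrib_left mult.commute)
  finally show ?thesis by (rule power2_le_imp_le) (simp add: 0)
qed

text \<open>Below coordinate \<open>M\<close> the series agrees with its \<open>M\<close>-th partial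
  sum, whose norm is controlled by orthogonality of the blocks; hence the formula does define an
  element of \<open>ell2\<close>.\<close>

lemma block_map_nth: "l2_nth (block_map w c) i = (\<Sum>k\<le>i. l2_nth c k * l2_nth (w k) i)"
proof -
  have 0: "0 \<le> hi" using hi[of 0] norm_ge_zero order_trans by blast
  have "L2_set (\<lambda>i. norm (\<Sum>k\<le>i. l2_nth c k * l2_nth (w k) i)) {..<M} \<le> hi * norm c" for M
  proof -
    have "(\<Sum>k\<le>i. l2_nth c k * l2_nth (w k) i) = l2_nth (\<Sum>k<M. l2_scale (l2_nth c k) (w k)) i"
      if "i < M" for i
      using that by (simp, intro sum.mono_neutral_left) (auto simp: block_nth_0)
    then have "L2_set (\<lambda>i. norm (\<Sum>k\<le>i. l2_nth c k * l2_nth (w k) i)) {..<M}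
        = L2_set (\<lambda>i. norm (l2_nth (\<Sum>k<M. l2_scale (l2_nth c k) (w k)) i)) {..<M}"
      by (intro L2_set_cong) auto
    also have "\<dots> \<le> norm (\<Sum>k<M. l2_scale (l2_nth c k) (w k))" by (rule L2_set_l2_le)
    also have "\<dots> \<le> hi * norm c"
      using block_sum_le[of c M] mult_left_mono[OF norm_l2_proj_le[of "{..<M}" c] 0] by linarith
    finally show ?thesis .
  qed
  from ell2_boundI(1)[OF this] show ?thesis by (simp add: block_map_def Abs_l2_inverse)
qed

lemma block_map_add: "block_map w (c + d) = block_map w c + block_map w d"
  by (rule l2_eqI) (simp add: block_map_nth algebra_simps sum.distrib)

lemma block_map_scale: "block_map w (l2_scale a c) = l2_scale a (block_map w c)"
  by (rule l2_eqI) (simp add: block_map_nth algebra_simps sum_distrib_left)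

lemma block_map_e: "block_map w (l2_e k) = w k"
  by (rule l2_eqI) (auto simp: block_map_nth if_distrib[of "\<lambda>x. x * _"] block_nth_0 cong: if_cong)

lemma block_map_nth_block: "i \<in> {N k..<N (Suc k)} \<Longrightarrow> l2_nth (block_map w c) i = l2_nth c k * l2_nth (w k) i"
proof -
  assume i: "i \<in> {N k..<N (Suc k)}"
  have sm: "strict_mono N" using w by (simp add: blocks_def)
  have "k \<le> i" using i strict_mono_imp_increasing[OF sm, of k] by simp
  moreover have "l2_nth (w j) i = 0" if "j \<noteq> k" for j
  proof -
    have "i \<notin> {N j..<N (Suc j)}"
      using i that strict_mono_blocks_disjoint[OF sm] by (metis atLeastLessThan_iff linorder_neqE_nat)
    then show ?thesis using w by (simp add: blocks_def)
  qed
  ultimately have "(\<Sum>j\<le>i. l2_nth c j * l2_nth (w j) i) = (\<Sum>j\<in>{k}. l2_nth c j * l2_nth (w j) i)"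
    by (intro sum.mono_neutral_right) auto
  then show ?thesis by (simp add: block_map_nth)
qed

lemma block_map_nth_0: "(\<And>k. i \<notin> {N k..<N (Suc k)}) \<Longrightarrow> l2_nth (block_map w c) i = 0"
  using w by (simp add: block_map_nth blocks_def)

lemma block_map_proj: "block_map w (l2_proj {..<M} c) = (\<Sum>k<M. l2_scale (l2_nth c k) (w k))"
  unfolding l2_proj_lessThan
  by (induction M) (auto simp: block_map_add block_map_scale block_map_e
      intro: l2_eqI simp: block_map_nth)

lemma block_map_norm_le: "norm (block_map w c) \<le> hi * norm c"
proof (rule l2_boundI)
  fix M
  have 0: "0 \<le> hi" using hi[of 0] norm_ge_zero order_trans by blast
  have "l2_nth (block_map w c) i = l2_nth (\<Sum>k<M. l2_scale (l2_nth c k) (w k)) i" if "i < M" for i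
    using that by (simp add: block_map_nth, intro sum.mono_neutral_left) (auto simp: block_nth_0)
  then have "L2_set (\<lambda>i. norm (l2_nth (block_map w c) i)) {..<M}
      = L2_set (\<lambda>i. norm (l2_nth (\<Sum>k<M. l2_scale (l2_nth c k) (w k)) i)) {..<M}"
    by (intro L2_set_cong) auto
  also have "\<dots> \<le> norm (\<Sum>k<M. l2_scale (l2_nth c k) (w k))" by (rule L2_set_l2_le)
  also have "\<dots> \<le> hi * norm c"
    using block_sum_le[of c M] mult_left_mono[OF norm_l2_proj_le[of "{..<M}" c] 0] by linarith
  finally show "L2_set (\<lambda>i. norm (l2_nth (block_map w c) i)) {..<M} \<le> hi * norm c" .
qed

lemma bounded_linear_block_map: "bounded_linear (block_map w)"
  by (rule bounded_linear_intro[of _ hi])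
    (simp_all add: block_map_add scaleR_l2_conv block_map_scale block_map_norm_le mult.commute)

text \<open>Orthogonality gives the estimate for truncated coefficients, and continuity of
  \<open>block_map\<close> extends it.\<close>

lemma block_map_norm_ge:
  assumes lo: "\<And>k. lo \<le> norm (w k)" "0 \<le> lo"
  shows "lo * norm c \<le> norm (block_map w c)"
proof (rule tendsto_le[OF sequentially_bot])
  show "(\<lambda>M. norm (block_map w (l2_proj {..<M} c))) \<longlonglongrightarrow> norm (block_map w c)"
    by (intro tendsto_norm bounded_linear.tendsto[OF bounded_linear_block_map] l2_proj_tendsto)
  show "(\<lambda>M. lo * norm (l2_proj {..<M} c)) \<longlonglongrightarrow> lo * norm c"
    by (intro tendsto_intros l2_proj_tendsto)
  show "\<forall>\<^sub>F M in sequentially. lo * norm (l2_proj {..<M} c) \<le> norm (block_map w (l2_proj {..<M} c))"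
  proof (rule always_eventually, rule allI)
    fix M
    have "(lo * norm (l2_proj {..<M} c))\<^sup>2 = (\<Sum>k<M. (norm (l2_nth c k) * lo)\<^sup>2)"
      by (simp add: power_mult_distrib norm_l2_proj_lessThan sum_distrib_left mult.commute)
    also have "\<dots> \<le> (norm (block_map w (l2_proj {..<M} c)))\<^sup>2"
      unfolding block_map_proj block_sum_power2 using lo
      by (intro sum_mono power_mono mult_left_mono) auto
    finally show "lo * norm (l2_proj {..<M} c) \<le> norm (block_map w (l2_proj {..<M} c))"
      by (rule power2_le_imp_le) simp
  qed
qed

end

section \<open>Coordinates on the Kalton--Peck space\<close>

lift_definition z2_y :: "'k::rc_field z2 \<Rightarrow> 'k l2" is "\<lambda>(x, y). y"
  by (auto simp: z2_set_def)

text \<open>The coordinate that carries the norm. It is homogeneous but not additive; linear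
  identities are therefore checked on \<open>z2_x\<close> and \<open>z2_y\<close>.\<close>

lift_definition z2_d :: "'k::rc_field z2 \<Rightarrow> 'k l2" is "\<lambda>(x, y) n. x n - Omega y n"
  by (auto simp: z2_set_def)

lift_definition z2_x :: "'k::rc_field z2 \<Rightarrow> nat \<Rightarrow> 'k" is "\<lambda>(x, y). x" .

lift_definition z2_emb :: "'k::rc_field l2 \<Rightarrow> 'k z2" is "\<lambda>x. (x, \<lambda>n. 0)"
  by (simp add: z2_set_def Omega_zero ell2_zero)

text \<open>The homogeneous but nonlinear section of the quotient map \<open>z2_y\<close> that
  defines the twisting.\<close>

lift_definition z2_sec :: "'k::rc_field l2 \<Rightarrow> 'k z2" is "\<lambda>y. (Omega y, y)"
  by (simp add: z2_set_def ell2_zero)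

lift_definition l2_Omega :: "'k::rc_field l2 \<Rightarrow> nat \<Rightarrow> 'k" is Omega .

lemma l2_Omega_eq: "l2_Omega y n = l2_nth y n * of_real (ln (norm y / norm (l2_nth y n)))"
  by transfer (simp add: Omega_def)

lemma l2_Omega_0 [simp]: "l2_Omega 0 n = 0"
  by (simp add: l2_Omega_eq)

lemma l2_Omega_scale: "l2_Omega (l2_scale c y) n = c * l2_Omega y n"
  by transfer (rule Omega_scale)

lemma z2_d_nth: "l2_nth (z2_d u) n = z2_x u n - l2_Omega (z2_y u) n"
  by transfer auto

lemma z2_x_eq: "z2_x u n = l2_nth (z2_d u) n + l2_Omega (z2_y u) n"
  by (simp add: z2_d_nth)

lemma z2_eqI: "(\<And>n. z2_x u n = z2_x v n) \<Longrightarrow> z2_y u = z2_y v \<Longrightarrow> u = v"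
  by transfer (auto simp: fun_eq_iff)

lemma z2_eqI_d: "z2_d u = z2_d v \<Longrightarrow> z2_y u = z2_y v \<Longrightarrow> u = v"
  by (rule z2_eqI) (simp_all add: z2_x_eq)

lemma z2_x_rep: "z2_x u = fst (Rep_z2 u)" and z2_y_rep: "l2_nth (z2_y u) = snd (Rep_z2 u)"
  by (simp_all add: z2_x.rep_eq z2_y.rep_eq split_beta)

lemmas z2_rep_simps = z2_x_rep z2_y_rep zero_z2.rep_eq plus_z2.rep_eq uminus_z2.rep_eq z2_scale.rep_eq
  z2_emb.rep_eq z2_sec.rep_eq split_beta

lemma z2_x_simps [simp]:
  "z2_x 0 n = 0" "z2_x (u + v) n = z2_x u n + z2_x v n" "z2_x (- u) n = - z2_x u n"
  "z2_x (z2_scale c u) n = c * z2_x u n" "z2_x (z2_emb w) n = l2_nth w n"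
  "z2_x (z2_sec y) n = l2_Omega y n"
  by (simp_all add: z2_rep_simps l2_Omega.rep_eq)

lemma z2_y_simps [simp]:
  "z2_y 0 = 0" "z2_y (u + v) = z2_y u + z2_y v" "z2_y (- u) = - z2_y u"
  "z2_y (z2_scale c u) = l2_scale c (z2_y u)" "z2_y (z2_emb w) = 0" "z2_y (z2_sec y) = y"
proof -
  show "z2_y 0 = 0" by (rule l2_eqI) (simp add: z2_rep_simps)
  show "z2_y (u + v) = z2_y u + z2_y v" by (rule l2_eqI) (simp add: z2_rep_simps)
  show "z2_y (- u) = - z2_y u" by (rule l2_eqI) (simp add: z2_rep_simps)
  show "z2_y (z2_scale c u) = l2_scale c (z2_y u)" by (rule l2_eqI) (simp add: z2_rep_simps)
  show "z2_y (z2_emb w) = 0" by (rule l2_eqI) (simp only: z2_y_rep z2_emb.rep_eq snd_conv l2_nth_simps)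
  show "z2_y (z2_sec y) = y" by (rule l2_eqI) (simp only: z2_y_rep z2_sec.rep_eq snd_conv)
qed

lemma z2_xy_diff [simp]: "z2_x (u - v) n = z2_x u n - z2_x v n" "z2_y (u - v) = z2_y u - z2_y v"
  using z2_x_simps(2)[of u "- v"] z2_y_simps(2)[of u "- v"] by simp_all

lemma z2_xy_sum [simp]: "z2_x (sum f A) n = (\<Sum>i\<in>A. z2_x (f i) n)" "z2_y (sum f A) = (\<Sum>i\<in>A. z2_y (f i))"
  by (induction A rule: infinite_finite_induct) auto

lemma z2_d_simps [simp]:
  "z2_d 0 = 0" "z2_d (z2_emb w) = w" "z2_d (z2_sec y) = 0"
  "z2_d (z2_scale c u) = l2_scale c (z2_d u)"
  "z2_d (z2_emb w + u) = w + z2_d u"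
  by (auto intro!: l2_eqI simp: z2_d_nth l2_Omega_scale algebra_simps)

lemma z2_emb_simps [simp]:
  "z2_emb 0 = 0" "z2_emb (v + w) = z2_emb v + z2_emb w" "z2_emb (- w) = - z2_emb w"
  "z2_emb (v - w) = z2_emb v - z2_emb w" "z2_emb (l2_scale c w) = z2_scale c (z2_emb w)"
  by (auto intro!: z2_eqI)

lemma z2_emb_sum: "z2_emb (sum f A) = (\<Sum>i\<in>A. z2_emb (f i))"
  by (induction A rule: infinite_finite_induct) auto

lemma z2_sec_0 [simp]: "z2_sec 0 = 0"
  by (rule z2_eqI) auto

lemma z2_decompose: "u = z2_emb (z2_d u) + z2_sec (z2_y u)"
  by (rule z2_eqI) (auto simp: z2_d_nth)

lemma z2_e_eq: "z2_e n = z2_emb (l2_e n)"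
  by transfer simp

lemma z2_norm_eq: "z2_norm u = norm (z2_d u) + norm (z2_y u)"
  by transfer auto

lemma z2_norm_emb [simp]: "z2_norm (z2_emb w) = norm w"
  by (simp add: z2_norm_eq)

lemma z2_norm_sec [simp]: "z2_norm (z2_sec y) = norm y"
  by (simp add: z2_norm_eq)

lemma z2_norm_minus [simp]: "z2_norm (- u) = z2_norm u"
  using z2_norm_scale[of "- 1" u] by simp

lemma z2_norm_minus_commute: "z2_norm (u - v) = z2_norm (v - u)"
  using z2_norm_minus[of "u - v"] by simp

lemma z2_norm_diff: "z2_norm (u - v) \<le> 8 * (z2_norm u + z2_norm v)"
  using z2_norm_add[of u "- v"] by simp

lemma z2_norm_zero_iff: "z2_norm u = 0 \<longleftrightarrow> u = 0"
proof
  assume "z2_norm u = 0"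
  then have "norm (z2_d u) = 0" "norm (z2_y u) = 0"
    unfolding z2_norm_eq by (simp_all add: add_nonneg_eq_0_iff)
  then show "u = 0" by (intro z2_eqI_d) auto
qed (simp add: z2_norm_zero)

lemma norm_z2_y_le: "norm (z2_y u) \<le> z2_norm u" and norm_z2_d_le: "norm (z2_d u) \<le> z2_norm u"
  by (simp_all add: z2_norm_eq)

text \<open>As \<open>z2_x\<close> is additive, the defect of \<open>z2_d\<close> is that of
  \<open>Omega\<close> with the opposite sign. It is small when the second components are, which
  makes \<open>z2_d\<close> asymptotically additive on the vectors
  \<open>T (e n, 0)\<close>.\<close>

lemma z2_d_quasilinear:
  "norm (z2_d (u + v) - z2_d u - z2_d v) \<le> 6 * (norm (z2_y u) + norm (z2_y v))"
proof -
  have eq: "l2_nth (z2_d (u + v) - z2_d u - z2_d v)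
      = (\<lambda>n. - 1 * (Omega (\<lambda>n. l2_nth (z2_y u) n + l2_nth (z2_y v) n) n
         - Omega (l2_nth (z2_y u)) n - Omega (l2_nth (z2_y v)) n))"
    by (rule ext) (simp add: z2_d_nth l2_Omega.rep_eq plus_l2.rep_eq)
  show ?thesis
    unfolding norm_l2.rep_eq eq ell2_scale(2)[OF Omega_quasilinear(1)[OF l2_nth l2_nth]]
    using Omega_quasilinear(2)[OF l2_nth l2_nth, of "z2_y u" "z2_y v"] by simp
qed

text \<open>Although \<open>z2_norm\<close> is only a quasi-norm, adding a vector of the embedded Hilbert space
  obeys the exact triangle inequality; this is why the final estimates are isometric.\<close>

lemma z2_norm_emb_add_le: "z2_norm (z2_emb w + u) \<le> norm w + z2_norm u"
  using norm_triangle_ineq[of w "z2_d u"] by (simp add: z2_norm_eq)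

lemma z2_norm_emb_add_ge: "norm w - z2_norm u \<le> z2_norm (z2_emb w + u)"
  using norm_triangle_ineq4[of "w + z2_d u" "z2_d u"] norm_ge_zero[of "z2_y u"]
  by (simp add: z2_norm_eq del: norm_ge_zero)

lemma z2_norm_close_emb:
  "z2_norm u \<le> norm w + z2_norm (u - z2_emb w)" "norm w \<le> z2_norm u + z2_norm (u - z2_emb w)"
  using z2_norm_emb_add_le[of w "u - z2_emb w"] z2_norm_emb_add_ge[of w "u - z2_emb w"] by auto

lemma z2_norm_diff_emb_d: "z2_norm (u - z2_emb (z2_d u)) = norm (z2_y u)"
proof -
  have "u - z2_emb (z2_d u) = z2_sec (z2_y u)" by (metis z2_decompose add_diff_cancel_left')
  then show ?thesis by simp
qed

text \<open>The first term is split off each time, so that term \<open>k\<close> is charged the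
  factor 8 only \<open>k + 1\<close> times.\<close>

lemma z2_norm_sum_le: "z2_norm (\<Sum>k<n. u k) \<le> (\<Sum>k<n. 8 ^ Suc k * z2_norm (u k))"
proof (induction n arbitrary: u)
  case (Suc n)
  have "z2_norm (\<Sum>k<Suc n. u k) \<le> 8 * (z2_norm (u 0) + z2_norm (\<Sum>k<n. u (Suc k)))"
    unfolding sum.lessThan_Suc_shift by (rule z2_norm_add)
  also have "\<dots> \<le> 8 * (z2_norm (u 0) + (\<Sum>k<n. 8 ^ Suc k * z2_norm (u (Suc k))))"
    using Suc.IH[of "\<lambda>k. u (Suc k)"] by simp
  also have "\<dots> = (\<Sum>k<Suc n. 8 ^ Suc k * z2_norm (u k))"
    unfolding sum.lessThan_Suc_shift[of _ n] by (simp add: sum_distrib_left algebra_simps)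
  finally show ?case .
qed (simp add: z2_norm_zero)

text \<open>The ratio \<open>1/16\<close> beats the growth of \<open>8 ^ k\<close>: what is left is
  \<open>8 * C * (1/2) ^ k\<close>, with sum at most \<open>16 * C\<close>.\<close>

lemma z2_norm_sum_small:
  assumes u: "\<And>k. z2_norm (u k) \<le> C * (1/16) ^ k"
  shows "z2_norm (\<Sum>k<n. u k) \<le> 16 * C"
proof -
  have C: "0 \<le> C" using u[of 0] z2_norm_nonneg[of "u 0"] by simp
  have "z2_norm (\<Sum>k<n. u k) \<le> (\<Sum>k<n. 8 ^ Suc k * (C * (1/16) ^ k))"
    using z2_norm_sum_le[of u n] sum_mono[of "{..<n}" "\<lambda>k. 8 ^ Suc k * z2_norm (u k)" "\<lambda>k. 8 ^ Suc k * (C * (1/16) ^ k)"] u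
    by force
  also have "\<dots> = (\<Sum>k<n. 8 * C * (1/2) ^ k)"
  proof (rule sum.cong[OF refl])
    fix k
    have "8 ^ k * (1/16) ^ k = (1/2 :: real) ^ k" by (simp flip: power_mult_distrib)
    then show "8 ^ Suc k * (C * (1/16) ^ k) = 8 * C * (1/2) ^ k" by (simp add: mult_ac)
  qed
  also have "\<dots> = 8 * C * (\<Sum>k<n. (1/2) ^ k)" by (simp add: sum_distrib_left)
  also have "\<dots> \<le> 8 * C * 2"
    using C sum_gp_strict[of "1/2 :: real" n] by (intro mult_left_mono) auto
  finally show ?thesis by simp
qed

lemma norm_l2_pos: "l2_nth y n \<noteq> 0 \<Longrightarrow> 0 < norm y"
  using norm_l2_nth_le[of y n] by (meson less_le_trans zero_less_norm_iff)

text \<open>Uses \<open>ln s = 2 * ln (sqrt s)\<close> and \<open>ln x \<le> x - 1\<close>; unlike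
  in \<open>mult_ln_bound\<close>, the bound tends to 0 with \<open>r\<close>.\<close>

lemma mult_ln_le_sqrt:
  fixes r t :: real
  assumes "0 \<le> r" "r \<le> t"
  shows "r * \<bar>ln (t / r)\<bar> \<le> 2 * sqrt (t * r)"
proof (cases "r = 0")
  case False
  then have r: "0 < r" "0 < t" using assms by auto
  have "ln (t / r) = 2 * ln (sqrt (t / r))" using r by (simp add: ln_sqrt)
  also have "\<dots> \<le> 2 * (sqrt (t / r) - 1)" using r by (intro mult_left_mono ln_le_minus_one) auto
  finally have "ln (t / r) \<le> 2 * sqrt (t / r)" by simp
  then have "r * ln (t / r) \<le> r * (2 * sqrt (t / r))" using r by (intro mult_left_mono) auto
  also have "\<dots> = 2 * sqrt (t * r)"
    using r real_sqrt_mult[of r r] by (simp add: real_sqrt_divide real_sqrt_mult field_simps)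
  finally show ?thesis using r assms by simp
qed simp

text \<open>Cutting \<open>y\<close> into two disjoint pieces changes \<open>Omega\<close> on each
  piece only through the norm inside the logarithm, so \<open>z2_d\<close> of the difference is a
  combination of the two pieces. The retained piece contributes at most \<open>R\<close>, the
  removed one the square root term.\<close>

lemma z2_sec_proj_close:
  defines "r \<equiv> \<lambda>I y. norm (y - l2_proj I y)"
  shows "z2_norm (z2_sec y - z2_sec (l2_proj I y)) \<le> 2 * r I y + 2 * sqrt (norm y * r I y)"
proof -
  define p where "p = norm (l2_proj I y)"
  define R where "R = r I y"
  define t where "t = norm y"
  have b: "0 \<le> p" "p \<le> t" "0 \<le> R" "R \<le> t" "t \<le> p + R"
    using norm_triangle_sub[of y "l2_proj I y"]
    by (auto simp: p_def R_def r_def t_def norm_l2_proj_le norm_l2_diff_proj_le)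
  have d: "z2_d (z2_sec y - z2_sec (l2_proj I y))
      = ln (t / p) *\<^sub>R l2_proj I y + ln (t / R) *\<^sub>R (y - l2_proj I y)"
  proof (rule l2_eqI)
    fix n
    show "l2_nth (z2_d (z2_sec y - z2_sec (l2_proj I y))) n
      = l2_nth (ln (t / p) *\<^sub>R l2_proj I y + ln (t / R) *\<^sub>R (y - l2_proj I y)) n"
    proof (cases "l2_nth y n = 0")
      case True
      then show ?thesis by (simp add: z2_d_nth l2_Omega_eq)
    next
      case nz: False
      then have t: "0 < t" unfolding t_def by (rule norm_l2_pos)
      show ?thesis
      proof (cases "n \<in> I")
        case True
        then have "0 < p" using nz norm_l2_pos[of "l2_proj I y" n] by (simp add: p_def)
        then have "ln (t / norm (l2_nth y n)) - ln (p / norm (l2_nth y n)) = ln (t / p)"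
          using t nz by (simp add: ln_div)
        then have "l2_nth y n * of_real (ln (t / norm (l2_nth y n))) - l2_nth y n * of_real (ln (p / norm (l2_nth y n)))
            = l2_nth y n * of_real (ln (t / p))"
          by (metis of_real_diff right_diff_distrib)
        then show ?thesis using True
          by (simp add: z2_d_nth l2_Omega_eq scaleR_conv_of_real mult.commute flip: t_def p_def)
      next
        case False
        then have "0 < R" using nz norm_l2_pos[of "y - l2_proj I y" n] by (simp add: R_def r_def)
        then have "ln (t / norm (l2_nth y n)) - ln (R / norm (l2_nth y n)) = ln (t / R)"
          using t nz by (simp add: ln_div)
        then have "l2_nth y n * of_real (ln (t / norm (l2_nth y n))) - l2_nth y n * of_real (ln (R / norm (l2_nth y n)))
            = l2_nth y n * of_real (ln (t / R))"
          by (metis of_real_diff right_diff_distrib)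
        then show ?thesis using False
          by (simp add: z2_d_nth l2_Omega_eq scaleR_conv_of_real mult.commute R_def r_def flip: t_def)
      qed
    qed
  qed
  \<comment> \<open>From \<open>p * ln (t / p) \<le> t - p\<close> and the triangle inequality
    \<open>t \<le> p + R\<close>.\<close>
  have "p * \<bar>ln (t / p)\<bar> \<le> R"
  proof (cases "p = 0")
    case False
    then have p: "0 < p" "0 < t" using b by auto
    then have "p * ln (t / p) \<le> p * (t / p - 1)" by (intro mult_left_mono ln_le_minus_one) auto
    also have "\<dots> = t - p" using p by (simp add: field_simps)
    finally show ?thesis using p b by simp
  qed (use b in simp)
  moreover have "R * \<bar>ln (t / R)\<bar> \<le> 2 * sqrt (t * R)" by (rule mult_ln_le_sqrt) (use b in auto)
  moreover have "norm (z2_d (z2_sec y - z2_sec (l2_proj I y))) \<le> p * \<bar>ln (t / p)\<bar> + R * \<bar>ln (t / R)\<bar>"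
    unfolding d by (rule order_trans[OF norm_triangle_ineq]) (simp add: p_def R_def r_def mult.commute)
  ultimately show ?thesis
    unfolding z2_norm_eq[of "z2_sec y - z2_sec (l2_proj I y)"] by (simp add: R_def r_def t_def)
qed

section \<open>Convergence and completeness of the quasi-norm\<close>

lemma z2_tendsto_unique:
  assumes "z2_tendsto us u" "z2_tendsto us v" shows "u = v"
proof -
  have "(\<lambda>n. 8 * (z2_norm (us n - u) + z2_norm (us n - v))) \<longlonglongrightarrow> 8 * (0 + 0)"
    using assms unfolding z2_tendsto_def by (intro tendsto_intros)
  moreover have "z2_norm (v - u) \<le> 8 * (z2_norm (us n - u) + z2_norm (us n - v))" for n
    using z2_norm_diff[of "us n - u" "us n - v"] by simp
  ultimately have "z2_norm (v - u) \<le> 0" by (intro tendsto_lowerbound[of _ _ sequentially]) auto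
  then show ?thesis using z2_norm_nonneg[of "v - u"] z2_norm_zero_iff[of "v - u"] by simp
qed

lemma z2_tendsto_le:
  assumes "\<And>n. z2_norm (us n - u) \<le> f n" "f \<longlonglongrightarrow> 0"
  shows "z2_tendsto us u"
  unfolding z2_tendsto_def by (rule tendsto_sandwich[OF _ _ tendsto_const assms(2)]) (auto simp: assms z2_norm_nonneg)

lemma z2_tendsto_add:
  assumes "z2_tendsto us u" "z2_tendsto vs v" shows "z2_tendsto (\<lambda>n. us n + vs n) (u + v)"
proof (rule z2_tendsto_le)
  show "z2_norm (us n + vs n - (u + v)) \<le> 8 * (z2_norm (us n - u) + z2_norm (vs n - v))" for n
    using z2_norm_add[of "us n - u" "vs n - v"] by (simp add: algebra_simps)
  show "(\<lambda>n. 8 * (z2_norm (us n - u) + z2_norm (vs n - v))) \<longlonglongrightarrow> 0"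
    using assms unfolding z2_tendsto_def by (auto intro!: tendsto_eq_intros)
qed

lemma z2_tendsto_scale:
  assumes "z2_tendsto us u" shows "z2_tendsto (\<lambda>n. z2_scale c (us n)) (z2_scale c u)"
proof (rule z2_tendsto_le)
  show "z2_norm (z2_scale c (us n) - z2_scale c u) \<le> norm c * z2_norm (us n - u)" for n
    by (simp add: z2_norm_scale flip: z2.scale_right_diff_distrib)
  show "(\<lambda>n. norm c * z2_norm (us n - u)) \<longlonglongrightarrow> 0"
    using assms unfolding z2_tendsto_def by (rule tendsto_mult_right_zero)
qed

lemma z2_tendsto_emb: "ws \<longlonglongrightarrow> w \<Longrightarrow> z2_tendsto (\<lambda>n. z2_emb (ws n)) (z2_emb w)"
  unfolding z2_tendsto_def by (simp add: tendsto_norm_zero LIM_zero flip: z2_emb_simps)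

lemma z2_tendsto_bounded:
  assumes "z2_tendsto us u" obtains C where "\<And>n. z2_norm (us n) \<le> C"
proof -
  have "Bseq (\<lambda>n. z2_norm (us n - u))"
    using assms unfolding z2_tendsto_def by (blast intro: convergent_imp_Bseq convergentI)
  then obtain K where K: "\<And>n. norm (z2_norm (us n - u)) \<le> K" by (auto simp: Bseq_def)
  have "z2_norm (us n) \<le> 8 * (K + z2_norm u)" for n
    using z2_norm_add[of "us n - u" u] K[of n] by simp
  then show ?thesis by (rule that)
qed

text \<open>The two norm coordinates are truncated rather than the pair itself, since the error is
  then visible in the norm; the result is still finitely supported.\<close>

lemma z2_tendsto_truncation:
  "z2_tendsto (\<lambda>N. z2_emb (l2_proj {..<N} (z2_d u)) + z2_sec (l2_proj {..<N} (z2_y u))) u"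
proof (rule z2_tendsto_le)
  let ?d = "\<lambda>N. norm (z2_d u - l2_proj {..<N} (z2_d u))" and ?r = "\<lambda>N. norm (z2_y u - l2_proj {..<N} (z2_y u))"
  have 0: "(\<lambda>N. norm (w - l2_proj {..<N} w)) \<longlonglongrightarrow> 0" for w :: "'a l2"
    using tendsto_norm_zero[OF LIM_zero[OF l2_proj_tendsto[of w]]] by (simp add: norm_minus_commute)
  have "(\<lambda>N. ?d N + (2 * ?r N + 2 * sqrt (norm (z2_y u) * ?r N)))
      \<longlonglongrightarrow> 0 + (2 * 0 + 2 * sqrt (norm (z2_y u) * 0))"
    by (intro tendsto_add tendsto_mult tendsto_const tendsto_real_sqrt 0)
  then show "(\<lambda>N. ?d N + (2 * ?r N + 2 * sqrt (norm (z2_y u) * ?r N))) \<longlonglongrightarrow> 0" by simp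
  fix N
  have "z2_emb (l2_proj {..<N} (z2_d u)) + z2_sec (l2_proj {..<N} (z2_y u)) - u
     = - (z2_emb (z2_d u - l2_proj {..<N} (z2_d u)) + (z2_sec (z2_y u) - z2_sec (l2_proj {..<N} (z2_y u))))"
    by (subst (3) z2_decompose[of u]) simp
  then show "z2_norm (z2_emb (l2_proj {..<N} (z2_d u)) + z2_sec (l2_proj {..<N} (z2_y u)) - u)
      \<le> ?d N + (2 * ?r N + 2 * sqrt (norm (z2_y u) * ?r N))"
    using z2_norm_emb_add_le[of "z2_d u - l2_proj {..<N} (z2_d u)" "z2_sec (z2_y u) - z2_sec (l2_proj {..<N} (z2_y u))"]
      z2_sec_proj_close[of "z2_y u" "{..<N}"]
    by (simp only: z2_norm_minus)
qed

text \<open>The second components converge to some \<open>y\<close>. Subtracting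
  \<open>z2_sec y\<close> leaves vectors \<open>h n\<close> whose second components tend to 0, where
  \<open>z2_d\<close> is almost additive; so their first components are Cauchy as well.\<close>

lemma z2_complete:
  assumes C: "\<And>e. 0 < e \<Longrightarrow> \<exists>N. \<forall>m\<ge>N. \<forall>n\<ge>N. z2_norm (us m - us n) < e"
  shows "\<exists>u. z2_tendsto us u"
proof -
  have "Cauchy (\<lambda>n. z2_y (us n))"
    unfolding Cauchy_iff
  proof (intro allI impI)
    fix e :: real assume "0 < e"
    from C[OF this] obtain N where N: "\<forall>m\<ge>N. \<forall>n\<ge>N. z2_norm (us m - us n) < e" by blast
    have "norm (z2_y (us m) - z2_y (us n)) < e" if "m \<ge> N" "n \<ge> N" for m n
      using norm_z2_y_le[of "us m - us n"] N that by (simp add: order.strict_trans1)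
    then show "\<exists>M. \<forall>m\<ge>M. \<forall>n\<ge>M. norm (z2_y (us m) - z2_y (us n)) < e" by blast
  qed
  then obtain y where y: "(\<lambda>n. z2_y (us n)) \<longlonglongrightarrow> y" using Cauchy_convergent convergent_def by blast
  define h where "h = (\<lambda>n. us n - z2_sec y)"
  have hy: "(\<lambda>n. norm (z2_y (h n))) \<longlonglongrightarrow> 0"
    using tendsto_norm_zero[OF LIM_zero[OF y]] by (simp add: h_def)
  have "Cauchy (\<lambda>n. z2_d (h n))"
    unfolding Cauchy_iff
  proof (intro allI impI)
    fix e :: real assume e: "0 < e"
    \<comment> \<open>Thirteen such errors occur: six for each of two second components in
      \<open>z2_d_quasilinear\<close>, and one for \<open>z2_d (h m - h n)\<close>.\<close>
    from C[of "e / 14"] obtain N where N: "\<And>m n. m \<ge> N \<Longrightarrow> n \<ge> N \<Longrightarrow> z2_norm (us m - us n) < e / 14"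
      using e by auto
    obtain M where M: "\<And>n. n \<ge> M \<Longrightarrow> norm (z2_y (h n)) < e / 14"
      using LIMSEQ_D[OF hy, of "e / 14"] e by auto
    have "norm (z2_d (h m) - z2_d (h n)) < e" if "m \<ge> max N M" "n \<ge> max N M" for m n
    proof -
      have hh: "h m - h n = us m - us n" by (simp add: h_def)
      have "norm (z2_d (h m) - z2_d (h m - h n) - z2_d (h n)) \<le> 6 * (norm (z2_y (h m - h n)) + norm (z2_y (h n)))"
        using z2_d_quasilinear[of "h m - h n" "h n"] by simp
      moreover have "norm (z2_y (h m - h n)) < e / 14" "norm (z2_d (h m - h n)) < e / 14"
        using N[of m n] that norm_z2_y_le[of "us m - us n"] norm_z2_d_le[of "us m - us n"] unfolding hh by auto
      moreover have "norm (z2_y (h n)) < e / 14" using M that by simp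
      moreover have "norm (z2_d (h m) - z2_d (h n)) \<le> norm (z2_d (h m) - z2_d (h m - h n) - z2_d (h n)) + norm (z2_d (h m - h n))"
        using norm_triangle_ineq[of "z2_d (h m) - z2_d (h m - h n) - z2_d (h n)" "z2_d (h m - h n)"]
        by (simp add: algebra_simps)
      ultimately show ?thesis using e by argo
    qed
    then show "\<exists>M. \<forall>m\<ge>M. \<forall>n\<ge>M. norm (z2_d (h m) - z2_d (h n)) < e" by blast
  qed
  then obtain d where d: "(\<lambda>n. z2_d (h n)) \<longlonglongrightarrow> d" using Cauchy_convergent convergent_def by blast
  have "z2_norm (us n - (z2_sec y + z2_emb d)) = norm (z2_d (h n) - d) + norm (z2_y (h n))" for n
  proof -
    have "us n - (z2_sec y + z2_emb d) = z2_emb (- d) + h n" by (simp add: h_def)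
    then show ?thesis
      by (simp only: z2_norm_eq z2_d_simps z2_y_simps add_0_left uminus_add_conv_diff)
  qed
  moreover have "(\<lambda>n. norm (z2_d (h n) - d) + norm (z2_y (h n))) \<longlonglongrightarrow> 0"
    using tendsto_add[OF tendsto_norm_zero[OF LIM_zero[OF d]] hy] by simp
  ultimately have "z2_tendsto us (z2_sec y + z2_emb d)" by (simp add: z2_tendsto_def)
  then show ?thesis ..
qed

section \<open>Normalised sums of blocks\<close>

lemma mult_ln_le: "0 \<le> t \<Longrightarrow> t * \<bar>ln t\<bar> \<le> 1 + t\<^sup>2" for t :: real
proof (cases "t \<le> 1")
  case True
  assume "0 \<le> t"
  with True show ?thesis using mult_ln_bound[of t 1] by (simp add: add_increasing2)
next
  case False
  then have "t * ln t \<le> t * (t - 1)" by (intro mult_left_mono ln_le_minus_one) auto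
  then show ?thesis using False by (simp add: power2_eq_square algebra_simps)
qed

text \<open>The factor \<open>1 / sqrt n\<close> keeps averages of disjoint blocks of norm 1 at norm
  1.\<close>

definition l2_avg :: "nat \<Rightarrow> (nat \<Rightarrow> 'k::rc_field l2) \<Rightarrow> 'k l2" where
  "l2_avg n y = l2_scale (of_real (1 / sqrt (real n))) (\<Sum>k<n. y k)"

definition z2_avg :: "nat \<Rightarrow> (nat \<Rightarrow> 'k::rc_field z2) \<Rightarrow> 'k z2" where
  "z2_avg n v = z2_scale (of_real (1 / sqrt (real n))) (\<Sum>k<n. v k)"

lemma l2_avg_blocks_le:
  assumes "blocks N y" "\<And>k. norm (y k) \<le> C" "0 < n" shows "norm (l2_avg n y) \<le> C"
  using blocks_norm_sum_le[OF assms(1,2), of n] assms(3) by (simp add: l2_avg_def norm_divide field_simps)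

lemma l2_avg_blocks_ge:
  assumes "blocks N y" "\<And>k. C \<le> norm (y k)" "0 \<le> C" "0 < n" shows "C \<le> norm (l2_avg n y)"
  using blocks_norm_sum_ge[OF assms(1,2,3), of n] assms(4) by (simp add: l2_avg_def norm_divide field_simps)

lemma z2_avg_emb: "z2_avg n (\<lambda>k. z2_emb (y k)) = z2_emb (l2_avg n y)"
  by (simp add: z2_avg_def l2_avg_def z2_emb_sum)

text \<open>At each coordinate at most one block is nonzero, and there \<open>Omega\<close> of the
  block and \<open>Omega\<close> of the average differ only in their logarithms. The scaling by
  \<open>1 / sqrt n\<close> inside the logarithm is the origin of the term
  \<open>ln (sqrt n)\<close>.\<close>

lemma z2_avg_sec_blocks:
  assumes y: "blocks N y" and n: "0 < n"
  shows "z2_avg n (\<lambda>k. z2_sec (y k)) = z2_sec (l2_avg n y)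
    + z2_emb (l2_avg n (\<lambda>k. ln (norm (y k)) *\<^sub>R y k) - (ln (norm (l2_avg n y)) + ln (sqrt (real n))) *\<^sub>R l2_avg n y)"
proof (rule z2_eqI)
  define s where "s = 1 / sqrt (real n)"
  have s: "0 < s" "ln (sqrt (real n)) = - ln s" using n by (auto simp: s_def ln_div)
  define Y where "Y = l2_avg n y"
  fix i
  have Yi: "l2_nth Y i = of_real s * (\<Sum>k<n. l2_nth (y k) i)" by (simp add: Y_def l2_avg_def s_def)
  show "z2_x (z2_avg n (\<lambda>k. z2_sec (y k))) i = z2_x (z2_sec (l2_avg n y)
    + z2_emb (l2_avg n (\<lambda>k. ln (norm (y k)) *\<^sub>R y k) - (ln (norm (l2_avg n y)) + ln (sqrt (real n))) *\<^sub>R l2_avg n y)) i"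
  proof (cases "\<exists>j<n. l2_nth (y j) i \<noteq> 0")
    case False
    then have 0: "\<And>k. k < n \<Longrightarrow> l2_nth (y k) i = 0" by blast
    then have "l2_nth Y i = 0" by (simp add: Yi)
    with 0 show ?thesis
      unfolding Y_def[symmetric] by (simp add: z2_avg_def l2_avg_def l2_Omega_eq)
  next
    case True
    then obtain j where j: "j < n" "l2_nth (y j) i \<noteq> 0" by blast
    have 0: "l2_nth (y k) i = 0" if "k \<noteq> j" for k using blocks_disjoint[OF y y that] j(2) by blast
    have one: "(\<Sum>k<n. f k) = f j" if "\<And>k. k \<noteq> j \<Longrightarrow> f k = 0" for f :: "nat \<Rightarrow> 'a"
      using that j(1) sum.mono_neutral_right[of "{..<n}" "{j}" f] by auto
    define a where "a = l2_nth (y j) i"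
    have Yi': "l2_nth Y i = of_real s * a" unfolding Yi a_def by (subst one) (auto simp: 0)
    have a: "a \<noteq> 0" using j(2) by (simp add: a_def)
    have pos: "0 < norm (y j)" "0 < norm Y"
    proof -
      show "0 < norm (y j)" by (rule norm_l2_pos[OF j(2)])
      have "l2_nth Y i \<noteq> 0" unfolding Yi' using a s by simp
      then show "0 < norm Y" by (rule norm_l2_pos)
    qed
    have L: "z2_x (z2_avg n (\<lambda>k. z2_sec (y k))) i = of_real s * (a * of_real (ln (norm (y j) / norm a)))"
      unfolding z2_avg_def z2_x_simps z2_xy_sum s_def[symmetric]
      by (subst one) (auto simp: 0 l2_Omega_eq a_def)
    have S: "l2_nth (l2_avg n (\<lambda>k. ln (norm (y k)) *\<^sub>R y k)) i = of_real s * (of_real (ln (norm (y j))) * a)"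
      unfolding l2_avg_def l2_nth_simps l2_nth_sum s_def[symmetric]
      by (subst one) (auto simp: 0 a_def scaleR_conv_of_real)
    have O: "l2_Omega Y i = of_real s * a * of_real (ln (norm Y / (s * norm a)))"
      unfolding l2_Omega_eq Yi' using s by (simp add: norm_mult)
    have l: "ln (norm (y j) / norm a) = ln (norm Y / (s * norm a)) + ln (norm (y j)) - (ln (norm Y) - ln s)"
      using pos s a by (simp add: ln_div ln_mult)
    show ?thesis
      unfolding L Y_def[symmetric] z2_x_simps l2_nth_simps S O Yi' s(2) scaleR_conv_of_real
      by (simp add: l algebra_simps)
  qed
qed (simp add: z2_avg_def l2_avg_def)

text \<open>Once \<open>ln (sqrt n)\<close> is compensated, the remaining corrections have the size
  of \<open>t * ln t\<close> with \<open>t \<le> C\<close>, which \<open>mult_ln_le\<close> bounds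
  independently of \<open>n\<close>.\<close>

lemma z2_avg_sec_blocks_bounded:
  assumes y: "blocks N y" "\<And>k. norm (y k) \<le> C" and n: "0 < n"
  shows "z2_norm (z2_avg n (\<lambda>k. z2_sec (y k)) + z2_emb (ln (sqrt (real n)) *\<^sub>R l2_avg n y)) \<le> 2 * (1 + C\<^sup>2) + C"
proof -
  define Y where "Y = l2_avg n y"
  have Y: "norm Y \<le> C" unfolding Y_def by (rule l2_avg_blocks_le[OF y n])
  have sq: "t * \<bar>ln t\<bar> \<le> 1 + C\<^sup>2" if "0 \<le> t" "t \<le> C" for t
    using mult_ln_le[OF that(1)] power_mono[OF that(2,1), of 2] by simp
  have "blocks N (\<lambda>k. ln (norm (y k)) *\<^sub>R y k)" using blocks_scale[OF y(1)] by (simp add: scaleR_l2_conv)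
  then have Z: "norm (l2_avg n (\<lambda>k. ln (norm (y k)) *\<^sub>R y k)) \<le> 1 + C\<^sup>2"
    by (rule l2_avg_blocks_le[OF _ _ n]) (use sq y(2) in \<open>simp add: mult.commute\<close>)
  have "z2_avg n (\<lambda>k. z2_sec (y k)) + z2_emb (ln (sqrt (real n)) *\<^sub>R Y)
      = z2_emb (l2_avg n (\<lambda>k. ln (norm (y k)) *\<^sub>R y k) - ln (norm Y) *\<^sub>R Y) + z2_sec Y"
    unfolding z2_avg_sec_blocks[OF y(1) n] Y_def[symmetric] by (simp add: scaleR_add_left)
  also have "z2_norm \<dots> \<le> norm (l2_avg n (\<lambda>k. ln (norm (y k)) *\<^sub>R y k)) + norm (ln (norm Y) *\<^sub>R Y) + norm Y"
    by (rule order_trans[OF z2_norm_emb_add_le]) (simp only: z2_norm_sec add_le_cancel_right norm_triangle_ineq4)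
  also have "\<dots> \<le> 2 * (1 + C\<^sup>2) + C"
    using Z Y sq[of "norm Y"] by (simp add: mult.commute)
  finally show ?thesis by (simp add: Y_def)
qed

section \<open>The symplectic form\<close>

text \<open>The difference is formed inside the sum because the two series need not converge
  separately: their logarithmic parts cancel only termwise.\<close>

definition z2_form :: "'k::rc_field z2 \<Rightarrow> 'k z2 \<Rightarrow> 'k" where
  "z2_form u v = (\<Sum>n. z2_x u n * scnj (l2_nth (z2_y v) n) - l2_nth (z2_y u) n * scnj (z2_x v n))"

text \<open>The two logarithms combine into the difference of \<open>ln a\<close> and
  \<open>ln b\<close> for the normalised coordinates \<open>a\<close> and \<open>b\<close>; then
  \<open>a * b * \<bar>ln b - ln a\<bar>\<close> is at most the square of the larger one, by
  \<open>mult_ln_bound\<close>.\<close>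

lemma Omega_cross_term:
  fixes y z :: "'k::rc_field l2"
  shows "norm (l2_Omega y n * scnj (l2_nth z n) - l2_nth y n * scnj (l2_Omega z n))
    \<le> norm y * norm z * ((norm (l2_nth y n) / norm y)\<^sup>2 + (norm (l2_nth z n) / norm z)\<^sup>2)"
proof (cases "l2_nth y n = 0 \<or> l2_nth z n = 0")
  case True
  then show ?thesis by (auto simp: l2_Omega_eq)
next
  case False
  define a b where "a = norm (l2_nth y n) / norm y" and "b = norm (l2_nth z n) / norm z"
  have ny: "0 < norm y" "0 < norm z" using False norm_l2_pos by blast+
  have pos: "0 < a" "0 < b" using False ny by (auto simp: a_def b_def)
  have ab: "a * b * \<bar>ln b - ln a\<bar> \<le> a\<^sup>2 + b\<^sup>2"
  proof (cases "a \<le> b")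
    case True
    have "a * \<bar>ln (a / b)\<bar> \<le> b" using mult_ln_bound[of a b] True pos by simp
    then have "b * (a * \<bar>ln (a / b)\<bar>) \<le> b * b" using pos by (intro mult_left_mono) auto
    then show ?thesis using pos
      by (simp add: ln_div power2_eq_square abs_minus_commute mult_ac add_increasing)
  next
    case False
    have "b * \<bar>ln (b / a)\<bar> \<le> a" using mult_ln_bound[of b a] False pos by simp
    then have "a * (b * \<bar>ln (b / a)\<bar>) \<le> a * a" using pos by (intro mult_left_mono) auto
    then show ?thesis using pos
      by (simp add: ln_div power2_eq_square mult_ac add_increasing2)
  qed
  have "l2_Omega y n * scnj (l2_nth z n) - l2_nth y n * scnj (l2_Omega z n)
      = l2_nth y n * scnj (l2_nth z n) * of_real (ln (1 / a) - ln (1 / b))"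
    by (simp add: l2_Omega_eq scnj_mult a_def b_def algebra_simps)
  then have "norm (l2_Omega y n * scnj (l2_nth z n) - l2_nth y n * scnj (l2_Omega z n))
      = norm (l2_nth y n) * norm (l2_nth z n) * \<bar>ln (1 / a) - ln (1 / b)\<bar>"
    by (simp add: norm_mult del: of_real_diff)
  also have "\<bar>ln (1 / a) - ln (1 / b)\<bar> = \<bar>ln b - ln a\<bar>" using pos by (simp add: ln_div)
  also have "norm (l2_nth y n) * norm (l2_nth z n) * \<bar>ln b - ln a\<bar>
      = norm y * norm z * (a * b * \<bar>ln b - ln a\<bar>)"
    using ny by (simp add: a_def b_def)
  also have "\<dots> \<le> norm y * norm z * (a\<^sup>2 + b\<^sup>2)" by (intro mult_left_mono ab) auto
  finally show ?thesis by (simp add: a_def b_def)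
qed

lemma Omega_cross_summable:
  fixes y z :: "'k::rc_field l2"
  defines "f \<equiv> \<lambda>n. l2_Omega y n * scnj (l2_nth z n) - l2_nth y n * scnj (l2_Omega z n)"
  shows "summable f" and "norm (suminf f) \<le> 2 * (norm y * norm z)"
proof -
  define g where "g = (\<lambda>n. norm y * norm z * ((norm (l2_nth y n) / norm y)\<^sup>2 + (norm (l2_nth z n) / norm z)\<^sup>2))"
  have s: "summable (\<lambda>n. (norm (l2_nth y n) / norm y)\<^sup>2)" for y :: "'k l2"
    using l2_summable[of y] by (simp add: power_divide summable_divide)
  \<comment> \<open>Equality holds unless \<open>y = 0\<close>, where division by 0 makes the sum
    0.\<close>
  have t: "(\<Sum>n. (norm (l2_nth y n) / norm y)\<^sup>2) \<le> 1" for y :: "'k l2"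
  proof -
    have "(\<Sum>n. (norm (l2_nth y n) / norm y)\<^sup>2) = (norm y)\<^sup>2 / (norm y)\<^sup>2"
      unfolding power_divide norm_l2_power2[of y] by (rule suminf_divide[OF l2_summable])
    then show ?thesis by simp
  qed
  have g: "summable g" unfolding g_def by (intro summable_mult summable_add s)
  have fg: "norm (f n) \<le> g n" for n unfolding f_def g_def by (rule Omega_cross_term)
  have sn: "summable (\<lambda>n. norm (f n))" by (rule summable_comparison_test'[OF g, of 0]) (simp add: fg)
  then show "summable f" by (rule summable_norm_cancel)
  have "norm (suminf f) \<le> (\<Sum>n. norm (f n))" by (rule summable_norm[OF sn])
  also have "\<dots> \<le> suminf g" by (rule suminf_le[OF fg sn g])
  also have "\<dots> = norm y * norm z * ((\<Sum>n. (norm (l2_nth y n) / norm y)\<^sup>2) + (\<Sum>n. (norm (l2_nth z n) / norm z)\<^sup>2))"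
    unfolding g_def by (simp add: suminf_mult summable_add s suminf_add[OF s s])
  also have "\<dots> \<le> norm y * norm z * (1 + 1)" by (intro mult_left_mono add_mono t) auto
  finally show "norm (suminf f) \<le> 2 * (norm y * norm z)" by simp
qed

lemma z2_form_summable:
    "summable (\<lambda>n. z2_x u n * scnj (l2_nth (z2_y v) n) - l2_nth (z2_y u) n * scnj (z2_x v n))" (is ?s)
  and z2_form_split: "z2_form u v = l2_inner (z2_d u) (z2_y v) - l2_inner (z2_y u) (z2_d v)
    + (\<Sum>n. l2_Omega (z2_y u) n * scnj (l2_nth (z2_y v) n) - l2_nth (z2_y u) n * scnj (l2_Omega (z2_y v) n))" (is ?t)
proof -
  have e: "(\<lambda>n. z2_x u n * scnj (l2_nth (z2_y v) n) - l2_nth (z2_y u) n * scnj (z2_x v n))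
     = (\<lambda>n. (l2_nth (z2_d u) n * scnj (l2_nth (z2_y v) n) - l2_nth (z2_y u) n * scnj (l2_nth (z2_d v) n))
      + (l2_Omega (z2_y u) n * scnj (l2_nth (z2_y v) n) - l2_nth (z2_y u) n * scnj (l2_Omega (z2_y v) n)))"
    by (rule ext) (simp add: z2_x_eq scnj_add algebra_simps)
  show ?s unfolding e by (intro summable_add summable_diff summable_l2_inner Omega_cross_summable)
  show ?t unfolding z2_form_def e l2_inner_eq
    by (simp add: suminf_add[symmetric] suminf_diff summable_diff summable_l2_inner Omega_cross_summable)
qed

lemma norm_z2_form_le: "norm (z2_form u v) \<le> 2 * (z2_norm u * z2_norm v)"
proof -
  have "norm (z2_form u v) \<le> norm (z2_d u) * norm (z2_y v) + norm (z2_y u) * norm (z2_d v) + 2 * (norm (z2_y u) * norm (z2_y v))"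
    unfolding z2_form_split
    by (rule norm_triangle_le[OF add_mono[OF order_trans[OF norm_triangle_ineq4 add_mono[OF norm_l2_inner_le norm_l2_inner_le]]
      Omega_cross_summable(2)]])
  also have "\<dots> \<le> 2 * (z2_norm u * z2_norm v)"
    by (simp add: z2_norm_eq algebra_simps)
  finally show ?thesis .
qed

lemma z2_form_add_left: "z2_form (u + u') v = z2_form u v + z2_form u' v"
  unfolding z2_form_def suminf_add[OF z2_form_summable z2_form_summable]
  by (rule arg_cong[where f = suminf]) (simp add: fun_eq_iff algebra_simps)

lemma z2_form_scale_left: "z2_form (z2_scale c u) v = c * z2_form u v"
  unfolding z2_form_def suminf_mult[OF z2_form_summable, symmetric]
  by (rule arg_cong[where f = suminf]) (simp add: fun_eq_iff algebra_simps)

lemma z2_form_skew: "z2_form v u = - scnj (z2_form u v)"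
proof -
  have "- scnj (z2_form u v) = (\<Sum>n. - scnj (z2_x u n * scnj (l2_nth (z2_y v) n) - l2_nth (z2_y u) n * scnj (z2_x v n)))"
    unfolding z2_form_def
    by (subst bounded_linear.suminf[OF bounded_linear_scnj z2_form_summable], subst suminf_minus)
      (auto intro: bounded_linear.summable[OF bounded_linear_scnj z2_form_summable])
  also have "\<dots> = z2_form v u"
    unfolding z2_form_def by (rule arg_cong[where f = suminf]) (simp add: fun_eq_iff scnj_diff scnj_mult mult.commute)
  finally show ?thesis by simp
qed

lemma z2_form_add_right: "z2_form u (v + v') = z2_form u v + z2_form u v'"
  by (simp add: z2_form_skew[of u] z2_form_add_left scnj_add)

lemma z2_form_scale_right: "z2_form u (z2_scale c v) = scnj c * z2_form u v"
  by (simp add: z2_form_skew[of u] z2_form_scale_left scnj_mult)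

lemma z2_form_minus: "z2_form (- u) v = - z2_form u v" "z2_form u (- v) = - z2_form u v"
  using z2_form_scale_left[of "- 1" u v] z2_form_scale_right[of u "- 1" v] by simp_all

lemma z2_form_diff: "z2_form (u - u') v = z2_form u v - z2_form u' v" "z2_form u (v - v') = z2_form u v - z2_form u v'"
  using z2_form_add_left[of u "- u'" v] z2_form_add_right[of u v "- v'"] by (simp_all add: z2_form_minus)

lemma z2_form_emb: "z2_form (z2_emb a) v = l2_inner a (z2_y v)" "z2_form u (z2_emb a) = - l2_inner (z2_y u) a"
  by (simp_all add: z2_form_split)

lemma z2_form_tendsto:
  assumes u: "z2_tendsto us u" and v: "z2_tendsto vs v"
  shows "(\<lambda>n. z2_form (us n) (vs n)) \<longlonglongrightarrow> z2_form u v"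
proof -
  obtain C where C: "\<And>n. z2_norm (vs n) \<le> C" using z2_tendsto_bounded[OF v] by blast
  have "(\<lambda>n. 2 * (z2_norm (us n - u) * C) + 2 * (z2_norm u * z2_norm (vs n - v))) \<longlonglongrightarrow> 2 * (0 * C) + 2 * (z2_norm u * 0)"
    using u v unfolding z2_tendsto_def by (intro tendsto_intros)
  then have "(\<lambda>n. z2_form (us n) (vs n) - z2_form u v) \<longlonglongrightarrow> 0"
  proof (rule Lim_null_comparison[rotated, OF tendsto_eq_rhs])
    show "\<forall>\<^sub>F n in sequentially. norm (z2_form (us n) (vs n) - z2_form u v)
        \<le> 2 * (z2_norm (us n - u) * C) + 2 * (z2_norm u * z2_norm (vs n - v))"
    proof (rule always_eventually, rule allI)
      fix n
      have eq: "z2_form (us n) (vs n) - z2_form u v = z2_form (us n - u) (vs n) + z2_form u (vs n - v)"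
        by (simp add: z2_form_diff)
      have "norm (z2_form (us n - u) (vs n)) \<le> 2 * (z2_norm (us n - u) * C)"
        using norm_z2_form_le[of "us n - u" "vs n"] mult_left_mono[OF C[of n] z2_norm_nonneg[of "us n - u"]] by linarith
      moreover note norm_z2_form_le[of u "vs n - v"]
      ultimately show "norm (z2_form (us n) (vs n) - z2_form u v)
        \<le> 2 * (z2_norm (us n - u) * C) + 2 * (z2_norm u * z2_norm (vs n - v))"
        unfolding eq using norm_triangle_ineq[of "z2_form (us n - u) (vs n)" "z2_form u (vs n - v)"] by linarith
    qed
  qed simp
  then show ?thesis by (rule LIM_zero_cancel)
qed

lemma z2_finsupp_iff: "z2_finsupp u \<longleftrightarrow> finite {n. z2_x u n \<noteq> 0 \<or> l2_nth (z2_y u) n \<noteq> 0}"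
  by (simp add: z2_finsupp.rep_eq z2_x_rep z2_y_rep split_beta)

lemma z2_form_finsupp:
  assumes "z2_finsupp u" "z2_finsupp v" shows "z2_form u v = omega0 u v"
proof -
  have "summable (\<lambda>n. z2_x u n * scnj (l2_nth (z2_y v) n))" "summable (\<lambda>n. l2_nth (z2_y u) n * scnj (z2_x v n))"
    using assms unfolding z2_finsupp_iff by (auto intro!: summable_finite)
  then show ?thesis
    by (simp add: z2_form_def suminf_diff omega0.rep_eq ell2_inner_def z2_x_rep z2_y_rep split_beta)
qed

lemma z2_finsupp_truncation: "z2_finsupp (z2_emb (l2_proj {..<N} d) + z2_sec (l2_proj {..<N} y))"
  unfolding z2_finsupp_iff by (rule finite_subset[of _ "{..<N}"]) (auto simp: l2_Omega_eq split: if_splits)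

text \<open>Truncations are finitely supported and converge to the given vectors, so a continuous
  extension of \<open>omega0\<close> is unique; existence is the continuity of
  \<open>z2_form\<close>.\<close>

lemma omega_eq: "omega = z2_form"
  unfolding omega_def
proof (rule the_equality)
  show "(\<forall>u v. z2_finsupp u \<and> z2_finsupp v \<longrightarrow> z2_form u v = omega0 u v) \<and>
    (\<forall>us u vs v. z2_tendsto us u \<and> z2_tendsto vs v \<longrightarrow> (\<lambda>n. z2_form (us n) (vs n)) \<longlonglongrightarrow> z2_form u v)"
    using z2_form_finsupp z2_form_tendsto by blast
  fix w :: "'a z2 \<Rightarrow> 'a z2 \<Rightarrow> 'a"
  assume w: "(\<forall>u v. z2_finsupp u \<and> z2_finsupp v \<longrightarrow> w u v = omega0 u v) \<and>
    (\<forall>us u vs v. z2_tendsto us u \<and> z2_tendsto vs v \<longrightarrow> (\<lambda>n. w (us n) (vs n)) \<longlonglongrightarrow> w u v)"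
  have "w u v = z2_form u v" for u v
  proof -
    let ?t = "\<lambda>u N. z2_emb (l2_proj {..<N} (z2_d u)) + z2_sec (l2_proj {..<N} (z2_y u))"
    have "(\<lambda>N. w (?t u N) (?t v N)) \<longlonglongrightarrow> w u v" using w z2_tendsto_truncation by blast
    moreover have "w (?t u N) (?t v N) = z2_form (?t u N) (?t v N)" for N
      using w[THEN conjunct1, rule_format, OF conjI[OF z2_finsupp_truncation z2_finsupp_truncation]]
      by (simp add: z2_form_finsupp z2_finsupp_truncation)
    ultimately have "(\<lambda>N. z2_form (?t u N) (?t v N)) \<longlonglongrightarrow> w u v" by simp
    then show ?thesis using z2_form_tendsto[OF z2_tendsto_truncation z2_tendsto_truncation] LIMSEQ_unique by blast
  qed
  then show "w = z2_form" by (simp add: fun_eq_iff)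
qed

text \<open>Pairing with embedded vectors detects \<open>z2_y v\<close>; once this is 0, pairing
  with sections detects \<open>z2_d v\<close>.\<close>

lemma z2_form_nondegenerate:
  assumes "\<And>u. z2_form u v = 0" shows "v = 0"
proof -
  have "l2_inner (z2_y v) (z2_y v) = 0" using assms[of "z2_emb (z2_y v)"] by (simp add: z2_form_emb)
  then have y: "z2_y v = 0" by (simp add: l2_inner_self)
  then have v: "v = z2_emb (z2_d v)" by (metis z2_decompose z2_sec_0 add_0_right)
  have "l2_inner (z2_d v) (z2_d v) = 0" using assms[of "z2_sec (z2_d v)"] by (subst (asm) v) (simp add: z2_form_emb)
  then have "z2_d v = 0" by (simp add: l2_inner_self)
  with v show ?thesis by simp
qed

section \<open>Duality and adjoints\<close>

text \<open>The coordinates of \<open>w\<close> are forced by the values at unit vectors. Their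
  square summability follows by testing \<open>f\<close> on the vector \<open>z\<close> made of the
  first \<open>N\<close> of them, where \<open>f z\<close> is the square of
  \<open>norm z\<close>.\<close>

lemma l2_riesz:
  fixes f :: "'k::rc_field l2 \<Rightarrow> 'k"
  assumes add: "\<And>x y. f (x + y) = f x + f y" and scale: "\<And>c x. f (l2_scale c x) = c * f x"
    and bd: "\<And>x. norm (f x) \<le> K * norm x"
  obtains w where "\<And>x. f x = l2_inner x w" "norm w \<le> K"
proof -
  have K: "0 \<le> K" using bd[of "l2_e 0"] norm_ge_zero[of "f (l2_e 0)"] by (simp del: norm_ge_zero)
  have fsum: "f (\<Sum>n<N. l2_scale (c n) (l2_e n)) = (\<Sum>n<N. c n * f (l2_e n))" for c N
    using add scale[of 0 0] by (induction N) (auto simp: scale)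
  define a where "a = (\<lambda>n. scnj (f (l2_e n)))"
  have b: "L2_set (\<lambda>n. norm (a n)) {..<N} \<le> K" for N
  proof -
    define z where "z = (\<Sum>n<N. l2_scale (a n) (l2_e n))"
    have z: "(norm z)\<^sup>2 = (\<Sum>n<N. (norm (a n))\<^sup>2)" unfolding z_def by (subst norm_l2_power2_sum) auto
    have "f z = (\<Sum>n<N. a n * scnj (a n))" unfolding z_def fsum by (simp add: a_def)
    also have "\<dots> = of_real ((norm z)\<^sup>2)" unfolding z mult_scnj by (simp add: scaleR_conv_of_real)
    finally have "(norm z)\<^sup>2 \<le> K * norm z" using bd[of z] by (simp add: norm_power)
    then have "norm z \<le> K" using K by (cases "z = 0") (auto simp: power2_eq_square)
    moreover have "L2_set (\<lambda>n. norm (a n)) {..<N} = norm z"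
      unfolding L2_set_def z[symmetric] by simp
    ultimately show ?thesis by simp
  qed
  define w where "w = Abs_l2 a"
  have w: "l2_nth w = a" unfolding w_def by (rule Abs_l2_inverse[OF ell2_boundI(1)[OF b]])
  have nw: "norm w \<le> K" by (rule l2_boundI) (simp add: w b)
  have "f x = l2_inner x w" for x
  proof (rule LIMSEQ_unique)
    have "bounded_linear f"
      by (rule bounded_linear_intro[of _ K]) (simp_all add: add scaleR_l2_conv scale bd mult.commute scaleR_conv_of_real)
    then show "(\<lambda>N. f (l2_proj {..<N} x)) \<longlonglongrightarrow> f x" by (rule bounded_linear.tendsto[OF _ l2_proj_tendsto])
    have "f (l2_proj {..<N} x) = (\<Sum>n<N. l2_nth x n * scnj (l2_nth w n))" for N
      unfolding l2_proj_lessThan fsum by (simp add: w a_def)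
    then show "(\<lambda>N. f (l2_proj {..<N} x)) \<longlonglongrightarrow> l2_inner x w"
      using summable_LIMSEQ[OF summable_l2_inner[of x w]] by (simp add: l2_inner_eq)
  qed
  then show ?thesis using nw that by blast
qed

text \<open>On the embedded subspace \<open>f\<close> is represented by some \<open>w\<close>, and
  pairing with \<open>z2_sec w\<close> reproduces it there. The remainder \<open>h\<close> vanishes
  on that subspace, so it factors through the quotient: composed with \<open>z2_sec\<close> it is
  linear although \<open>z2_sec\<close> is not, and a second vector \<open>z\<close> represents
  it.\<close>

lemma z2_riesz:
  fixes f :: "'k::rc_field z2 \<Rightarrow> 'k"
  assumes add: "\<And>x y. f (x + y) = f x + f y" and scale: "\<And>c x. f (z2_scale c x) = c * f x"
    and bd: "\<And>x. norm (f x) \<le> K * z2_norm x"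
  obtains v where "\<And>u. f u = z2_form u v" "z2_norm v \<le> 4 * K"
proof -
  have "f (z2_emb (x + y)) = f (z2_emb x) + f (z2_emb y)" "f (z2_emb (l2_scale c x)) = c * f (z2_emb x)"
    "norm (f (z2_emb x)) \<le> K * norm x" for x y c
    using bd[of "z2_emb x"] by (simp_all add: add scale)
  then obtain w where w: "\<And>x. f (z2_emb x) = l2_inner x w" "norm w \<le> K"
    using l2_riesz[of "\<lambda>x. f (z2_emb x)" K] by blast
  define h where "h = (\<lambda>u. f u - z2_form u (z2_sec w))"
  have h_add: "h (u + v) = h u + h v" and h_scale: "h (z2_scale c u) = c * h u" for u v c
    by (simp_all add: h_def add scale z2_form_add_left z2_form_scale_left algebra_simps)
  have h_emb: "h (z2_emb x) = 0" for x by (simp add: h_def w z2_form_emb)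
  have h_y: "h u = h (z2_sec (z2_y u))" for u
    using h_add[of "z2_emb (z2_d u)" "z2_sec (z2_y u)"] z2_decompose[of u] h_emb by simp
  have "h (z2_sec (x + y)) = h (z2_sec x) + h (z2_sec y)" for x y
    using h_y[of "z2_sec x + z2_sec y"] h_add by simp
  moreover have "h (z2_sec (l2_scale c x)) = c * h (z2_sec x)" for c x
    using h_y[of "z2_scale c (z2_sec x)"] h_scale by simp
  \<comment> \<open>One \<open>K\<close> from \<open>f\<close> and two from the form; together with
    \<open>norm w \<le> K\<close> this makes the final constant 4.\<close>
  moreover have "norm (h (z2_sec x)) \<le> 3 * K * norm x" for x
  proof -
    have "norm (h (z2_sec x)) \<le> norm (f (z2_sec x)) + norm (z2_form (z2_sec x) (z2_sec w))"
      unfolding h_def by (rule norm_triangle_ineq4)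
    also have "\<dots> \<le> K * norm x + 2 * (norm x * norm w)"
      using bd[of "z2_sec x"] norm_z2_form_le[of "z2_sec x" "z2_sec w"] by simp
    also have "\<dots> \<le> K * norm x + 2 * (norm x * K)" using mult_left_mono[OF w(2) norm_ge_zero[of x]] by (simp add: mult.commute)
    finally show ?thesis by (simp add: algebra_simps)
  qed
  ultimately obtain z where z: "\<And>x. h (z2_sec x) = l2_inner x z" "norm z \<le> 3 * K"
    using l2_riesz[of "\<lambda>x. h (z2_sec x)" "3 * K"] by blast
  define v where "v = z2_emb (- z) + z2_sec w"
  have "f u = z2_form u v" for u
  proof -
    have "f u = z2_form u (z2_sec w) + h (z2_sec (z2_y u))" unfolding h_y[of u, symmetric] by (simp add: h_def)
    also have "\<dots> = z2_form u v" unfolding v_def z2_form_add_right z2_form_emb z by (simp add: l2_inner_minus)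
    finally show ?thesis .
  qed
  moreover have "z2_norm v \<le> 4 * K"
    using z2_norm_emb_add_le[of "- z" "z2_sec w"] w(2) z(2) by (simp add: v_def)
  ultimately show ?thesis using that by blast
qed

lemma z2_app_simps [simp]:
  "z2_app A (u + v) = z2_app A u + z2_app A v" "z2_app A (z2_scale c u) = z2_scale c (z2_app A u)"
  using z2_app[of A] by (auto simp: z2_linear_iff)

lemma z2_app_0 [simp]: "z2_app A 0 = 0"
  using z2_app_simps(2)[of A 0 0] by simp

lemma z2_app_minus [simp]: "z2_app A (- u) = - z2_app A u"
  using z2_app_simps(2)[of A "- 1" u] by simp

lemma z2_app_diff [simp]: "z2_app A (u - v) = z2_app A u - z2_app A v"
  using z2_app_simps(1)[of A u "- v"] by simp

lemma z2_app_sum [simp]: "z2_app A (sum f I) = (\<Sum>i\<in>I. z2_app A (f i))"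
  by (induction I rule: infinite_finite_induct) auto

lemma z2_app_avg: "z2_app A (z2_avg n v) = z2_avg n (\<lambda>k. z2_app A (v k))"
  by (simp add: z2_avg_def)

lemma z2_op_eqI: "(\<And>u. z2_app A u = z2_app B u) \<Longrightarrow> A = B"
  by (simp add: z2_app_inject[symmetric] fun_eq_iff)

lemma z2_app_op_simps [simp]:
  "z2_app 0 u = 0" "z2_app 1 u = u" "z2_app (A + B) u = z2_app A u + z2_app B u"
  "z2_app (- A) u = - z2_app A u" "z2_app (A * B) u = z2_app A (z2_app B u)" "z2_app (op_scale c A) u = z2_scale c (z2_app A u)"
  by (simp_all add: zero_z2_op.rep_eq one_z2_op.rep_eq plus_z2_op.rep_eq uminus_z2_op.rep_eq
      times_z2_op.rep_eq op_scale.rep_eq)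

lemma z2_op_bounded:
  obtains K where "0 \<le> K" "\<And>u. z2_norm (z2_app A u) \<le> K * z2_norm u"
proof -
  obtain K where K: "\<And>u. z2_norm (z2_app A u) \<le> K * z2_norm u" using z2_app[of A] by auto
  have "z2_norm (z2_app A u) \<le> \<bar>K\<bar> * z2_norm u" for u
    using K[of u] mult_right_mono[OF abs_ge_self z2_norm_nonneg, of K u] by linarith
  then show ?thesis using that[of "\<bar>K\<bar>"] by simp
qed

lemma Abs_z2_op_inverse':
  assumes "\<And>u v. T (u + v) = T u + T v" "\<And>c u. T (z2_scale c u) = z2_scale c (T u)"
    "\<And>u. z2_norm (T u) \<le> K * z2_norm u"
  shows "z2_app (Abs_z2_op T) = T"
  by (rule Abs_z2_op_inverse) (use assms in \<open>auto simp: z2_linear_iff\<close>)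

text \<open>\<open>z2_riesz\<close> yields the adjoint pointwise with a uniform bound; nondegeneracy
  makes it linear and the only operator with this property, as the definite description in
  \<open>op_star\<close> demands.\<close>

lemma z2_form_adjoint: "z2_form (z2_app A u) v = z2_form u (z2_app (op_star A) v)"
proof -
  obtain K where K: "0 \<le> K" "\<And>u. z2_norm (z2_app A u) \<le> K * z2_norm u" using z2_op_bounded by blast
  have "\<exists>w. (\<forall>u. z2_form (z2_app A u) v = z2_form u w) \<and> z2_norm w \<le> 8 * K * z2_norm v" for v
  proof -
    have bd: "norm (z2_form (z2_app A u) v) \<le> 2 * (K * z2_norm v) * z2_norm u" for u
    proof -
      have "z2_norm (z2_app A u) * z2_norm v \<le> (K * z2_norm u) * z2_norm v"
        by (intro mult_right_mono K z2_norm_nonneg)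
      then show ?thesis using norm_z2_form_le[of "z2_app A u" v] by (simp add: mult_ac)
    qed
    obtain w where "\<And>u. z2_form (z2_app A u) v = z2_form u w" "z2_norm w \<le> 4 * (2 * (K * z2_norm v))"
      by (rule z2_riesz[of "\<lambda>u. z2_form (z2_app A u) v" "2 * (K * z2_norm v)"])
        (auto simp: z2_form_add_left z2_form_scale_left bd)
    then show ?thesis by (intro exI[of _ w]) auto
  qed
  then obtain S where S: "\<And>u v. z2_form (z2_app A u) v = z2_form u (S v)"
    and Sb: "\<And>v. z2_norm (S v) \<le> 8 * K * z2_norm v" by metis
  have eqI: "x = y" if "\<And>u. z2_form u x = z2_form u y" for x y :: "'a z2"
    using z2_form_nondegenerate[of "x - y"] that by (simp add: z2_form_diff)
  have lin: "S (v + w) = S v + S w" "S (z2_scale c v) = z2_scale c (S v)" for v w c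
    by (rule eqI, simp add: S[symmetric] z2_form_add_right z2_form_scale_right)+
  have app: "z2_app (Abs_z2_op S) = S" by (rule Abs_z2_op_inverse'[OF lin Sb])
  have "op_star A = Abs_z2_op S"
    unfolding op_star_def omega_eq
  proof (rule the_equality)
    show "\<forall>u v. z2_form (z2_app A u) v = z2_form u (z2_app (Abs_z2_op S) v)" by (simp add: app S)
    fix R assume "\<forall>u v. z2_form (z2_app A u) v = z2_form u (z2_app R v)"
    then show "R = Abs_z2_op S" by (intro z2_op_eqI eqI) (simp add: app flip: S)
  qed
  then show ?thesis by (simp add: app S)
qed

lemma op_star_eqI:
  assumes "\<And>u v. z2_form (z2_app A u) v = z2_form u (z2_app B v)" shows "op_star A = B"
proof (rule z2_op_eqI)
  fix v
  have "z2_form u (z2_app (op_star A) v - z2_app B v) = 0" for u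
    using assms z2_form_adjoint[of A u v] by (simp add: z2_form_diff)
  then show "z2_app (op_star A) v = z2_app B v" using z2_form_nondegenerate by fastforce
qed

lemma op_star_add: "op_star (A + B) = op_star A + op_star B"
  by (rule op_star_eqI) (simp add: z2_form_add_left z2_form_add_right z2_form_adjoint)

section \<open>Weakly null sequences in the Kalton--Peck space\<close>

text \<open>Stated in the coordinates of the norm, to which gliding humps are applied;
  \<open>z2_nullI\<close> and \<open>z2_null_x\<close> translate from and to the linear
  coordinates.\<close>

definition z2_null :: "(nat \<Rightarrow> 'k::rc_field z2) \<Rightarrow> bool" where
  "z2_null u \<longleftrightarrow> l2_null (\<lambda>n. z2_d (u n)) \<and> l2_null (\<lambda>n. z2_y (u n))"

lemma z2_null_emb: "l2_null w \<Longrightarrow> z2_null (\<lambda>n. z2_emb (w n))"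
  by (auto simp: z2_null_def l2_null_def)

lemma z2_null_sec: "l2_null w \<Longrightarrow> z2_null (\<lambda>n. z2_sec (w n))"
  by (auto simp: z2_null_def l2_null_def)

text \<open>For bounded norms, \<open>mult_ln_le_sqrt\<close> controls a coordinate of
  \<open>Omega\<close> by the square root of the same coordinate of its argument.\<close>

lemma l2_null_Omega_tendsto:
  assumes "l2_null y" shows "(\<lambda>n. l2_Omega (y n) i) \<longlonglongrightarrow> 0"
proof -
  obtain C where C: "\<And>n. norm (y n) \<le> C" using assms by (auto simp: l2_null_def)
  have "(\<lambda>n. 2 * sqrt (C * norm (l2_nth (y n) i))) \<longlonglongrightarrow> 2 * sqrt (C * 0)"
    using assms unfolding l2_null_def by (intro tendsto_intros tendsto_norm_zero) auto
  then have "(\<lambda>n. 2 * sqrt (C * norm (l2_nth (y n) i))) \<longlonglongrightarrow> 0" by simp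
  then show ?thesis
  proof (rule Lim_null_comparison[rotated], intro always_eventually allI)
    fix n
    have "norm (l2_Omega (y n) i) \<le> 2 * sqrt (norm (y n) * norm (l2_nth (y n) i))"
      using mult_ln_le_sqrt[of "norm (l2_nth (y n) i)" "norm (y n)"] norm_l2_nth_le[of "y n" i]
      by (simp add: l2_Omega_eq norm_mult)
    also have "\<dots> \<le> 2 * sqrt (C * norm (l2_nth (y n) i))"
      using C by (intro mult_left_mono real_sqrt_le_mono mult_right_mono) auto
    finally show "norm (l2_Omega (y n) i) \<le> 2 * sqrt (C * norm (l2_nth (y n) i))" .
  qed
qed

lemma z2_nullI:
  assumes b: "\<And>n. z2_norm (u n) \<le> C" and x: "\<And>i. (\<lambda>n. z2_x (u n) i) \<longlonglongrightarrow> 0"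
    and y: "\<And>i. (\<lambda>n. l2_nth (z2_y (u n)) i) \<longlonglongrightarrow> 0"
  shows "z2_null u"
proof -
  have yn: "l2_null (\<lambda>n. z2_y (u n))"
    unfolding l2_null_def using y b norm_z2_y_le order_trans by blast
  have "(\<lambda>n. z2_x (u n) i - l2_Omega (z2_y (u n)) i) \<longlonglongrightarrow> 0 - 0" for i
    by (intro tendsto_diff x l2_null_Omega_tendsto yn)
  then have "(\<lambda>n. l2_nth (z2_d (u n)) i) \<longlonglongrightarrow> 0" for i by (simp add: z2_d_nth)
  moreover have "norm (z2_d (u n)) \<le> C" for n using norm_z2_d_le[of "u n"] b[of n] by linarith
  ultimately have "l2_null (\<lambda>n. z2_d (u n))" unfolding l2_null_def by blast
  with yn show ?thesis by (simp add: z2_null_def)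
qed

lemma z2_null_bounded:
  assumes "z2_null u" obtains C where "\<And>n. z2_norm (u n) \<le> C"
proof -
  obtain C D where "\<And>n. norm (z2_d (u n)) \<le> C" "\<And>n. norm (z2_y (u n)) \<le> D"
    using assms by (auto simp: z2_null_def l2_null_def)
  then have "z2_norm (u n) \<le> C + D" for n unfolding z2_norm_eq by (rule add_mono)
  then show ?thesis by (rule that)
qed

lemma z2_null_x:
  assumes "z2_null u" shows "(\<lambda>n. z2_x (u n) i) \<longlonglongrightarrow> 0"
proof -
  have "(\<lambda>n. l2_nth (z2_d (u n)) i) \<longlonglongrightarrow> 0" "(\<lambda>n. l2_Omega (z2_y (u n)) i) \<longlonglongrightarrow> 0"
    using assms l2_null_Omega_tendsto[of "\<lambda>n. z2_y (u n)"] by (auto simp: z2_null_def l2_null_def)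
  from tendsto_add[OF this] show ?thesis by (simp add: z2_x_eq)
qed

text \<open>Replacing \<open>v\<close> by a truncation reduces the pairing to finitely many
  coordinates, at a cost that is uniform in \<open>n\<close>.\<close>

lemma z2_null_form_tendsto:
  assumes u: "z2_null u" shows "(\<lambda>n. z2_form (u n) v) \<longlonglongrightarrow> 0"
proof (rule LIMSEQ_I)
  fix e :: real assume e: "0 < e"
  obtain C where C: "\<And>n. z2_norm (u n) \<le> C" using z2_null_bounded[OF u] by blast
  have C0: "0 \<le> C" using C[of 0] z2_norm_nonneg[of "u 0"] by linarith
  define v' where "v' = (\<lambda>N. z2_emb (l2_proj {..<N} (z2_d v)) + z2_sec (l2_proj {..<N} (z2_y v)))"
  have "(\<lambda>N. z2_norm (v' N - v)) \<longlonglongrightarrow> 0"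
    using z2_tendsto_truncation[of v] unfolding v'_def z2_tendsto_def .
  \<comment> \<open>The 4 covers the constant 2 of \<open>norm_z2_form_le\<close> and leaves
    \<open>e / 2\<close>; \<open>C + 1\<close> avoids division by 0.\<close>
  moreover have "0 < e / (4 * (C + 1))" using e C0 by simp
  ultimately obtain N where "norm (z2_norm (v' N - v) - 0) < e / (4 * (C + 1))"
    using LIMSEQ_D by blast
  then have N: "z2_norm (v' N - v) < e / (4 * (C + 1))" by simp
  have "z2_form (u n) (v' N) = (\<Sum>i<N. z2_x (u n) i * scnj (l2_nth (z2_y (v' N)) i) - l2_nth (z2_y (u n)) i * scnj (z2_x (v' N) i))" for n
    unfolding z2_form_def by (rule suminf_finite) (auto simp: v'_def l2_Omega_eq)
  moreover have "(\<lambda>n. \<Sum>i<N. z2_x (u n) i * scnj (l2_nth (z2_y (v' N)) i) - l2_nth (z2_y (u n)) i * scnj (z2_x (v' N) i)) \<longlonglongrightarrow> 0"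
  proof (rule tendsto_null_sum)
    fix i
    have "(\<lambda>n. l2_nth (z2_y (u n)) i) \<longlonglongrightarrow> 0" using u by (simp add: z2_null_def l2_null_def)
    from tendsto_diff[OF tendsto_mult_left_zero[OF z2_null_x[OF u]] tendsto_mult_left_zero[OF this]]
    show "(\<lambda>n. z2_x (u n) i * scnj (l2_nth (z2_y (v' N)) i) - l2_nth (z2_y (u n)) i * scnj (z2_x (v' N) i)) \<longlonglongrightarrow> 0"
      by simp
  qed
  ultimately have "(\<lambda>n. z2_form (u n) (v' N)) \<longlonglongrightarrow> 0" by simp
  then obtain n0 where n0: "\<And>n. n \<ge> n0 \<Longrightarrow> norm (z2_form (u n) (v' N)) < e / 2"
    using LIMSEQ_D[of _ 0 "e / 2"] e by fastforce
  have "norm (z2_form (u n) v - 0) < e" if n: "n \<ge> n0" for n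
  proof -
    have "z2_norm (u n) * z2_norm (v' N - v) \<le> C * (e / (4 * (C + 1)))"
      using C N C0 by (intro mult_mono) (auto simp: z2_norm_nonneg)
    moreover have "C * (e / (4 * (C + 1))) \<le> e / 4" using e C0 by (simp add: field_simps)
    moreover have eq: "z2_form (u n) v = z2_form (u n) (v' N) - z2_form (u n) (v' N - v)" by (simp add: z2_form_diff)
    moreover note norm_triangle_ineq4[of "z2_form (u n) (v' N)" "z2_form (u n) (v' N - v)"]
      norm_z2_form_le[of "u n" "v' N - v"] n0[OF n]
    ultimately show ?thesis unfolding diff_0_right by (subst eq) linarith
  qed
  then show "\<exists>no. \<forall>n\<ge>no. norm (z2_form (u n) v - 0) < e" by blast
qed

text \<open>Each linear coordinate of a vector is, up to sign, its pairing with a fixed vector, and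
  the adjoint moves \<open>A\<close> onto that fixed vector.\<close>

lemma z2_null_app:
  assumes u: "z2_null u" shows "z2_null (\<lambda>n. z2_app A (u n))"
proof -
  obtain C where C: "\<And>n. z2_norm (u n) \<le> C" using z2_null_bounded[OF u] by blast
  obtain K where K: "0 \<le> K" "\<And>u. z2_norm (z2_app A u) \<le> K * z2_norm u" using z2_op_bounded by blast
  have form: "(\<lambda>n. z2_form (z2_app A (u n)) v) \<longlonglongrightarrow> 0" for v
    unfolding z2_form_adjoint by (rule z2_null_form_tendsto[OF u])
  have y: "l2_nth (z2_y w) i = - z2_form w (z2_emb (l2_e i))" for w :: "'a z2" and i
    by (simp add: z2_form_emb l2_inner_e)
  \<comment> \<open>Because \<open>ln 1 = 0\<close>; hence pairing with
    \<open>z2_sec (l2_e i)\<close> returns exactly the coordinate \<open>z2_x\<close>.\<close>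
  have Om: "l2_Omega (l2_e i :: 'a l2) n = 0" for i n by (simp add: l2_Omega_eq)
  have x: "z2_x w i = z2_form w (z2_sec (l2_e i))" for w :: "'a z2" and i
  proof -
    have "z2_form w (z2_sec (l2_e i)) = (\<Sum>n. if n = i then z2_x w n else 0)"
      unfolding z2_form_def by (rule arg_cong[where f = suminf]) (auto simp: fun_eq_iff Om)
    then show ?thesis using sums_single[of i "z2_x w", THEN sums_unique] by simp
  qed
  show ?thesis
  proof (rule z2_nullI)
    show "z2_norm (z2_app A (u n)) \<le> K * C" for n
      using K(2)[of "u n"] mult_left_mono[OF C K(1), of n] by linarith
    show "(\<lambda>n. z2_x (z2_app A (u n)) i) \<longlonglongrightarrow> 0" for i unfolding x by (rule form)
    show "(\<lambda>n. l2_nth (z2_y (z2_app A (u n))) i) \<longlonglongrightarrow> 0" for i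
      unfolding y using tendsto_minus[OF form] by simp
  qed
qed

section \<open>Logarithmic growth along blocks\<close>

lemma norm_l2_sum_small:
  fixes x :: "nat \<Rightarrow> 'k::rc_field l2"
  assumes "\<And>k. norm (x k) \<le> c * (1/16) ^ k" shows "norm (\<Sum>k<n. x k) \<le> 2 * c"
proof -
  have c: "0 \<le> c" using assms[of 0] norm_ge_zero[of "x 0"] by (simp del: norm_ge_zero)
  have "norm (\<Sum>k<n. x k) \<le> (\<Sum>k<n. c * (1/16) ^ k)"
    using assms by (intro order_trans[OF norm_sum sum_mono])
  also have "\<dots> = c * (\<Sum>k<n. (1/16) ^ k)" by (simp add: sum_distrib_left)
  also have "\<dots> \<le> c * 2"
  proof (rule mult_left_mono[OF _ c])
    show "(\<Sum>k<n. (1/16 :: real) ^ k) \<le> 2"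
    proof -
      have "15 * (\<Sum>k<n. (1/16 :: real) ^ k) = 16 - 16 * (1/16) ^ n" by (simp add: sum_gp_strict)
      moreover have "0 \<le> (1/16 :: real) ^ n" by simp
      ultimately show ?thesis by linarith
    qed
  qed
  finally show ?thesis by simp
qed

text \<open>The normalisation absorbs the logarithm, so perturbations with bounded sums stay bounded
  after averaging and multiplication by \<open>ln (sqrt n)\<close>.\<close>

lemma ln_sqrt_div_le: "0 < n \<Longrightarrow> \<bar>ln (sqrt (real n))\<bar> * (1 / sqrt (real n)) \<le> 1"
  using ln_le_minus_one[of "sqrt (real n)"] ln_ge_zero[of "sqrt (real n)"] by (simp add: divide_le_eq)

lemma norm_l2_avg_le: "norm (l2_avg n x) \<le> norm (\<Sum>k<n. x k)"
proof -
  have "1 / sqrt (real n) \<le> 1" by (cases n) auto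
  from mult_right_mono[OF this norm_ge_zero] show ?thesis by (simp add: l2_avg_def norm_divide)
qed

lemma z2_norm_avg_le: "z2_norm (z2_avg n x) \<le> z2_norm (\<Sum>k<n. x k)"
proof -
  have "1 / sqrt (real n) \<le> 1" by (cases n) auto
  from mult_right_mono[OF this z2_norm_nonneg] show ?thesis by (simp add: z2_avg_def norm_divide z2_norm_scale)
qed

lemma norm_ln_l2_avg_le: "0 < n \<Longrightarrow> norm (ln (sqrt (real n)) *\<^sub>R l2_avg n x) \<le> norm (\<Sum>k<n. x k)"
  using mult_right_mono[OF ln_sqrt_div_le norm_ge_zero, of n "\<Sum>k<n. x k"]
  by (simp add: l2_avg_def norm_divide)

lemma l2_avg_diff: "l2_avg n (\<lambda>k. x k - y k) = l2_avg n x - l2_avg n y"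
  by (simp add: l2_avg_def sum_subtractf l2.scale_right_diff_distrib)

lemma z2_avg_add: "z2_avg n (\<lambda>k. x k + y k) = z2_avg n x + z2_avg n y"
  by (simp add: z2_avg_def sum.distrib z2.scale_right_distrib)

lemma z2_avg_diff: "z2_avg n (\<lambda>k. x k - y k) = z2_avg n x - z2_avg n y"
  by (simp add: z2_avg_def sum_subtractf z2.scale_right_diff_distrib)

lemma z2_y_avg: "z2_y (z2_avg n x) = l2_avg n (\<lambda>k. z2_y (x k))"
  by (simp add: z2_avg_def l2_avg_def)

text \<open>By \<open>z2_avg_sec_blocks\<close> the averages of \<open>v\<close> differ from \<open>- ln (sqrt n)\<close> times the averages
  of \<open>z2_y (v k)\<close> by a bounded amount; a matching logarithmic correction can only come from
  \<open>z2_y (v k)\<close> itself.\<close>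

lemma log_growth_separation:
  fixes v :: "nat \<Rightarrow> 'k::rc_field z2" and d :: "nat \<Rightarrow> 'k l2"
  defines "P \<equiv> \<lambda>N k. l2_proj {N k..<N (Suc k)}"
  assumes N: "strict_mono N" and c: "0 < c" "c \<le> 1" "4 * c \<le> \<delta>"
    and C: "\<And>k. z2_norm (v k) \<le> C" "\<And>k. norm (d k) \<le> C"
    and near: "\<And>k. norm (z2_d (v k) - P N k (z2_d (v k))) \<le> c * (1/256) ^ k"
      "\<And>k. norm (z2_y (v k) - P N k (z2_y (v k))) \<le> c * (1/256) ^ k"
      "\<And>k. norm (d k - P N k (d k)) \<le> c * (1/256) ^ k"
    and B: "\<And>n. 0 < n \<Longrightarrow> z2_norm (z2_avg n v + z2_emb (ln (sqrt (real n)) *\<^sub>R l2_avg n d)) \<le> B"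
    and sep: "\<And>k. \<delta> \<le> norm (d k - z2_y (v k))"
  shows False
proof -
  have C0: "0 \<le> C" using C(1)[of 0] z2_norm_nonneg[of "v 0"] by linarith
  define a' where "a' = (\<lambda>k. P N k (z2_d (v k)))"
  define y' where "y' = (\<lambda>k. P N k (z2_y (v k)))"
  define d' where "d' = (\<lambda>k. P N k (d k))"
  have bl: "blocks N a'" "blocks N y'" "blocks N d'"
    unfolding a'_def y'_def d'_def P_def by (rule blocks_proj[OF N])+
  have le: "norm (a' k) \<le> C" "norm (y' k) \<le> C" "norm (d' k) \<le> C" for k
    unfolding a'_def y'_def d'_def P_def
    using C[of k] norm_z2_d_le[of "v k"] norm_z2_y_le[of "v k"]
    by (meson norm_l2_proj_le order_trans)+
  define e where "e = (\<lambda>k. v k - (z2_emb (a' k) + z2_sec (y' k)))"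
  have small: "c * (1/256) ^ k \<le> (1/16) ^ k" for k
  proof -
    have "c * (1/256) ^ k \<le> 1 * (1/16) ^ k" using c by (intro mult_mono power_mono) auto
    then show ?thesis by simp
  qed
  have e: "z2_norm (e k) \<le> (3 + 2 * sqrt C) * (1/16) ^ k" for k
  proof -
    have ee: "e k = z2_emb (z2_d (v k) - a' k) + (z2_sec (z2_y (v k)) - z2_sec (y' k))"
      unfolding e_def by (subst z2_decompose[of "v k"]) simp
    have r: "norm (z2_y (v k) - y' k) \<le> (1/16) ^ k" "norm (z2_d (v k) - a' k) \<le> (1/16) ^ k"
      unfolding y'_def a'_def using near[of k] small[of k] by linarith+
    have "norm (z2_y (v k) - y' k) \<le> 1 * (1/256) ^ k"
      unfolding y'_def by (rule order_trans[OF near(2) mult_right_mono[OF c(2)]]) simp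
    moreover have "norm (z2_y (v k)) \<le> C" using norm_z2_y_le[of "v k"] C(1)[of k] by linarith
    ultimately have "sqrt (norm (z2_y (v k)) * norm (z2_y (v k) - y' k)) \<le> sqrt (C * (1/256) ^ k)"
      using C0 by (intro real_sqrt_le_mono mult_mono) auto
    \<comment> \<open>The square root from \<open>z2_sec_proj_close\<close> turns the rate
      \<open>1/256\<close> into \<open>1/16\<close>, which \<open>z2_norm_sum_small\<close> can
      sum.\<close>
    also have "\<dots> = sqrt C * (1/16) ^ k"
    proof -
      have "(1/256 :: real) ^ k = ((1/16) ^ k)\<^sup>2" by (simp add: power2_eq_square flip: power_mult_distrib)
      then show ?thesis by (simp add: real_sqrt_mult)
    qed
    finally have "z2_norm (z2_sec (z2_y (v k)) - z2_sec (y' k)) \<le> 2 * (1/16) ^ k + 2 * (sqrt C * (1/16) ^ k)"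
      using z2_sec_proj_close[of "z2_y (v k)" "{N k..<N (Suc k)}"] r(1) unfolding y'_def P_def by linarith
    then show ?thesis
      unfolding ee using z2_norm_emb_add_le[of "z2_d (v k) - a' k" "z2_sec (z2_y (v k)) - z2_sec (y' k)"] r(2)
      by (simp add: algebra_simps)
  qed
  define M where "M = 8 * (8 * (B + 16 * (3 + 2 * sqrt C)) + (2 * (1 + C\<^sup>2) + C)) + (2 + C)"
  have key: "ln (sqrt (real n)) * (\<delta> / 2) \<le> M" if n: "0 < n" for n
  proof -
    define L where "L = ln (sqrt (real n))"
    have L0: "0 \<le> L" using n by (simp add: L_def)
    define G where "G = z2_avg n (\<lambda>k. z2_sec (y' k)) + z2_emb (L *\<^sub>R l2_avg n y')"
    have G: "z2_norm G \<le> 2 * (1 + C\<^sup>2) + C"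
      unfolding G_def L_def by (rule z2_avg_sec_blocks_bounded[OF bl(2) le(2) n])
    have ve: "z2_avg n v = z2_emb (l2_avg n a') + z2_avg n (\<lambda>k. z2_sec (y' k)) + z2_avg n e"
      by (simp add: z2_avg_add[symmetric] z2_avg_emb[symmetric] e_def)
    have dd: "norm (L *\<^sub>R l2_avg n (\<lambda>k. d k - d' k)) \<le> 2 * 1"
      unfolding L_def
      by (rule order_trans[OF norm_ln_l2_avg_le[OF n] norm_l2_sum_small])
        (use near(3) small in \<open>simp add: d'_def, meson order_trans\<close>)
    define X where "X = z2_avg n v + z2_emb (L *\<^sub>R l2_avg n d) - z2_avg n e - G"
    \<comment> \<open>The term carrying the factor \<open>L\<close> is isolated on the left;
      \<open>X\<close> and the embedded remainder are bounded independently of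
      \<open>n\<close>.\<close>
    have "z2_emb (L *\<^sub>R l2_avg n (\<lambda>k. d' k - y' k)) = X + z2_emb (- (L *\<^sub>R l2_avg n (\<lambda>k. d k - d' k)) - l2_avg n a')"
      unfolding X_def G_def ve l2_avg_diff by (simp add: scaleR_diff_right)
    then have "norm (L *\<^sub>R l2_avg n (\<lambda>k. d' k - y' k)) = z2_norm (z2_emb (- (L *\<^sub>R l2_avg n (\<lambda>k. d k - d' k)) - l2_avg n a') + X)"
      by (metis z2_norm_emb add.commute)
    also have "\<dots> \<le> norm (- (L *\<^sub>R l2_avg n (\<lambda>k. d k - d' k)) - l2_avg n a') + z2_norm X"
      by (rule z2_norm_emb_add_le)
    also have "\<dots> \<le> (2 + C) + 8 * (8 * (B + 16 * (3 + 2 * sqrt C)) + (2 * (1 + C\<^sup>2) + C))"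
    proof (rule add_mono)
      show "norm (- (L *\<^sub>R l2_avg n (\<lambda>k. d k - d' k)) - l2_avg n a') \<le> 2 + C"
        using norm_triangle_ineq4[of "- (L *\<^sub>R l2_avg n (\<lambda>k. d k - d' k))" "l2_avg n a'"]
          dd l2_avg_blocks_le[OF bl(1) le(1) n] unfolding norm_minus_cancel by linarith
      have "z2_norm (z2_avg n e) \<le> 16 * (3 + 2 * sqrt C)"
        by (rule order_trans[OF z2_norm_avg_le z2_norm_sum_small[OF e]])
      then have "z2_norm (z2_avg n v + z2_emb (L *\<^sub>R l2_avg n d) - z2_avg n e) \<le> 8 * (B + 16 * (3 + 2 * sqrt C))"
        using z2_norm_diff[of "z2_avg n v + z2_emb (L *\<^sub>R l2_avg n d)" "z2_avg n e"] B[OF n] unfolding L_def by argo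
      then show "z2_norm X \<le> 8 * (8 * (B + 16 * (3 + 2 * sqrt C)) + (2 * (1 + C\<^sup>2) + C))"
        unfolding X_def using z2_norm_diff[of "z2_avg n v + z2_emb (L *\<^sub>R l2_avg n d) - z2_avg n e" G] G by argo
    qed
    also have "\<dots> = M" by (simp add: M_def)
    finally have "L * norm (l2_avg n (\<lambda>k. d' k - y' k)) \<le> M" using L0 by simp
    \<comment> \<open>Passing to the blocks costs \<open>\<delta> / 4\<close> for each of the two
      sequences, by \<open>4 * c \<le> \<delta>\<close>.\<close>
    moreover have "\<delta> / 2 \<le> norm (l2_avg n (\<lambda>k. d' k - y' k))"
    proof (rule l2_avg_blocks_ge[OF blocks_diff[OF bl(3,2)] _ _ n])
      show "0 \<le> \<delta> / 2" using c by simp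
      fix k
      have "c * (1/256) ^ k \<le> c" using c by (simp add: mult_left_le power_le_one)
      then have "norm (d k - d' k) \<le> \<delta> / 4" "norm (z2_y (v k) - y' k) \<le> \<delta> / 4"
        using near(2,3)[of k] c(3) unfolding d'_def y'_def by linarith+
      moreover have "norm ((d' k - y' k) + (d k - d' k) - (z2_y (v k) - y' k))
          \<le> norm (d' k - y' k) + norm (d k - d' k) + norm (z2_y (v k) - y' k)"
        by (rule order_trans[OF norm_triangle_ineq4 add_right_mono[OF norm_triangle_ineq]])
      then have "norm (d k - z2_y (v k)) \<le> norm (d' k - y' k) + norm (d k - d' k) + norm (z2_y (v k) - y' k)"
        by (simp add: algebra_simps)
      ultimately show "\<delta> / 2 \<le> norm (d' k - y' k)" using sep[of k] by linarith
    qed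
    ultimately show ?thesis
      unfolding L_def[symmetric] using mult_left_mono[OF _ L0] order_trans by blast
  qed
  \<comment> \<open>Large enough that \<open>ln m * (\<delta> / 2)\<close> exceeds \<open>M\<close>;
    the contradiction is taken at \<open>n = m * m\<close>, where
    \<open>ln (sqrt n) = ln m\<close>.\<close>
  obtain m :: nat where m: "exp (2 * \<bar>M\<bar> / \<delta> + 1) < real m" using reals_Archimedean2 by blast
  have d0: "0 < \<delta>" using c by linarith
  have "0 < m" using m exp_gt_zero[of "2 * \<bar>M\<bar> / \<delta> + 1"] by (cases m) auto
  then have "ln (exp (2 * \<bar>M\<bar> / \<delta> + 1)) < ln (real m)" using m by (subst ln_less_cancel_iff) auto
  then have "2 * \<bar>M\<bar> / \<delta> + 1 < ln (real m)" by simp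
  moreover have "ln (real m) * (\<delta> / 2) \<le> M" using key[of "m * m"] \<open>0 < m\<close> by simp
  moreover have "ln (real m) * (\<delta> / 2) > (2 * \<bar>M\<bar> / \<delta> + 1) * (\<delta> / 2)"
    using calculation(1) d0 by (intro mult_strict_right_mono) auto
  moreover have "(2 * \<bar>M\<bar> / \<delta> + 1) * (\<delta> / 2) = \<bar>M\<bar> + \<delta> / 2" using d0 by (simp add: field_simps)
  ultimately show False using d0 by linarith
qed

lemma not_tendsto_0_frequently:
  fixes f :: "nat \<Rightarrow> 'a::real_normed_vector"
  assumes "\<not> f \<longlonglongrightarrow> 0"
  obtains \<delta> where "0 < \<delta>" "\<And>m. \<exists>n\<ge>m. \<delta> \<le> norm (f n)"
  using assms that unfolding LIMSEQ_def dist_norm by (metis diff_zero not_less)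

lemma blocks_e: "strict_mono r \<Longrightarrow> blocks r (\<lambda>k. l2_e (r k))"
  unfolding blocks_def using strict_mono_Suc_iff[of r] by auto

lemma z2_null_app_e: "z2_null (\<lambda>n. z2_app T (z2_e n))"
  unfolding z2_e_eq by (rule z2_null_app[OF z2_null_emb[OF l2_null_e]])

text \<open>Averages of distinct unit vectors have norm at most 1, so those of their images stay
  bounded; \<open>log_growth_separation\<close> with \<open>d = 0\<close> then excludes second
  components bounded away from 0 along a subsequence.\<close>

lemma z2_y_app_e_tendsto: "(\<lambda>n. z2_y (z2_app T (z2_e n))) \<longlonglongrightarrow> 0"
proof (rule ccontr)
  assume "\<not> ?thesis"
  then obtain \<delta> where \<delta>: "0 < \<delta>" "\<And>m. \<exists>n\<ge>m. \<delta> \<le> norm (z2_y (z2_app T (z2_e n)))"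
    using not_tendsto_0_frequently by blast
  define c where "c = min 1 (\<delta> / 4)"
  define f where "f = (\<lambda>j n. (if j then z2_d else z2_y) (z2_app T (z2_e n)))"
  have null: "l2_null (f j)" for j using z2_null_app_e[of T] by (auto simp: f_def z2_null_def)
  obtain r N :: "nat \<Rightarrow> nat" where rN: "strict_mono r" "strict_mono N"
    "\<And>k. \<delta> \<le> norm (z2_y (z2_app T (z2_e (r k))))"
    "\<And>k j. j \<in> UNIV \<Longrightarrow> norm (f j (r k) - l2_proj {N k..<N (Suc k)} (f j (r k))) \<le> c * (1/256) ^ k"
    by (rule gliding_hump[of UNIV f "\<lambda>k. c * (1/256) ^ k" "\<lambda>k n. \<delta> \<le> norm (z2_y (z2_app T (z2_e n)))"])
      (use \<delta> null in \<open>auto simp: c_def\<close>)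
  obtain C where C: "\<And>n. z2_norm (z2_app T (z2_e n)) \<le> C" using z2_null_bounded[OF z2_null_app_e] by blast
  have C0: "0 \<le> C" using C[of 0] z2_norm_nonneg order_trans by blast
  obtain K where K: "0 \<le> K" "\<And>u. z2_norm (z2_app T u) \<le> K * z2_norm u" using z2_op_bounded by blast
  show False
  proof (rule log_growth_separation[OF rN(2), of c \<delta> "\<lambda>k. z2_app T (z2_e (r k))" C "\<lambda>_. 0" K])
    fix n :: nat assume n: "0 < n"
    have "z2_norm (z2_app T (z2_emb (l2_avg n (\<lambda>k. l2_e (r k))))) \<le> K * norm (l2_avg n (\<lambda>k. l2_e (r k) :: 'a l2))"
      using K(2)[of "z2_emb (l2_avg n (\<lambda>k. l2_e (r k)))"] by simp
    also have "\<dots> \<le> K * 1"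
      by (intro mult_left_mono K l2_avg_blocks_le[OF blocks_e[OF rN(1)] _ n]) simp
    finally show "z2_norm (z2_avg n (\<lambda>k. z2_app T (z2_e (r k))) + z2_emb (ln (sqrt (real n)) *\<^sub>R l2_avg n (\<lambda>_. 0))) \<le> K"
      by (simp add: z2_e_eq z2_avg_emb flip: z2_app_avg) (simp add: l2_avg_def)
  qed (use rN(3,4) rN(4)[of True] rN(4)[of False] \<delta> C C0 in \<open>auto simp: c_def f_def\<close>)
qed

section \<open>Compatibility of the symplectic and the Hilbert space adjoint\<close>

text \<open>Modulo null sequences, an operator acts in the same way on the subspace and on the
  quotient of the twisted sum.\<close>

lemma z2_y_app_sec_close:
  fixes b d :: "nat \<Rightarrow> 'k::rc_field l2"
  assumes b: "blocks N0 b" "\<And>k. norm (b k) \<le> C" and d: "l2_null d"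
    and close: "\<And>k. z2_norm (z2_app A (z2_emb (b k)) - z2_emb (d k)) \<le> D * (1/16) ^ k"
    and \<delta>: "0 < \<delta>"
  shows "\<exists>k\<ge>m. norm (d k - z2_y (z2_app A (z2_sec (b k)))) < \<delta>"
proof (rule ccontr)
  assume "\<not> ?thesis"
  then have far: "\<And>k. k \<ge> m \<Longrightarrow> \<delta> \<le> norm (d k - z2_y (z2_app A (z2_sec (b k))))" by force
  define c where "c = min 1 (\<delta> / 4)"
  define v where "v = (\<lambda>k. z2_app A (z2_sec (b k)))"
  have v: "z2_null v" unfolding v_def by (rule z2_null_app[OF z2_null_sec[OF blocks_null[OF b]]])
  \<comment> \<open>Both norm coordinates of \<open>v\<close> and the target \<open>d\<close> are to
    become almost blocks on common intervals.\<close>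
  define f where "f = (\<lambda>j::nat. if j = 0 then (\<lambda>n. z2_d (v n)) else if j = 1 then (\<lambda>n. z2_y (v n)) else d)"
  have null: "l2_null (f j)" for j using v d by (auto simp: f_def z2_null_def)
  have ex: "\<exists>n\<ge>l. m \<le> n" for l by (rule exI[of _ "max l m"]) simp
  obtain r N :: "nat \<Rightarrow> nat" where rN: "strict_mono r" "strict_mono N" "\<And>k. m \<le> r k"
    "\<And>k j. j \<in> {0,1,2} \<Longrightarrow> norm (f j (r k) - l2_proj {N k..<N (Suc k)} (f j (r k))) \<le> c * (1/256) ^ k"
    by (rule gliding_hump[of "{0,1,2}" f "\<lambda>k. c * (1/256) ^ k" "\<lambda>k n. m \<le> n"])
      (use \<delta> null ex in \<open>auto simp: c_def\<close>)
  obtain C1 where C1: "\<And>n. z2_norm (v n) \<le> C1" using z2_null_bounded[OF v] by blast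
  obtain C2 where C2: "\<And>n. norm (d n) \<le> C2" using d by (auto simp: l2_null_def)
  obtain K where K: "0 \<le> K" "\<And>u. z2_norm (z2_app A u) \<le> K * z2_norm u" using z2_op_bounded by blast
  have D: "0 \<le> D" using order_trans[OF z2_norm_nonneg close[of 0]] by simp
  show False
  proof (rule log_growth_separation[OF rN(2), of c \<delta> "\<lambda>k. v (r k)" "max C1 C2" "\<lambda>k. d (r k)"
        "8 * (K * (2 * (1 + C\<^sup>2) + C) + 16 * D)"])
    fix n :: nat assume n: "0 < n"
    define L where "L = ln (sqrt (real n))"
    define g where "g = (\<lambda>k. z2_app A (z2_emb (b (r k))) - z2_emb (d (r k)))"
    \<comment> \<open>Bounded in \<open>n\<close>, and so is its image. Hence the growth of the
      averages of \<open>v\<close> must be cancelled by the images of the embedded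
      \<open>b (r k)\<close>, that is, up to the errors \<open>g\<close>, by the
      \<open>d (r k)\<close>.\<close>
    define G where "G = z2_avg n (\<lambda>k. z2_sec (b (r k))) + z2_emb (L *\<^sub>R l2_avg n (\<lambda>k. b (r k)))"
    have "z2_norm G \<le> 2 * (1 + C\<^sup>2) + C"
      unfolding G_def L_def by (rule z2_avg_sec_blocks_bounded[OF blocks_subseq[OF b(1) rN(1)] b(2) n])
    then have AG: "z2_norm (z2_app A G) \<le> K * (2 * (1 + C\<^sup>2) + C)"
      using K(2)[of G] mult_left_mono[OF _ K(1)] order_trans by blast
    have "z2_norm (g k) \<le> D * (1/16) ^ k" for k
    proof -
      have "(1/16 :: real) ^ r k \<le> (1/16) ^ k"
        by (rule power_decreasing[OF strict_mono_imp_increasing[OF rN(1)]]) auto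
      from mult_left_mono[OF this D] show ?thesis using close[of "r k"] by (simp add: g_def)
    qed
    then have gs: "z2_norm (\<Sum>k<n. g k) \<le> 16 * D" by (rule z2_norm_sum_small)
    have "z2_norm (z2_scale (of_real L) (z2_avg n g)) = \<bar>L\<bar> * (1 / sqrt (real n)) * z2_norm (\<Sum>k<n. g k)"
      by (simp add: z2_avg_def z2_norm_scale norm_divide)
    also have "\<dots> \<le> 1 * z2_norm (\<Sum>k<n. g k)"
      unfolding L_def by (intro mult_right_mono ln_sqrt_div_le n z2_norm_nonneg)
    finally have Lg: "z2_norm (z2_scale (of_real L) (z2_avg n g)) \<le> 16 * D" using gs by simp
    have "z2_avg n (\<lambda>k. v (r k)) + z2_emb (L *\<^sub>R l2_avg n (\<lambda>k. d (r k))) = z2_app A G - z2_scale (of_real L) (z2_avg n g)"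
      unfolding G_def g_def v_def z2_avg_diff
      by (simp add: z2_app_avg scaleR_l2_conv z2.scale_right_diff_distrib flip: z2_avg_emb)
    then show "z2_norm (z2_avg n (\<lambda>k. v (r k)) + z2_emb (ln (sqrt (real n)) *\<^sub>R l2_avg n (\<lambda>k. d (r k))))
        \<le> 8 * (K * (2 * (1 + C\<^sup>2) + C) + 16 * D)"
      unfolding L_def[symmetric] using z2_norm_diff[of "z2_app A G" "z2_scale (of_real L) (z2_avg n g)"] AG Lg by simp
  next
    show "\<delta> \<le> norm (d (r k) - z2_y (v (r k)))" for k using far[OF rN(3)] by (simp add: v_def)
    show "z2_norm (v (r k)) \<le> max C1 C2" "norm (d (r k)) \<le> max C1 C2" for k
      using C1[of "r k"] C2[of "r k"] by auto
  qed (use rN(4)[of 0] rN(4)[of 1] rN(4)[of 2] \<delta> in \<open>auto simp: c_def f_def\<close>)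
qed

text \<open>If this fails along a subsequence, \<open>R (e n, 0)\<close> can be replaced there by
  blocks \<open>b k\<close>, and pairing embedded vectors with the section of \<open>b k\<close>
  recovers inner products with \<open>b k\<close>. The other side of the adjoint identity contains
  the second component of the image of that section, which \<open>z2_y_app_sec_close\<close>
  compares with the \<open>z2_d\<close> coordinate of the image of \<open>b k\<close>
  itself.\<close>

lemma l2_inner_adjoint_tendsto:
  fixes A T R :: "'k::rc_field z2_op"
  shows "(\<lambda>n. l2_inner (z2_d (z2_app (A * T) (z2_e n))) (z2_d (z2_app R (z2_e n)))
    - l2_inner (z2_d (z2_app T (z2_e n))) (z2_d (z2_app (op_star A * R) (z2_e n)))) \<longlonglongrightarrow> 0" (is "?\<Delta> \<longlonglongrightarrow> 0")
proof (rule ccontr)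
  assume "\<not> ?thesis"
  then obtain \<delta> where \<delta>: "0 < \<delta>" "\<And>m. \<exists>n\<ge>m. \<delta> \<le> norm (?\<Delta> n)"
    using not_tendsto_0_frequently by blast
  define p where "p = (\<lambda>S n. z2_d (z2_app S (z2_e n :: 'k z2)))"
  define q where "q = (\<lambda>S n. norm (z2_y (z2_app S (z2_e n :: 'k z2))))"
  \<comment> \<open>The four operators whose images of \<open>(e n, 0)\<close> must lie close to the
    embedded subspace.\<close>
  define E where "E = {T, R, A * T, op_star A * R}"
  have pn: "l2_null (p S)" for S using z2_null_app_e[of S] by (simp add: p_def z2_null_def)
  have Q: "\<exists>n\<ge>m. \<delta> \<le> norm (?\<Delta> n) \<and> (\<forall>S\<in>E. q S n \<le> (1/16) ^ k)" for k m
  proof -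
    have "\<forall>\<^sub>F n in sequentially. \<forall>S\<in>E. q S n < (1/16) ^ k"
    proof (rule eventually_ball_finite)
      show "finite E" by (simp add: E_def)
      show "\<forall>S\<in>E. \<forall>\<^sub>F n in sequentially. q S n < (1/16) ^ k"
        unfolding q_def by (intro ballI order_tendstoD[OF tendsto_norm_zero[OF z2_y_app_e_tendsto]]) simp
    qed
    then obtain n0 where n0: "\<And>n. n \<ge> n0 \<Longrightarrow> \<forall>S\<in>E. q S n < (1/16) ^ k" unfolding eventually_sequentially by blast
    obtain n where "n \<ge> max m n0" "\<delta> \<le> norm (?\<Delta> n)" using \<delta>(2) by blast
    then show ?thesis using n0[of n] by (intro exI[of _ n]) (auto simp: less_imp_le)
  qed
  obtain r N :: "nat \<Rightarrow> nat" where rN: "strict_mono r" "strict_mono N"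
    "\<And>k. \<delta> \<le> norm (?\<Delta> (r k)) \<and> (\<forall>S\<in>E. q S (r k) \<le> (1/16) ^ k)"
    "\<And>k j. j \<in> {()} \<Longrightarrow> norm (p R (r k) - l2_proj {N k..<N (Suc k)} (p R (r k))) \<le> (1/16) ^ k"
    by (rule gliding_hump[of "{()}" "\<lambda>_. p R" "\<lambda>k. (1/16) ^ k" "\<lambda>k n. \<delta> \<le> norm (?\<Delta> n) \<and> (\<forall>S\<in>E. q S n \<le> (1/16) ^ k)"])
      (use Q pn in auto)
  define b where "b = (\<lambda>k. l2_proj {N k..<N (Suc k)} (p R (r k)))"
  obtain C where C: "\<And>S n. S \<in> E \<Longrightarrow> z2_norm (z2_app S (z2_e n)) \<le> C"
  proof -
    have "\<exists>C. \<forall>n. z2_norm (z2_app S (z2_e n)) \<le> C" for S :: "'k z2_op"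
      using z2_null_bounded[OF z2_null_app_e] by metis
    then obtain F where F: "\<And>S n. z2_norm (z2_app S (z2_e n :: 'k z2)) \<le> F S" by metis
    have "z2_norm (z2_app S (z2_e n)) \<le> Max (F ` E)" if "S \<in> E" for S n
      using F[of S n] that Max_ge[of "F ` E" "F S"] by (auto simp: E_def)
    then show ?thesis by (rule that)
  qed
  have RE: "R \<in> E" "T \<in> E" "A * T \<in> E" "op_star A * R \<in> E" by (auto simp: E_def)
  have C0: "0 \<le> C" using C[OF RE(1), of 0] z2_norm_nonneg order_trans by blast
  have pC: "norm (p S n) \<le> C" if "S \<in> E" for S n
    unfolding p_def using norm_z2_d_le C[OF that] order_trans by blast
  have bC: "norm (b k) \<le> C" for k
    unfolding b_def using norm_l2_proj_le pC[OF RE(1)] order_trans by blast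
  have pb: "norm (p R (r k) - b k) \<le> (1/16) ^ k" for k using rN(4)[of "()" k] by (simp add: b_def)
  obtain K where K: "0 \<le> K" "\<And>u. z2_norm (z2_app (op_star A) u) \<le> K * z2_norm u" using z2_op_bounded by blast
  have qk: "q S (r k) \<le> (1/16) ^ k" if "S \<in> E" for S k using rN(3) that by blast
  have err: "z2_norm (z2_app S (z2_e n) - z2_emb (p S n)) = q S n" for S n
    unfolding p_def q_def by (rule z2_norm_diff_emb_d)
  have close: "z2_norm (z2_app (op_star A) (z2_emb (b k)) - z2_emb (p (op_star A * R) (r k))) \<le> (8 * (K * 2 + 1)) * (1/16) ^ k" for k
  proof -
    have "z2_norm (z2_emb (b k) - z2_app R (z2_e (r k))) = z2_norm (z2_emb (p R (r k) - b k) + (z2_app R (z2_e (r k)) - z2_emb (p R (r k))))"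
      by (subst z2_norm_minus_commute) (simp add: algebra_simps)
    also have "\<dots> \<le> norm (p R (r k) - b k) + q R (r k)"
      unfolding err[symmetric] by (rule z2_norm_emb_add_le)
    also have "\<dots> \<le> 2 * (1/16) ^ k" using pb[of k] qk[OF RE(1), of k] by simp
    finally have 1: "z2_norm (z2_app (op_star A) (z2_emb (b k) - z2_app R (z2_e (r k)))) \<le> K * (2 * (1/16) ^ k)"
      using K(2) mult_left_mono[OF _ K(1)] order_trans by blast
    have "z2_app (op_star A) (z2_emb (b k)) - z2_emb (p (op_star A * R) (r k))
       = z2_app (op_star A) (z2_emb (b k) - z2_app R (z2_e (r k)))
         + (z2_app (op_star A * R) (z2_e (r k)) - z2_emb (p (op_star A * R) (r k)))" by simp
    then show ?thesis
      using z2_norm_add[of "z2_app (op_star A) (z2_emb (b k) - z2_app R (z2_e (r k)))"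
          "z2_app (op_star A * R) (z2_e (r k)) - z2_emb (p (op_star A * R) (r k))"]
        1 qk[OF RE(4), of k] unfolding err by (simp add: algebra_simps)
  qed
  define v where "v = (\<lambda>k. z2_app (op_star A) (z2_sec (b k)))"
  have vC: "z2_norm (v k) \<le> K * C" for k
    unfolding v_def using K(2)[of "z2_sec (b k)"] mult_left_mono[OF bC K(1), of k] by simp
  have bound: "norm (?\<Delta> (r k)) \<le> (C + 2 * C + 2 * (K * C)) * (1/16) ^ k + C * norm (p (op_star A * R) (r k) - z2_y (v k))" for k
  proof -
    let ?c = "p (A * T) (r k)" and ?a = "p T (r k)" and ?d = "p (op_star A * R) (r k)"
    let ?x = "z2_app (A * T) (z2_e (r k)) - z2_emb ?c" and ?w = "z2_app T (z2_e (r k)) - z2_emb ?a"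
    have "z2_form (z2_app (A * T) (z2_e (r k))) (z2_sec (b k)) = z2_form (z2_app T (z2_e (r k))) (v k)"
      unfolding v_def by (simp add: z2_form_adjoint)
    \<comment> \<open>Splitting off embedded parts leaves the inner products, with errors
      \<open>?x\<close> and \<open>?w\<close> of size \<open>(1/16) ^ k\<close>.\<close>
    then have "l2_inner ?c (b k) + z2_form ?x (z2_sec (b k)) = l2_inner ?a (z2_y (v k)) + z2_form ?w (v k)"
      by (simp add: z2_form_diff z2_form_emb)
    then have eq: "?\<Delta> (r k) = l2_inner ?c (p R (r k) - b k) - z2_form ?x (z2_sec (b k)) + z2_form ?w (v k)
        - l2_inner ?a (?d - z2_y (v k))"
      by (simp add: l2_inner_diff p_def algebra_simps)
    have "norm (l2_inner ?c (p R (r k) - b k)) \<le> C * (1/16) ^ k"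
      by (rule order_trans[OF norm_l2_inner_le mult_mono[OF pC[OF RE(3)] pb]]) (use C0 in auto)
    moreover have "z2_norm ?x \<le> (1/16) ^ k" unfolding err by (rule qk[OF RE(3)])
    then have "norm (z2_form ?x (z2_sec (b k))) \<le> 2 * ((1/16) ^ k * C)"
      by (intro order_trans[OF norm_z2_form_le mult_left_mono[OF mult_mono]])
        (use C0 bC in \<open>auto simp: z2_norm_nonneg\<close>)
    moreover have "norm (z2_form ?w (v k)) \<le> 2 * ((1/16) ^ k * (K * C))"
      by (rule order_trans[OF norm_z2_form_le mult_left_mono[OF mult_mono]])
        (use C0 vC qk[OF RE(2)] in \<open>auto simp: err z2_norm_nonneg\<close>)
    moreover have "norm (l2_inner ?a (?d - z2_y (v k))) \<le> C * norm (?d - z2_y (v k))"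
      by (rule order_trans[OF norm_l2_inner_le mult_right_mono[OF pC[OF RE(2)]]]) auto
    moreover have "norm (?\<Delta> (r k)) \<le> norm (l2_inner ?c (p R (r k) - b k)) + norm (z2_form ?x (z2_sec (b k)))
        + norm (z2_form ?w (v k)) + norm (l2_inner ?a (?d - z2_y (v k)))"
      unfolding eq
      by (intro order_trans[OF norm_triangle_ineq4 add_right_mono] order_trans[OF norm_triangle_ineq add_right_mono] norm_triangle_ineq4)
    ultimately show ?thesis by (simp add: algebra_simps)
  qed
  define M where "M = C + 2 * C + 2 * (K * C)"
  have "(\<lambda>k. M * (1/16) ^ k) \<longlonglongrightarrow> M * 0" by (intro tendsto_intros LIMSEQ_realpow_zero) auto
  then have "\<forall>\<^sub>F k in sequentially. M * (1/16) ^ k < \<delta> / 2"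
    by (rule order_tendstoD(2)) (use \<delta>(1) in simp)
  then obtain m where m: "\<And>k. k \<ge> m \<Longrightarrow> M * (1/16) ^ k < \<delta> / 2"
    unfolding eventually_sequentially by blast
  \<comment> \<open>One index beyond \<open>m\<close> suffices, because the lower bound
    \<open>\<delta>\<close> holds at every \<open>k\<close>.\<close>
  have "\<exists>k\<ge>m. norm (p (op_star A * R) (r k) - z2_y (z2_app (op_star A) (z2_sec (b k)))) < \<delta> / (2 * (C + 1))"
    by (rule z2_y_app_sec_close[OF _ bC l2_null_subseq[OF pn rN(1)] close])
      (use blocks_proj[OF rN(2)] \<delta> C0 in \<open>auto simp: b_def\<close>)
  then obtain k where k: "k \<ge> m" "norm (p (op_star A * R) (r k) - z2_y (v k)) < \<delta> / (2 * (C + 1))"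
    unfolding v_def by blast
  have "C * norm (p (op_star A * R) (r k) - z2_y (v k)) \<le> C * (\<delta> / (2 * (C + 1)))"
    using k(2) C0 by (intro mult_left_mono) auto
  also have "\<dots> \<le> \<delta> / 2" using \<delta> C0 by (simp add: field_simps)
  finally have "norm (?\<Delta> (r k)) < \<delta>" using bound[of k] m[OF k(1)] unfolding M_def by linarith
  then show False using rN(3)[of k] by linarith
qed

section \<open>Strict singularity of the quotient map\<close>

text \<open>A finite set spanning the kernel, enlarged by one vector of \<open>Y\<close> outside the
  kernel, would span \<open>Y\<close>.\<close>

lemma infdim_kernel:
  fixes \<phi> :: "'k::rc_field z2 \<Rightarrow> 'k"
  assumes Y: "z2.subspace Y" "\<nexists>B. finite B \<and> Y \<subseteq> z2.span B"
    and add: "\<And>u v. \<phi> (u + v) = \<phi> u + \<phi> v" and scale: "\<And>c u. \<phi> (z2_scale c u) = c * \<phi> u"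
  defines "Z \<equiv> {u \<in> Y. \<phi> u = 0}"
  shows "z2.subspace Z" "\<nexists>B. finite B \<and> Z \<subseteq> z2.span B"
proof -
  show "z2.subspace Z"
    using Y(1) scale[of 0 0] unfolding z2.subspace_def Z_def by (auto simp: add scale)
  show "\<nexists>B. finite B \<and> Z \<subseteq> z2.span B"
  proof
    assume "\<exists>B. finite B \<and> Z \<subseteq> z2.span B"
    then obtain B where B: "finite B" "Z \<subseteq> z2.span B" by blast
    show False
    proof (cases "\<forall>u\<in>Y. \<phi> u = 0")
      case True
      then have "Z = Y" by (auto simp: Z_def)
      with B Y(2) show False by blast
    next
      case False
      then obtain y where y: "y \<in> Y" "\<phi> y \<noteq> 0" by blast
      have "u \<in> z2.span (insert y B)" if u: "u \<in> Y" for u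
      proof -
        define c where "c = \<phi> u / \<phi> y"
        have "u + z2_scale (- c) y \<in> Z"
          using u y Y(1) by (auto simp: Z_def add scale c_def z2.subspace_add z2.subspace_scale simp del: z2.scale_minus_left)
        then have "u + z2_scale (- c) y \<in> z2.span (insert y B)"
          using B(2) z2.span_mono[of B "insert y B"] by blast
        moreover have "z2_scale c y \<in> z2.span (insert y B)" by (intro z2.span_scale z2.span_base) simp
        ultimately have "(u + z2_scale (- c) y) + z2_scale c y \<in> z2.span (insert y B)" by (rule z2.span_add)
        then show ?thesis by simp
      qed
      then show False using Y(2) B(1) by (meson finite_insert subsetI)
    qed
  qed
qed

text \<open>Linear coordinates are used so that passing from \<open>N\<close> to
  \<open>N + 1\<close> means intersecting with two kernels.\<close>

definition z2_tails :: "'k::rc_field z2 set \<Rightarrow> nat \<Rightarrow> 'k z2 set" where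
  "z2_tails Y N = {u \<in> Y. \<forall>i<N. z2_x u i = 0 \<and> l2_nth (z2_y u) i = 0}"

lemma infdim_z2_tails:
  assumes Y: "z2.subspace Y" "\<nexists>B. finite B \<and> Y \<subseteq> z2.span B"
  shows "z2.subspace (z2_tails Y N) \<and> (\<nexists>B. finite B \<and> z2_tails Y N \<subseteq> z2.span B)"
proof (induction N)
  case 0
  then show ?case using Y by (simp add: z2_tails_def)
next
  case (Suc N)
  have "z2_tails Y (Suc N) = {u \<in> {u \<in> z2_tails Y N. z2_x u N = 0}. l2_nth (z2_y u) N = 0}"
    by (auto simp: z2_tails_def less_Suc_eq)
  moreover note infdim_kernel[OF infdim_kernel[OF Suc[THEN conjunct1] Suc[THEN conjunct2], of "\<lambda>u. z2_x u N"],
      of "\<lambda>u. l2_nth (z2_y u) N"]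
  ultimately show ?case by simp
qed

lemma infdim_nonzero:
  assumes "z2.subspace Y" "\<nexists>B. finite B \<and> Y \<subseteq> z2.span B" obtains u where "u \<in> Y" "u \<noteq> 0"
  using assms(2)[simplified, rule_format, of "{}"] by auto

lemma z2_null_tails:
  assumes f: "\<And>n. f n \<in> z2_tails Y n" "\<And>n. z2_norm (f n) \<le> C"
  shows "z2_null f"
proof (rule z2_nullI[OF f(2)])
  have ev: "\<forall>\<^sub>F n in sequentially. z2_x (f n) i = 0 \<and> l2_nth (z2_y (f n)) i = 0" for i
    unfolding eventually_sequentially using f(1) by (intro exI[of _ "Suc i"]) (force simp: z2_tails_def)
  show "(\<lambda>n. z2_x (f n) i) \<longlonglongrightarrow> 0" for i
    by (rule tendsto_eventually[OF eventually_mono[OF ev[of i]]]) simp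
  show "(\<lambda>n. l2_nth (z2_y (f n)) i) \<longlonglongrightarrow> 0" for i
    by (rule tendsto_eventually[OF eventually_mono[OF ev[of i]]]) simp
qed

text \<open>Otherwise the norm on a tail is equivalent to that of the second component. For
  normalised vectors running down the tails the averages of second components are bounded, hence so
  are the averages of the vectors, which \<open>log_growth_separation\<close> with
  \<open>d = 0\<close> forbids.\<close>

lemma quotient_strictly_singular:
  assumes Y: "z2.subspace Y" "\<nexists>B. finite B \<and> Y \<subseteq> z2.span B" and \<delta>: "0 < \<delta>"
  obtains u where "u \<in> z2_tails Y N0" "z2_norm u = 1" "norm (z2_y u) < \<delta>"
proof (rule ccontr)
  assume "\<not> thesis"
  then have far1: "\<delta> \<le> norm (z2_y u)" if "u \<in> z2_tails Y N0" "z2_norm u = 1" for u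
    using that \<open>\<And>u. \<lbrakk>u \<in> z2_tails Y N0; z2_norm u = 1; norm (z2_y u) < \<delta>\<rbrakk> \<Longrightarrow> thesis\<close> by fastforce
  have sub: "z2.subspace (z2_tails Y N)" for N using infdim_z2_tails[OF Y] by blast
  have normalise: "z2_norm (z2_scale (of_real (1 / z2_norm u)) u) = 1" if "u \<noteq> 0" for u :: "'a z2"
    using that z2_norm_zero_iff[of u] z2_norm_nonneg[of u] by (simp add: z2_norm_scale norm_divide)
  have far: "\<delta> * z2_norm u \<le> norm (z2_y u)" if u: "u \<in> z2_tails Y N0" for u
  proof (cases "u = 0")
    case False
    have "\<delta> \<le> norm (z2_y (z2_scale (of_real (1 / z2_norm u)) u))"
      by (rule far1[OF z2.subspace_scale[OF sub u] normalise[OF False]])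
    then have "\<delta> \<le> norm (z2_y u) / z2_norm u" using z2_norm_nonneg[of u] by (simp add: norm_divide)
    moreover have "0 < z2_norm u" using False z2_norm_zero_iff[of u] z2_norm_nonneg[of u] by (simp add: less_le)
    ultimately show ?thesis by (simp add: pos_le_divide_eq)
  qed (simp add: z2_norm_zero)
  \<comment> \<open>The maximum keeps all vectors in the tail where \<open>far\<close> holds, while
    their coordinates tend to 0.\<close>
  have "\<exists>u. u \<in> z2_tails Y (max n N0) \<and> z2_norm u = 1" for n
  proof -
    obtain u where "u \<in> z2_tails Y (max n N0)" "u \<noteq> 0"
      using infdim_nonzero infdim_z2_tails[OF Y] by blast
    then show ?thesis using normalise z2.subspace_scale[OF sub] by blast
  qed
  then obtain f where f: "\<And>n. f n \<in> z2_tails Y (max n N0)" "\<And>n. z2_norm (f n) = 1" by metis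
  have fN: "f n \<in> z2_tails Y N0" for n using f(1)[of n] by (auto simp: z2_tails_def)
  have "f n \<in> z2_tails Y n" for n using f(1)[of n] by (auto simp: z2_tails_def)
  then have f0: "z2_null f" by (rule z2_null_tails[of f Y 1]) (simp add: f)
  define c where "c = min 1 (\<delta> / 4)"
  define g where "g = (\<lambda>j n. (if j then z2_d else z2_y) (f n))"
  have null: "l2_null (g j)" for j using f0 by (auto simp: g_def z2_null_def)
  obtain r N :: "nat \<Rightarrow> nat" where rN: "strict_mono r" "strict_mono N" "\<And>k. True"
    "\<And>k j. j \<in> UNIV \<Longrightarrow> norm (g j (r k) - l2_proj {N k..<N (Suc k)} (g j (r k))) \<le> c * (1/256) ^ k"
    by (rule gliding_hump[of UNIV g "\<lambda>k. c * (1/256) ^ k" "\<lambda>k n. True"])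
      (use \<delta> null in \<open>auto simp: c_def\<close>)
  define y where "y = (\<lambda>k. z2_y (f (r k)))"
  define y' where "y' = (\<lambda>k. l2_proj {N k..<N (Suc k)} (y k))"
  have y1: "norm (y k) \<le> 1" for k using norm_z2_y_le[of "f (r k)"] f(2) by (simp add: y_def)
  have yy: "norm (y k - y' k) \<le> 1 * (1/16) ^ k" for k
  proof -
    have "c * (1/256) ^ k \<le> 1 * (1/16) ^ k" using \<delta> by (intro mult_mono power_mono) (auto simp: c_def)
    then show ?thesis using rN(4)[of False k] by (simp add: g_def y'_def y_def)
  qed
  show False
  proof (rule log_growth_separation[OF rN(2), of c \<delta> "\<lambda>k. f (r k)" 1 "\<lambda>_. 0" "3 / \<delta>"])
    fix n :: nat assume n: "0 < n"
    have "z2_avg n (\<lambda>k. f (r k)) \<in> z2_tails Y N0"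
      unfolding z2_avg_def by (intro z2.subspace_scale z2.subspace_sum sub fN)
    from far[OF this] have "\<delta> * z2_norm (z2_avg n (\<lambda>k. f (r k))) \<le> norm (l2_avg n y)"
      by (simp add: z2_y_avg y_def)
    also have "l2_avg n y = l2_avg n y' + l2_avg n (\<lambda>k. y k - y' k)" by (simp add: l2_avg_diff)
    \<comment> \<open>The blocks contribute 1 by orthogonality and the truncation errors 2 by
      summation, for every \<open>n\<close>.\<close>
    also have "norm \<dots> \<le> 1 + 2 * 1"
    proof (rule order_trans[OF norm_triangle_ineq add_mono])
      show "norm (l2_avg n y') \<le> 1"
        unfolding y'_def
        by (rule l2_avg_blocks_le[OF blocks_proj[OF rN(2)] order_trans[OF norm_l2_proj_le y1] n])
      show "norm (l2_avg n (\<lambda>k. y k - y' k)) \<le> 2 * 1"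
        by (rule order_trans[OF norm_l2_avg_le norm_l2_sum_small[OF yy]])
    qed
    finally have "z2_norm (z2_avg n (\<lambda>k. f (r k))) \<le> 3 / \<delta>" using \<delta> by (simp add: field_simps)
    then show "z2_norm (z2_avg n (\<lambda>k. f (r k)) + z2_emb (ln (sqrt (real n)) *\<^sub>R l2_avg n (\<lambda>_. 0))) \<le> 3 / \<delta>"
      by (simp add: l2_avg_def)
  next
    show "\<delta> \<le> norm (0 - z2_y (f (r k)))" for k using far1[OF fN f(2)] by simp
  qed (use rN(4)[of True] rN(4)[of False] \<delta> f in \<open>auto simp: c_def g_def\<close>)
qed

section \<open>Perturbations of block embeddings\<close>

text \<open>A predicate of its own, since \<open>z2\<close> carries only a quasi-norm and
  \<open>bounded_linear\<close> asks for a normed target.\<close>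

definition z2_linear :: "('k::rc_field l2 \<Rightarrow> 'k z2) \<Rightarrow> real \<Rightarrow> bool" where
  "z2_linear V K \<longleftrightarrow> (\<forall>c d. V (c + d) = V c + V d) \<and> (\<forall>a c. V (l2_scale a c) = z2_scale a (V c))
     \<and> (\<forall>c. z2_norm (V c) \<le> K * norm c)"

lemma z2_linear_simps:
  assumes "z2_linear V K"
  shows "V (c + d) = V c + V d" "V (l2_scale a c) = z2_scale a (V c)" "z2_norm (V c) \<le> K * norm c"
    "V 0 = 0" "V (- c) = - V c" "V (c - d) = V c - V d" "V (sum f A) = (\<Sum>i\<in>A. V (f i))"
proof -
  show add: "V (c + d) = V c + V d" and scale: "V (l2_scale a c) = z2_scale a (V c)"
    and "z2_norm (V c) \<le> K * norm c" for c d a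
    using assms by (auto simp: z2_linear_def)
  show z: "V 0 = 0" using scale[of 0 0] by simp
  show m: "V (- c) = - V c" for c using scale[of "- 1" c] by simp
  show "V (c - d) = V c - V d" using add[of c "- d"] m[of d] by simp
  show "V (sum f A) = (\<Sum>i\<in>A. V (f i))"
    by (induction A rule: infinite_finite_induct) (auto simp: z add)
qed

lemma z2_linear_app:
  assumes "z2_linear V K" "\<And>u. z2_norm (z2_app A u) \<le> L * z2_norm u" "0 \<le> L"
  shows "z2_linear (\<lambda>c. z2_app A (V c)) (L * K)"
proof -
  have "z2_norm (z2_app A (V c)) \<le> L * K * norm c" for c
    using assms(2)[of "V c"] mult_left_mono[OF z2_linear_simps(3)[OF assms(1)] assms(3), of c]
    by (simp add: mult.assoc)
  then show ?thesis using assms(1) by (simp add: z2_linear_def)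
qed

text \<open>Summing the errors over truncated coefficients gives the factor 16, and one more
  quasi-triangle inequality for the passage to the limit gives 8; hence 128.\<close>

lemma block_perturbation:
  assumes V: "z2_linear V K" and w: "blocks N w" and hi: "\<And>k. norm (w k) \<le> hi"
    and near: "\<And>k. z2_norm (V (l2_e k) - z2_emb (w k)) \<le> \<eta> * (1/16) ^ k"
  shows "z2_norm (V c - z2_emb (block_map w c)) \<le> 128 * \<eta> * norm c"
proof -
  define E where "E = (\<lambda>c. V c - z2_emb (block_map w c))"
  have K: "0 \<le> K" using z2_linear_simps(3)[OF V, of "l2_e 0"] z2_norm_nonneg[of "V (l2_e 0)"] by simp
  have "z2_norm (E c) \<le> 8 * (K + hi) * norm c" for c
    using z2_norm_diff[of "V c" "z2_emb (block_map w c)"] z2_linear_simps(3)[OF V, of c]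
      block_map_norm_le[OF w hi, of c] by (simp add: E_def algebra_simps)
  then have E: "z2_linear E (8 * (K + hi))"
    using V by (simp add: z2_linear_def E_def block_map_add[OF w hi] block_map_scale[OF w hi] z2.scale_right_diff_distrib)
  have fin: "z2_norm (E (l2_proj {..<M} c)) \<le> 16 * (\<eta> * norm c)" for M
  proof -
    have "E (l2_proj {..<M} c) = (\<Sum>k<M. z2_scale (l2_nth c k) (E (l2_e k)))"
      unfolding l2_proj_lessThan by (simp add: z2_linear_simps[OF E])
    moreover have "z2_norm (z2_scale (l2_nth c k) (E (l2_e k))) \<le> \<eta> * norm c * (1/16) ^ k" for k
    proof -
      have "norm (l2_nth c k) * z2_norm (E (l2_e k)) \<le> norm c * (\<eta> * (1/16) ^ k)"
        using near[of k] norm_l2_nth_le[of c k]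
        by (intro mult_mono) (auto simp: E_def block_map_e[OF w hi] z2_norm_nonneg)
      then show ?thesis by (simp add: z2_norm_scale mult_ac)
    qed
    ultimately show ?thesis by (simp only: z2_norm_sum_small)
  qed
  have "(\<lambda>M. norm (c - l2_proj {..<M} c)) \<longlonglongrightarrow> 0"
    using tendsto_norm_zero[OF LIM_zero[OF l2_proj_tendsto[of c]]] by (simp add: norm_minus_commute)
  then have "(\<lambda>M. 8 * (16 * (\<eta> * norm c) + 8 * (K + hi) * norm (c - l2_proj {..<M} c)))
      \<longlonglongrightarrow> 8 * (16 * (\<eta> * norm c) + 8 * (K + hi) * 0)"
    by (intro tendsto_mult tendsto_add tendsto_const)
  moreover have "z2_norm (E c) \<le> 8 * (16 * (\<eta> * norm c) + 8 * (K + hi) * norm (c - l2_proj {..<M} c))" for M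
  proof -
    have "E c = E (l2_proj {..<M} c) + E (c - l2_proj {..<M} c)" by (simp add: z2_linear_simps(6)[OF E])
    then show ?thesis
      using z2_norm_add[of "E (l2_proj {..<M} c)" "E (c - l2_proj {..<M} c)"] fin[of M]
        z2_linear_simps(3)[OF E, of "c - l2_proj {..<M} c"] by simp
  qed
  ultimately have "z2_norm (E c) \<le> 8 * (16 * (\<eta> * norm c) + 8 * (K + hi) * 0)"
    by (intro tendsto_lowerbound[of _ _ sequentially]) auto
  then show ?thesis by (simp add: E_def)
qed

text \<open>Only the error carries a constant: the main term enters with factor 1 because it is
  embedded.\<close>

lemma block_perturbation_le:
  assumes "z2_linear V K" "blocks N w" "\<And>k. norm (w k) \<le> hi"
    "\<And>k. z2_norm (V (l2_e k) - z2_emb (w k)) \<le> \<eta> * (1/16) ^ k"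
  shows "z2_norm (V c) \<le> (hi + 128 * \<eta>) * norm c"
  using z2_norm_close_emb(1)[of "V c" "block_map w c"] block_perturbation[OF assms, of c]
    block_map_norm_le[OF assms(2,3), of c] by (simp add: algebra_simps)

lemma block_perturbation_ge:
  assumes "z2_linear V K" "blocks N w" "\<And>k. norm (w k) \<le> hi"
    "\<And>k. z2_norm (V (l2_e k) - z2_emb (w k)) \<le> \<eta> * (1/16) ^ k"
    "\<And>k. lo \<le> norm (w k)" "0 \<le> lo"
  shows "(lo - 128 * \<eta>) * norm c \<le> z2_norm (V c)"
  using z2_norm_close_emb(2)[of "block_map w c" "V c"] block_perturbation[OF assms(1-4), of c]
    block_map_norm_ge[OF assms(2,3,5,6), of c] by (simp add: algebra_simps)

text \<open>The series for \<open>V\<close> splits into the orthogonal series of the blocks, summed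
  by \<open>block_map\<close>, and an error series whose geometric decay makes it Cauchy in the
  complete quasi-norm.\<close>

lemma block_synthesis:
  assumes w: "blocks N w" and hi: "\<And>k. norm (w k) \<le> hi"
    and near: "\<And>k. z2_norm (u k - z2_emb (w k)) \<le> \<eta> * (1/16) ^ k"
  obtains V K where "z2_linear V K" "\<And>k. V (l2_e k) = u k"
    "\<And>c. z2_tendsto (\<lambda>n. \<Sum>k<n. z2_scale (l2_nth c k) (u k)) (V c)"
proof -
  define e where "e = (\<lambda>k. u k - z2_emb (w k))"
  have \<eta>: "0 \<le> \<eta>" using order_trans[OF z2_norm_nonneg near[of 0]] by simp
  define S where "S = (\<lambda>c n. \<Sum>k<n. z2_scale (l2_nth c k) (e k))"
  have tail: "z2_norm (S c (n + m) - S c n) \<le> 16 * (\<eta> * norm c * (1/16) ^ n)" for c n m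
  proof -
    have "S c (n + m) - S c n = (\<Sum>k<m. z2_scale (l2_nth c (n + k)) (e (n + k)))"
      unfolding S_def by (induction m) simp_all
    moreover have "z2_norm (z2_scale (l2_nth c (n + k)) (e (n + k))) \<le> (\<eta> * norm c * (1/16) ^ n) * (1/16) ^ k" for k
    proof -
      have "norm (l2_nth c (n + k)) * z2_norm (e (n + k)) \<le> norm c * (\<eta> * (1/16) ^ (n + k))"
        using near[of "n + k"] norm_l2_nth_le[of c "n + k"] by (intro mult_mono) (auto simp: e_def z2_norm_nonneg)
      then show ?thesis by (simp add: z2_norm_scale mult_ac power_add)
    qed
    ultimately show ?thesis by (simp only: z2_norm_sum_small)
  qed
  have "\<exists>l. z2_tendsto (S c) l" for c
  proof (rule z2_complete)
    fix r :: real assume r: "0 < r"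
    have "(\<lambda>n. 16 * (\<eta> * norm c * (1/16) ^ n)) \<longlonglongrightarrow> 16 * (\<eta> * norm c * 0)"
      by (intro tendsto_intros LIMSEQ_realpow_zero) auto
    then have "\<forall>\<^sub>F n in sequentially. 16 * (\<eta> * norm c * (1/16) ^ n) < r" by (rule order_tendstoD(2)) (use r in simp)
    then obtain n0 where n0: "\<And>n. n \<ge> n0 \<Longrightarrow> 16 * (\<eta> * norm c * (1/16) ^ n) < r"
      unfolding eventually_sequentially by blast
    have le: "z2_norm (S c m - S c n) < r" if "n \<ge> n0" "m \<ge> n" for m n
      using tail[of c n "m - n"] n0[of n] that by simp
    then have "z2_norm (S c m - S c n) < r" if "m \<ge> n0" "n \<ge> n0" for m n
      using that z2_norm_minus_commute[of "S c m" "S c n"] by (metis nle_le)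
    then show "\<exists>N. \<forall>m\<ge>N. \<forall>n\<ge>N. z2_norm (S c m - S c n) < r" by blast
  qed
  then obtain F where F: "\<And>c. z2_tendsto (S c) (F c)" by metis
  define V where "V = (\<lambda>c. z2_emb (block_map w c) + F c)"
  have lim: "z2_tendsto (\<lambda>n. \<Sum>k<n. z2_scale (l2_nth c k) (u k)) (V c)" for c
  proof -
    have "(\<Sum>k<n. z2_scale (l2_nth c k) (u k)) = z2_emb (block_map w (l2_proj {..<n} c)) + S c n" for n
      by (simp add: block_map_proj[OF w hi] S_def e_def z2_emb_sum sum.distrib[symmetric] flip: z2.scale_right_distrib)
    then show ?thesis
      unfolding V_def
      by (simp add: z2_tendsto_add[OF z2_tendsto_emb F] bounded_linear.tendsto[OF bounded_linear_block_map[OF w hi] l2_proj_tendsto])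
  qed
  have "z2_linear V (hi + 128 * \<eta>)"
    unfolding z2_linear_def
  proof (intro conjI allI)
    fix c d a
    show "V (c + d) = V c + V d"
      by (rule z2_tendsto_unique[OF lim])
        (use z2_tendsto_add[OF lim[of c] lim[of d]] in \<open>simp add: z2.scale_left_distrib sum.distrib\<close>)
    show "V (l2_scale a c) = z2_scale a (V c)"
      by (rule z2_tendsto_unique[OF lim])
        (use z2_tendsto_scale[OF lim[of c], of a] in \<open>simp add: z2.scale_sum_right\<close>)
    have "(\<lambda>n. 8 * (z2_norm (S c n - F c) + 16 * (\<eta> * norm c))) \<longlonglongrightarrow> 8 * (0 + 16 * (\<eta> * norm c))"
      using F[of c] unfolding z2_tendsto_def by (intro tendsto_intros)
    moreover have "z2_norm (F c) \<le> 8 * (z2_norm (S c n - F c) + 16 * (\<eta> * norm c))" for n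
    proof -
      have "z2_norm (S c n) \<le> 16 * (\<eta> * norm c)" using tail[of c 0 n] by (simp add: S_def)
      then show ?thesis
        using z2_norm_diff[of "S c n" "S c n - F c"] by simp
    qed
    ultimately have "z2_norm (F c) \<le> 8 * (0 + 16 * (\<eta> * norm c))"
      by (intro tendsto_lowerbound[of _ _ sequentially]) auto
    then show "z2_norm (V c) \<le> (hi + 128 * \<eta>) * norm c"
      using z2_norm_emb_add_le[of "block_map w c" "F c"] block_map_norm_le[OF w hi, of c]
      by (simp add: V_def algebra_simps)
  qed
  moreover have "V (l2_e k) = u k" for k
  proof (rule z2_tendsto_unique[OF lim])
    have "(\<Sum>j<n. z2_scale (l2_nth (l2_e k) j) (u j)) = u k" if "k < n" for n
    proof -
      have "(\<Sum>j<n. z2_scale (l2_nth (l2_e k) j) (u j)) = (\<Sum>j\<in>{k}. z2_scale (l2_nth (l2_e k) j) (u j))"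
        using that by (intro sum.mono_neutral_right) auto
      then show ?thesis by simp
    qed
    then show "z2_tendsto (\<lambda>n. \<Sum>j<n. z2_scale (l2_nth (l2_e k) j) (u j)) (u k)"
      unfolding z2_tendsto_def
      by (intro tendsto_eventually) (auto simp: eventually_sequentially z2_norm_zero intro!: exI[of _ "Suc k"])
  qed
  ultimately show ?thesis using that lim by blast
qed

text \<open>The lower bound carries Cauchy sequences back to the complete space of coefficients,
  whence closedness, and makes \<open>V\<close> injective, so that the images of the unit vectors
  are independent.\<close>

lemma infdim_range:
  assumes V: "z2_linear V K" and lo: "0 < lo" "\<And>c. lo * norm c \<le> z2_norm (V c)"
  shows "infdim_closed_subspace (range V)"
  unfolding infdim_closed_subspace_def
proof (intro conjI allI impI)
  note lin = z2_linear_simps[OF V]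
  have inj: "c = 0" if "V c = 0" for c using lo(2)[of c] lo(1) that by (simp add: z2_norm_zero mult_le_0_iff)
  show "z2.subspace (range V)"
    unfolding z2.subspace_def
  proof (intro conjI ballI allI)
    show "0 \<in> range V" using lin(4) by (metis rangeI)
    fix u v a assume "u \<in> range V" "v \<in> range V"
    then obtain c d where "u = V c" "v = V d" by blast
    then have eq: "u + v = V (c + d)" "z2_scale a u = V (l2_scale a c)" by (simp_all only: lin(1,2))
    show "u + v \<in> range V" unfolding eq by (rule rangeI)
    show "z2_scale a u \<in> range V" unfolding eq by (rule rangeI)
  qed
  show "u \<in> range V" if us: "(\<forall>n. us n \<in> range V) \<and> z2_tendsto us u" for us u
  proof -
    have "\<forall>n. \<exists>c. us n = V c" using us by blast
    then obtain c where c: "\<And>n. us n = V (c n)" by metis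
    have u0: "(\<lambda>n. z2_norm (us n - u)) \<longlonglongrightarrow> 0" using us by (simp add: z2_tendsto_def)
    have "Cauchy c"
      unfolding Cauchy_iff
    proof (intro allI impI)
      fix e :: real assume e: "0 < e"
      have "\<forall>\<^sub>F n in sequentially. z2_norm (us n - u) < lo * e / 16"
        by (rule order_tendstoD(2)[OF u0]) (use e lo in simp)
      \<comment> \<open>The \<open>16\<close> offsets the factor 8 applied to two terms.\<close>
      then obtain M where M: "\<And>n. n \<ge> M \<Longrightarrow> z2_norm (us n - u) < lo * e / 16"
        unfolding eventually_sequentially by blast
      have "norm (c m - c n) < e" if "m \<ge> M" "n \<ge> M" for m n
      proof -
        have "lo * norm (c m - c n) \<le> z2_norm (us m - us n)" using lo(2)[of "c m - c n"] by (simp add: c lin)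
        also have "\<dots> \<le> 8 * (z2_norm (us m - u) + z2_norm (us n - u))"
          using z2_norm_diff[of "us m - u" "us n - u"] by simp
        also have "\<dots> < lo * e" using M[OF that(1)] M[OF that(2)] by argo
        finally show ?thesis using lo by simp
      qed
      then show "\<exists>M. \<forall>m\<ge>M. \<forall>n\<ge>M. norm (c m - c n) < e" by blast
    qed
    then obtain c0 where c0: "c \<longlonglongrightarrow> c0" using Cauchy_convergent convergent_def by blast
    have "z2_tendsto us (V c0)"
    proof (rule z2_tendsto_le)
      show "z2_norm (us n - V c0) \<le> K * norm (c n - c0)" for n using lin(3)[of "c n - c0"] by (simp add: c lin)
      show "(\<lambda>n. K * norm (c n - c0)) \<longlonglongrightarrow> 0"
        by (intro tendsto_mult_right_zero tendsto_norm_zero LIM_zero c0)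
    qed
    then have "u = V c0" using us z2_tendsto_unique by blast
    then show ?thesis by simp
  qed
  show "\<nexists>B. finite B \<and> range V \<subseteq> z2.span B"
  proof
    assume "\<exists>B. finite B \<and> range V \<subseteq> z2.span B"
    then obtain B where B: "finite B" "range V \<subseteq> z2.span B" by blast
    define f where "f = (\<lambda>k. V (l2_e k))"
    have inj_f: "inj f"
    proof (rule injI)
      fix j k assume "f j = f k"
      then have "l2_e j - l2_e k = (0 :: 'a l2)" by (intro inj) (simp add: f_def lin)
      then have "l2_nth (l2_e j - l2_e k :: 'a l2) j = 0" by simp
      then show "j = k" by (auto split: if_splits)
    qed
    have "z2.independent (range f)"
      unfolding z2.independent_explicit_module
    proof (intro allI impI)
      fix t a v assume t: "finite t" "t \<subseteq> range f" "(\<Sum>v\<in>t. z2_scale (a v) v) = 0" "v \<in> t"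
      obtain A where A: "finite A" "t = f ` A" using t(1,2) finite_subset_image by metis
      have "V (\<Sum>k\<in>A. l2_scale (a (f k)) (l2_e k)) = (\<Sum>k\<in>A. z2_scale (a (f k)) (f k))"
        by (simp add: lin f_def)
      also have "\<dots> = (\<Sum>v\<in>t. z2_scale (a v) v)"
        unfolding A(2) by (rule sum.reindex_cong[symmetric, OF inj_on_subset[OF inj_f]]) auto
      finally have 0: "(\<Sum>k\<in>A. l2_scale (a (f k)) (l2_e k)) = 0" using inj t(3) by simp
      obtain j where j: "j \<in> A" "v = f j" using t(4) A by blast
      have "l2_nth (\<Sum>k\<in>A. l2_scale (a (f k)) (l2_e k)) j = (\<Sum>k\<in>{j}. a (f k))"
        unfolding l2_nth_sum using j A(1) by (intro sum.mono_neutral_cong_right) auto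
      then show "a v = 0" using 0 j by simp
    qed
    then have "finite (range f)" using z2.independent_span_bound[OF B(1), of "range f"] B(2) by (auto simp: f_def)
    then show False using inj_f finite_imageD infinite_UNIV_nat by blast
  qed
qed

section \<open>Operators along normalised blocks\<close>

text \<open>Both norm coordinates are pushed through the isometry \<open>block_map w\<close>, so the
  map preserves the quasi-norm. It is linear because the logarithm of a product splits: on the k-th
  interval \<open>z2_x\<close> of the image depends linearly on the k-th coordinates of
  \<open>z2_x u\<close> and \<open>z2_y u\<close>.\<close>

lemma block_operator:
  fixes w :: "nat \<Rightarrow> 'k::rc_field l2"
  assumes w: "blocks N w" and one: "\<And>k. norm (w k) = 1"
  obtains T :: "'k z2_op" where "\<And>k. z2_app T (z2_e k) = z2_emb (w k)"
proof -
  have le: "\<And>k. norm (w k) \<le> 1" using one by simp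
  note W = w le
  define T where "T = (\<lambda>u. z2_emb (block_map w (z2_d u)) + z2_sec (block_map w (z2_y u)))"
  have nW: "norm (block_map w c) = norm c" for c
    using block_map_norm_le[OF W, of c] block_map_norm_ge[OF W, of 1 c] one by simp
  have x: "z2_x (T u) i = (if i \<in> {N k..<N (Suc k)}
      then l2_nth (w k) i * z2_x u k + l2_nth (z2_y u) k * l2_nth (w k) i * of_real (ln (1 / norm (l2_nth (w k) i))) else 0)"
    if k: "i \<in> {N k..<N (Suc k)} \<or> (\<forall>k. i \<notin> {N k..<N (Suc k)})" for u i k
  proof (cases "i \<in> {N k..<N (Suc k)}")
    case True
    note nth = block_map_nth_block[OF W True]
    show ?thesis
    proof (cases "l2_nth (w k) i = 0 \<or> l2_nth (z2_y u) k = 0")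
      case True
      then show ?thesis using \<open>i \<in> _\<close> by (auto simp: T_def nth l2_Omega_eq z2_x_eq)
    next
      case False
      then have y: "0 < norm (z2_y u)" using norm_l2_pos by blast
      \<comment> \<open>Since \<open>block_map w\<close> preserves the norm, only the factor
        \<open>l2_nth (w k) i\<close> is new inside the logarithm.\<close>
      have "ln (norm (z2_y u) / norm (l2_nth (z2_y u) k * l2_nth (w k) i))
          = ln (norm (z2_y u) / norm (l2_nth (z2_y u) k)) + ln (1 / norm (l2_nth (w k) i))"
        using False y by (simp add: norm_mult ln_div ln_mult)
      then have "l2_Omega (block_map w (z2_y u)) i
          = l2_nth (z2_y u) k * l2_nth (w k) i * (of_real (ln (norm (z2_y u) / norm (l2_nth (z2_y u) k))) + of_real (ln (1 / norm (l2_nth (w k) i))))"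
        unfolding l2_Omega_eq nth nW by (simp only: of_real_add)
      then show ?thesis using \<open>i \<in> _\<close>
        by (simp add: T_def nth z2_x_eq l2_Omega_eq[of "z2_y u"] algebra_simps)
    qed
  next
    case False
    then have "\<And>k. i \<notin> {N k..<N (Suc k)}" using k by blast
    from block_map_nth_0[OF W this] False show ?thesis
      by (simp add: T_def l2_Omega_eq del: atLeastLessThan_iff)
  qed
  have add: "T (u + v) = T u + T v" for u v
  proof (rule z2_eqI)
    fix i
    obtain k where "i \<in> {N k..<N (Suc k)} \<or> (\<forall>k. i \<notin> {N k..<N (Suc k)})" by blast
    from x[OF this] show "z2_x (T (u + v)) i = z2_x (T u + T v) i" by (simp add: algebra_simps)
  qed (simp add: T_def block_map_add[OF W])
  have scale: "T (z2_scale c u) = z2_scale c (T u)" for c u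
  proof (rule z2_eqI)
    fix i
    obtain k where "i \<in> {N k..<N (Suc k)} \<or> (\<forall>k. i \<notin> {N k..<N (Suc k)})" by blast
    from x[OF this] show "z2_x (T (z2_scale c u)) i = z2_x (z2_scale c (T u)) i" by (simp add: algebra_simps)
  qed (simp add: T_def block_map_scale[OF W])
  have bd: "z2_norm (T u) \<le> 1 * z2_norm u" for u by (simp add: T_def z2_norm_eq nW)
  have "block_map w 0 = 0" using nW[of 0] by simp
  then have "z2_app (Abs_z2_op T) (z2_e k) = z2_emb (w k)" for k
    unfolding Abs_z2_op_inverse'[OF add scale bd] by (simp add: T_def z2_e_eq block_map_e[OF W])
  then show ?thesis by (rule that)
qed

section \<open>Comparison with the strictly singular seminorm\<close>

lemma z2_norm_diff_emb_le: "z2_norm (u - z2_emb w) \<le> norm (z2_d u - w) + norm (z2_y u)"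
proof -
  have "u - z2_emb w = z2_emb (z2_d u - w) + (u - z2_emb (z2_d u))" by simp
  then show ?thesis
    using z2_norm_emb_add_le[of "z2_d u - w" "u - z2_emb (z2_d u)"] by (simp only: z2_norm_diff_emb_d)
qed

lemma eventually_z2_y_app_e_small:
  "0 < e \<Longrightarrow> \<forall>\<^sub>F n in sequentially. norm (z2_y (z2_app T (z2_e n))) \<le> e"
  using order_tendstoD(2)[OF tendsto_norm_zero[OF z2_y_app_e_tendsto[of T]], of e]
  by (auto elim: eventually_mono)

text \<open>Along \<open>U\<close> the vectors \<open>T (e n, 0)\<close> have norm near
  \<open>t\<close> and their images under \<open>A\<close> norm near \<open>a\<close>. Made almost
  blocks on common intervals, they span a copy of \<open>ell2\<close> where the norm is nearly
  \<open>t\<close> times, and the norm of the image nearly \<open>a\<close> times, that of the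
  coefficients.\<close>

lemma ultrafilter_limit_large_on_subspace:
  fixes A T :: "'k::rc_field z2_op"
  assumes U: "nontrivial_ultrafilter U"
    and t: "((\<lambda>n. z2_norm (z2_app T (z2_e n))) \<longlongrightarrow> t) U"
    and a: "((\<lambda>n. z2_norm (z2_app (A * T) (z2_e n))) \<longlongrightarrow> a) U"
    and \<epsilon>: "0 \<le> \<epsilon>" "\<epsilon> * t < a" "0 < a"
  obtains Y \<epsilon>' where "infdim_closed_subspace Y" "\<epsilon> < \<epsilon>'" "\<And>u. u \<in> Y \<Longrightarrow> \<epsilon>' * z2_norm u \<le> z2_norm (z2_app A u)"
proof -
  have Ub: "U \<noteq> bot" using U by (simp add: nontrivial_ultrafilter_def)
  obtain L where L: "0 \<le> L" "\<And>u. z2_norm (z2_app A u) \<le> L * z2_norm u" using z2_op_bounded by blast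
  \<comment> \<open>Together with \<open>0 < a\<close> this excludes \<open>t = 0\<close>.\<close>
  have "a \<le> L * t"
    by (rule tendsto_le[OF Ub tendsto_mult[OF tendsto_const t] a]) (simp add: L)
  moreover have "0 \<le> t" by (rule tendsto_lowerbound[OF t _ Ub]) (simp add: z2_norm_nonneg)
  ultimately have t0: "0 < t" using \<epsilon>(3) by (cases "t = 0") auto
  \<comment> \<open>So small that a loss of \<open>3 * \<kappa>\<close> keeps both lower bounds
    positive and the quotient \<open>(a - 3 * \<kappa>) / (t + 3 * \<kappa>)\<close> above
    \<open>\<epsilon>\<close>.\<close>
  define \<kappa> where "\<kappa> = min (min (t / 6) (a / 6)) ((a - \<epsilon> * t) / (6 * (1 + \<epsilon>)))"
  have \<kappa>: "0 < \<kappa>" using t0 \<epsilon> by (simp add: \<kappa>_def)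
  have \<kappa>_le: "\<kappa> \<le> t / 6" "\<kappa> \<le> a / 6"
    unfolding \<kappa>_def by (rule min.coboundedI1, simp del: le_divide_eq_numeral1 min_less_iff_conj)+
  have "\<kappa> \<le> (a - \<epsilon> * t) / (6 * (1 + \<epsilon>))" by (simp add: \<kappa>_def)
  then have "\<kappa> * (6 * (1 + \<epsilon>)) \<le> a - \<epsilon> * t" using \<epsilon> by (simp add: pos_le_divide_eq)
  then have \<kappa>\<epsilon>: "\<epsilon> * (t + 3 * \<kappa>) < a - 3 * \<kappa>" using \<kappa> \<epsilon> by (simp add: algebra_simps)
  \<comment> \<open>Two errors of \<open>\<theta>\<close> per vector give
    \<open>\<kappa> / 128\<close>, which \<open>block_perturbation\<close> returns as one
    \<open>\<kappa>\<close>; the other two come from the norms of the blocks.\<close>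
  define \<theta> where "\<theta> = \<kappa> / 256"
  have \<theta>: "0 < \<theta>" using \<kappa> by (simp add: \<theta>_def)
  define R where "R = (\<lambda>k n. \<bar>z2_norm (z2_app T (z2_e n :: 'k z2)) - t\<bar> < \<kappa> \<and> \<bar>z2_norm (z2_app (A * T) (z2_e n :: 'k z2)) - a\<bar> < \<kappa>
      \<and> norm (z2_y (z2_app T (z2_e n :: 'k z2))) \<le> \<theta> * (1/16) ^ k \<and> norm (z2_y (z2_app (A * T) (z2_e n :: 'k z2))) \<le> \<theta> * (1/16) ^ k)"
  have R: "\<exists>n\<ge>m. R k n" for k m
  proof (rule ultrafilter_frequently[OF U])
    show "eventually (R k) U"
      unfolding R_def using tendstoD[OF t \<kappa>] tendstoD[OF a \<kappa>] \<theta>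
      by (intro eventually_conj filter_leD[OF ultrafilter_le_sequentially[OF U] eventually_z2_y_app_e_small])
        (auto simp: dist_real_def)
  qed
  define f where "f = (\<lambda>j n. z2_d (z2_app (if j then A * T else T) (z2_e n :: 'k z2)))"
  have null: "l2_null (f j)" for j using z2_null_app_e[of "if j then A * T else T"] by (simp add: f_def z2_null_def)
  obtain r N :: "nat \<Rightarrow> nat" where rN: "strict_mono r" "strict_mono N" "\<And>k. R k (r k)"
    "\<And>k j. j \<in> UNIV \<Longrightarrow> norm (f j (r k) - l2_proj {N k..<N (Suc k)} (f j (r k))) \<le> \<theta> * (1/16) ^ k"
    by (rule gliding_hump[of UNIV f "\<lambda>k. \<theta> * (1/16) ^ k" R]) (use R null \<theta> in auto)
  define w where "w = (\<lambda>j k. l2_proj {N k..<N (Suc k)} (f j (r k)))"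
  have bl: "blocks N (w j)" for j unfolding w_def by (rule blocks_proj[OF rN(2)])
  define S where "S = (\<lambda>j. if j then A * T else T)"
  define s where "s = (\<lambda>j. if j then a else t)"
  have near: "z2_norm (z2_app (S j) (z2_e (r k)) - z2_emb (w j k)) \<le> (\<kappa> / 128) * (1/16) ^ k" for j k
  proof -
    have "norm (z2_y (z2_app (S j) (z2_e (r k)))) \<le> \<theta> * (1/16) ^ k"
      using rN(3)[of k] by (cases j) (simp_all only: S_def R_def if_True if_False)
    moreover have "norm (z2_d (z2_app (S j) (z2_e (r k))) - w j k) \<le> \<theta> * (1/16) ^ k"
      using rN(4)[of j k] unfolding f_def w_def S_def by simp
    ultimately have "z2_norm (z2_app (S j) (z2_e (r k)) - z2_emb (w j k)) \<le> \<theta> * (1/16) ^ k + \<theta> * (1/16) ^ k"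
      using z2_norm_diff_emb_le order_trans add_mono by meson
    then show ?thesis by (simp add: \<theta>_def)
  qed
  have wn: "s j - 2 * \<kappa> \<le> norm (w j k) \<and> norm (w j k) \<le> s j + 2 * \<kappa>" for j k
  proof -
    have "(\<kappa> / 128) * (1/16) ^ k \<le> \<kappa> / 128" using \<kappa> by (simp add: mult_left_le power_le_one)
    then have "z2_norm (z2_app (S j) (z2_e (r k)) - z2_emb (w j k)) \<le> \<kappa>" using near[of j k] \<kappa> by linarith
    moreover have "\<bar>z2_norm (z2_app (S j) (z2_e (r k))) - s j\<bar> < \<kappa>"
      using rN(3)[of k] by (cases j) (simp_all only: S_def s_def R_def if_True if_False)
    ultimately show ?thesis
      using z2_norm_close_emb(1)[of "z2_app (S j) (z2_e (r k))" "w j k"] z2_norm_close_emb(2)[of "w j k" "z2_app (S j) (z2_e (r k))"]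
      by linarith
  qed
  obtain V K where V: "z2_linear V K" "\<And>k. V (l2_e k) = z2_app T (z2_e (r k))"
    using block_synthesis[OF bl[of False] wn[of False, THEN conjunct2] near[of False, unfolded S_def if_False]] by metis
  have nearV: "z2_norm (V (l2_e k) - z2_emb (w False k)) \<le> (\<kappa> / 128) * (1/16) ^ k" for k
    using near[of False k] by (simp add: V(2) S_def)
  have nearAV: "z2_norm (z2_app A (V (l2_e k)) - z2_emb (w True k)) \<le> (\<kappa> / 128) * (1/16) ^ k" for k
    using near[of True k] by (simp add: V(2) S_def)
  have up: "z2_norm (V c) \<le> (t + 3 * \<kappa>) * norm c" for c
    using block_perturbation_le[OF V(1) bl wn[THEN conjunct2] nearV, of c] by (simp add: s_def algebra_simps)
  have low: "(t - 3 * \<kappa>) * norm c \<le> z2_norm (V c)" for c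
    using block_perturbation_ge[OF V(1) bl wn[THEN conjunct2] nearV wn[THEN conjunct1], of c] \<kappa> \<kappa>_le by (simp add: s_def algebra_simps)
  have lowA: "(a - 3 * \<kappa>) * norm c \<le> z2_norm (z2_app A (V c))" for c
    using block_perturbation_ge[OF z2_linear_app[OF V(1) L(2,1)] bl wn[THEN conjunct2] nearAV wn[THEN conjunct1], of c] \<kappa> \<kappa>_le
    by (simp add: s_def algebra_simps)
  define \<epsilon>' where "\<epsilon>' = (a - 3 * \<kappa>) / (t + 3 * \<kappa>)"
  have tp: "0 < t + 3 * \<kappa>" using t0 \<kappa> by simp
  have e0: "0 \<le> \<epsilon>'" using tp \<kappa> \<kappa>_le \<epsilon>(3) by (simp add: \<epsilon>'_def)
  show ?thesis
  proof (rule that)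
    show "infdim_closed_subspace (range V)"
      by (rule infdim_range[OF V(1) _ low]) (use \<kappa> \<kappa>_le t0 in simp)
    show "\<epsilon> < \<epsilon>'" using \<kappa>\<epsilon> tp by (simp add: \<epsilon>'_def pos_less_divide_eq)
    fix u assume "u \<in> range V"
    then obtain c where c: "u = V c" by blast
    have "\<epsilon>' * z2_norm u \<le> \<epsilon>' * ((t + 3 * \<kappa>) * norm c)" unfolding c by (rule mult_left_mono[OF up e0])
    also have "\<dots> = (a - 3 * \<kappa>) * norm c" using tp by (simp add: \<epsilon>'_def)
    also have "\<dots> \<le> z2_norm (z2_app A u)" unfolding c by (rule lowA)
    finally show "\<epsilon>' * z2_norm u \<le> z2_norm (z2_app A u)" .
  qed
qed

lemma norm_diff_normalise:
  fixes w :: "'a::real_normed_vector"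
  assumes "w \<noteq> 0" shows "norm (w - (1 / norm w) *\<^sub>R w) = \<bar>norm w - 1\<bar>"
proof -
  have "w - (1 / norm w) *\<^sub>R w = (1 - 1 / norm w) *\<^sub>R w" by (simp add: scaleR_diff_left)
  then have "norm (w - (1 / norm w) *\<^sub>R w) = \<bar>1 - 1 / norm w\<bar> * \<bar>norm w\<bar>" by simp
  also have "\<dots> = \<bar>norm w - 1\<bar>" unfolding abs_mult[symmetric] using assms by (simp add: left_diff_distrib)
  finally show ?thesis .
qed

text \<open>Unit vectors of \<open>Y\<close> far out in the tails can be chosen with small second
  component by \<open>quotient_strictly_singular\<close>; they are weakly null, so a subsequence is
  close to embedded blocks.\<close>

lemma infdim_almost_embedded_blocks:
  fixes Y :: "'k::rc_field z2 set"
  assumes Y: "infdim_closed_subspace Y" and \<theta>: "0 < \<theta>" "\<theta> \<le> 1/4"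
  obtains u w N where "\<And>k. u k \<in> Y" "blocks N w" "\<And>k. norm (w k) = 1"
    "\<And>k. z2_norm (u k - z2_emb (w k)) \<le> 4 * \<theta> * (1/16) ^ k"
proof -
  have Y': "z2.subspace Y" "\<nexists>B. finite B \<and> Y \<subseteq> z2.span B" using Y by (auto simp: infdim_closed_subspace_def)
  have "\<exists>u. u \<in> z2_tails Y n \<and> z2_norm u = 1 \<and> norm (z2_y u) < inverse (real (Suc n))" for n
  proof -
    have "0 < inverse (real (Suc n))" by simp
    from quotient_strictly_singular[OF Y' this, of n] show ?thesis by blast
  qed
  then obtain f where f: "\<And>n. f n \<in> z2_tails Y n" "\<And>n. z2_norm (f n) = 1"
    "\<And>n. norm (z2_y (f n)) < inverse (real (Suc n))" by metis
  have f0: "z2_null f" by (rule z2_null_tails[of f Y 1]) (simp_all add: f)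
  have Q: "\<exists>n\<ge>m. norm (z2_y (f n)) \<le> \<theta> * (1/16) ^ k" for m k
  proof -
    obtain n0 where n0: "inverse (real (Suc n0)) < \<theta> * (1/16) ^ k" using reals_Archimedean[of "\<theta> * (1/16) ^ k"] \<theta> by auto
    have "inverse (real (Suc (max m n0))) \<le> inverse (real (Suc n0))" by (rule le_imp_inverse_le) auto
    then have "norm (z2_y (f (max m n0))) \<le> \<theta> * (1/16) ^ k" using f(3)[of "max m n0"] n0 by linarith
    then show ?thesis by (intro exI[of _ "max m n0"]) simp
  qed
  obtain r N :: "nat \<Rightarrow> nat" where rN: "strict_mono r" "strict_mono N" "\<And>k. norm (z2_y (f (r k))) \<le> \<theta> * (1/16) ^ k"
    "\<And>k j. j \<in> {()} \<Longrightarrow> norm (z2_d (f (r k)) - l2_proj {N k..<N (Suc k)} (z2_d (f (r k)))) \<le> \<theta> * (1/16) ^ k"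
    by (rule gliding_hump[of "{()}" "\<lambda>_ n. z2_d (f n)" "\<lambda>k. \<theta> * (1/16) ^ k" "\<lambda>k n. norm (z2_y (f n)) \<le> \<theta> * (1/16) ^ k"])
      (use Q f0 \<theta> in \<open>auto simp: z2_null_def\<close>)
  define v where "v = (\<lambda>k. l2_proj {N k..<N (Suc k)} (z2_d (f (r k))))"
  \<comment> \<open>Normalising the blocks costs \<open>2 * \<theta>\<close> on top of the
    \<open>2 * \<theta>\<close> of the approximation.\<close>
  define w where "w = (\<lambda>k. l2_scale (of_real (1 / norm (v k))) (v k))"
  have near: "z2_norm (f (r k) - z2_emb (v k)) \<le> 2 * (\<theta> * (1/16) ^ k)" for k
    using z2_norm_diff_emb_le[of "f (r k)" "v k"] rN(3)[of k] rN(4)[of "()" k] unfolding v_def by simp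
  have v1: "\<bar>norm (v k) - 1\<bar> \<le> 2 * (\<theta> * (1/16) ^ k)" for k
    using z2_norm_close_emb(1)[of "f (r k)" "v k"] z2_norm_close_emb(2)[of "v k" "f (r k)"] near[of k] f(2)[of "r k"]
    by linarith
  have v0: "v k \<noteq> 0" for k
  proof
    assume "v k = 0"
    moreover have "\<theta> * (1/16) ^ k \<le> \<theta>" using \<theta> by (intro mult_left_le) (auto simp: power_le_one)
    moreover have "1 \<le> 2 * (\<theta> * (1/16) ^ k)" using v1[of k] \<open>v k = 0\<close> by simp
    ultimately show False using \<theta> by linarith
  qed
  show ?thesis
  proof (rule that)
    show "f (r k) \<in> Y" for k using f(1)[of "r k"] by (simp add: z2_tails_def)
    show "blocks N w" unfolding w_def v_def by (rule blocks_scale[OF blocks_proj[OF rN(2)]])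
    show "norm (w k) = 1" for k using v0[of k] by (simp add: w_def norm_divide)
    fix k
    have "norm (v k - w k) \<le> 2 * (\<theta> * (1/16) ^ k)"
      using v1[of k] norm_diff_normalise[OF v0] by (simp add: w_def scaleR_l2_conv)
    moreover have "f (r k) - z2_emb (w k) = z2_emb (v k - w k) + (f (r k) - z2_emb (v k))" by simp
    then have "z2_norm (f (r k) - z2_emb (w k)) \<le> norm (v k - w k) + z2_norm (f (r k) - z2_emb (v k))"
      by (metis z2_norm_emb_add_le)
    ultimately show "z2_norm (f (r k) - z2_emb (w k)) \<le> 4 * \<theta> * (1/16) ^ k" using near[of k] by simp
  qed
qed

text \<open>Inside \<open>Y\<close> lie vectors close to normalised blocks \<open>w k\<close>, and
  \<open>block_operator\<close> realises these as \<open>T (e k, 0)\<close>, so that the hypothesis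
  on \<open>A * T\<close> speaks about \<open>Y\<close>. Along a subsequence the images of the
  \<open>w k\<close> are almost blocks of norm at most about \<open>K\<close>, and the bound passes
  to the closed span of the nearby vectors of \<open>Y\<close>.\<close>

lemma ultrafilter_bound_on_subspace:
  fixes A :: "'k::rc_field z2_op"
  assumes U: "nontrivial_ultrafilter U"
    and K: "\<And>T t a. ((\<lambda>n. z2_norm (z2_app T (z2_e n))) \<longlongrightarrow> t) U \<Longrightarrow>
      ((\<lambda>n. z2_norm (z2_app (A * T) (z2_e n))) \<longlongrightarrow> a) U \<Longrightarrow> a \<le> K * t" "0 \<le> K"
    and \<epsilon>: "K < \<epsilon>" and Y: "infdim_closed_subspace Y"
  obtains Z where "Z \<subseteq> Y" "infdim_closed_subspace Z" "\<And>u. u \<in> Z \<Longrightarrow> z2_norm (z2_app A u) \<le> \<epsilon> * z2_norm u"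
proof -
  obtain L where L: "0 \<le> L" "\<And>u. z2_norm (z2_app A u) \<le> L * z2_norm u" using z2_op_bounded by blast
  \<comment> \<open>\<open>\<theta> * D\<close> is the total error in \<open>fin\<close>: the norms
    of the blocks, the perturbation of the image with factor 128, and the loss of
    \<open>512 * \<theta>\<close> in the lower bound for \<open>V\<close>.\<close>
  define D where "D = 2 + 128 * (8 * (4 * L + 2)) + 512 * \<epsilon>"
  have D: "0 < D" using L \<epsilon> K(2) by (simp add: D_def)
  define \<theta> where "\<theta> = min (1/1024) ((\<epsilon> - K) / 2 / D)"
  have \<theta>: "0 < \<theta>" "\<theta> \<le> 1/1024" using D \<epsilon> by (simp_all add: \<theta>_def)
  have "\<theta> \<le> (\<epsilon> - K) / 2 / D" by (simp add: \<theta>_def)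
  then have \<theta>D: "\<theta> * D \<le> (\<epsilon> - K) / 2" using D by (simp add: pos_le_divide_eq)
  have \<theta>4: "\<theta> \<le> 1/4" using \<theta>(2) by simp
  obtain u w N where u: "\<And>k. u k \<in> Y" and w: "blocks N w" "\<And>k. norm (w k) = 1"
    and near: "\<And>k. z2_norm (u k - z2_emb (w k)) \<le> 4 * \<theta> * (1/16) ^ k"
    using infdim_almost_embedded_blocks[OF Y \<theta>(1) \<theta>4] by metis
  obtain T where T: "\<And>k. z2_app T (z2_e k) = z2_emb (w k)" using block_operator[OF w] by blast
  define \<kappa> where "\<kappa> = (\<epsilon> - K) / 2"
  have \<kappa>: "0 < \<kappa>" using \<epsilon> by (simp add: \<kappa>_def)
  define g where "g = (\<lambda>n. z2_norm (z2_app (A * T) (z2_e n)))"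
  have "norm (g n) \<le> L" for n using L(2)[of "z2_emb (w n)"] by (simp add: g_def T w z2_norm_nonneg)
  then have "bounded (range g)" by (auto simp: bounded_iff)
  then have lim: "(g \<longlongrightarrow> Lim U g) U" by (rule ultrafilter_tendsto_Lim[OF U])
  \<comment> \<open>The blocks have norm 1, so the hypothesis bounds the ultralimit of their images
    by \<open>K\<close> itself.\<close>
  have "((\<lambda>n. z2_norm (z2_app T (z2_e n))) \<longlongrightarrow> 1) U" by (simp add: T w)
  from K(1)[OF this lim[unfolded g_def]] have "Lim U g \<le> K * 1" by (simp add: g_def)
  then have evg: "eventually (\<lambda>n. g n < K + \<kappa>) U" using \<kappa> by (intro order_tendstoD(2)[OF lim]) simp
  define R where "R = (\<lambda>k n. g n < K + \<kappa> \<and> norm (z2_y (z2_app (A * T) (z2_e n))) \<le> \<theta> * (1/16) ^ k)"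
  have R: "\<exists>n\<ge>m. R k n" for k m
  proof (rule ultrafilter_frequently[OF U])
    show "eventually (R k) U"
      unfolding R_def using evg \<theta>
      by (intro eventually_conj filter_leD[OF ultrafilter_le_sequentially[OF U] eventually_z2_y_app_e_small]) auto
  qed
  obtain r M :: "nat \<Rightarrow> nat" where rM: "strict_mono r" "strict_mono M" "\<And>k. R k (r k)"
    "\<And>k j. j \<in> {()} \<Longrightarrow> norm (z2_d (z2_app (A * T) (z2_e (r k))) - l2_proj {M k..<M (Suc k)} (z2_d (z2_app (A * T) (z2_e (r k))))) \<le> \<theta> * (1/16) ^ k"
    by (rule gliding_hump[of "{()}" "\<lambda>_ n. z2_d (z2_app (A * T) (z2_e n))" "\<lambda>k. \<theta> * (1/16) ^ k" R])
      (use R z2_null_app_e[of "A * T"] \<theta> in \<open>auto simp: z2_null_def\<close>)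
  define z where "z = (\<lambda>k. l2_proj {M k..<M (Suc k)} (z2_d (z2_app (A * T) (z2_e (r k)))))"
  have bz: "blocks M z" unfolding z_def by (rule blocks_proj[OF rM(2)])
  have nz: "z2_norm (z2_app A (z2_emb (w (r k))) - z2_emb (z k)) \<le> 2 * \<theta> * (1/16) ^ k" for k
    using z2_norm_diff_emb_le[of "z2_app (A * T) (z2_e (r k))" "z k"] rM(3)[of k] rM(4)[of "()" k]
    unfolding R_def z_def by (simp add: T)
  have zb: "norm (z k) \<le> K + \<kappa> + 2 * \<theta>" for k
  proof -
    have "2 * \<theta> * (1/16) ^ k \<le> 2 * \<theta>" using \<theta> by (simp add: mult_left_le power_le_one)
    moreover have "z2_norm (z2_app A (z2_emb (w (r k)))) < K + \<kappa>" using rM(3)[of k] by (simp add: R_def g_def T)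
    ultimately show ?thesis using z2_norm_close_emb(2)[of "z k" "z2_app A (z2_emb (w (r k)))"] nz[of k] by linarith
  qed
  have near': "z2_norm (u (r k) - z2_emb (w (r k))) \<le> 4 * \<theta> * (1/16) ^ k" for k
  proof -
    have "(1/16 :: real) ^ r k \<le> (1/16) ^ k" by (rule power_decreasing[OF strict_mono_imp_increasing[OF rM(1)]]) auto
    then have "4 * \<theta> * (1/16) ^ r k \<le> 4 * \<theta> * (1/16) ^ k" using \<theta> by (intro mult_left_mono) auto
    then show ?thesis using near[of "r k"] by linarith
  qed
  have w1: "norm (w (r k)) \<le> 1" "1 \<le> norm (w (r k))" for k by (simp_all add: w)
  obtain V C where V: "z2_linear V C" "\<And>k. V (l2_e k) = u (r k)"
    and Vlim: "\<And>c. z2_tendsto (\<lambda>n. \<Sum>k<n. z2_scale (l2_nth c k) (u (r k))) (V c)"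
    using block_synthesis[OF blocks_subseq[OF w(1) rM(1)] w1(1) near'] by metis
  have low: "(1 - 512 * \<theta>) * norm c \<le> z2_norm (V c)" for c
    using block_perturbation_ge[OF V(1) blocks_subseq[OF w(1) rM(1)] w1(1), of "4 * \<theta>" 1 c] near' w1 by (simp add: V(2))
  have nearA: "z2_norm (z2_app A (V (l2_e k)) - z2_emb (z k)) \<le> (8 * (4 * L + 2) * \<theta>) * (1/16) ^ k" for k
  proof -
    have "z2_app A (V (l2_e k)) - z2_emb (z k) = z2_app A (u (r k) - z2_emb (w (r k))) + (z2_app A (z2_emb (w (r k))) - z2_emb (z k))"
      by (simp add: V(2))
    moreover have "z2_norm (z2_app A (u (r k) - z2_emb (w (r k)))) \<le> L * (4 * \<theta> * (1/16) ^ k)"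
      using L(2)[of "u (r k) - z2_emb (w (r k))"] mult_left_mono[OF near'[of k] L(1)] by linarith
    ultimately have "z2_norm (z2_app A (V (l2_e k)) - z2_emb (z k)) \<le> 8 * (L * (4 * \<theta> * (1/16) ^ k) + 2 * \<theta> * (1/16) ^ k)"
      using z2_norm_add[of "z2_app A (u (r k) - z2_emb (w (r k)))" "z2_app A (z2_emb (w (r k))) - z2_emb (z k)"] nz[of k]
      by simp
    then show ?thesis by (simp add: algebra_simps)
  qed
  have up: "z2_norm (z2_app A (V c)) \<le> (K + \<kappa> + 2 * \<theta> + 128 * (8 * (4 * L + 2) * \<theta>)) * norm c" for c
    by (rule block_perturbation_le[OF z2_linear_app[OF V(1) L(2,1)] bz zb nearA])
  have "2 * \<theta> + 128 * (8 * (4 * L + 2) * \<theta>) + 512 * \<theta> * \<epsilon> \<le> (\<epsilon> - K) / 2" using \<theta>D by (simp add: D_def algebra_simps)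
  then have fin: "K + \<kappa> + 2 * \<theta> + 128 * (8 * (4 * L + 2) * \<theta>) \<le> \<epsilon> * (1 - 512 * \<theta>)"
    unfolding \<kappa>_def by (simp add: field_simps)
  show ?thesis
  proof (rule that)
    show "range V \<subseteq> Y"
    proof clarify
      fix c
      have sums: "(\<Sum>k<n. z2_scale (l2_nth c k) (u (r k))) \<in> Y" for n
        using Y unfolding infdim_closed_subspace_def by (intro z2.subspace_sum z2.subspace_scale u) auto
      have "\<forall>us v. (\<forall>n. us n \<in> Y) \<and> z2_tendsto us v \<longrightarrow> v \<in> Y"
        using Y by (simp add: infdim_closed_subspace_def)
      from this[rule_format, OF conjI[OF allI Vlim]] sums show "V c \<in> Y" by blast
    qed
    show "infdim_closed_subspace (range V)" by (rule infdim_range[OF V(1) _ low]) (use \<theta> in simp)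
    fix x assume "x \<in> range V"
    then obtain c where c: "x = V c" by blast
    have "z2_norm (z2_app A x) \<le> \<epsilon> * (1 - 512 * \<theta>) * norm c"
      unfolding c by (rule order_trans[OF up mult_right_mono[OF fin]]) simp
    also have "\<dots> \<le> \<epsilon> * z2_norm x"
      unfolding c mult.assoc by (rule mult_left_mono[OF low]) (use \<epsilon> K(2) in simp)
    finally show "z2_norm (z2_app A x) \<le> \<epsilon> * z2_norm x" .
  qed
qed

section \<open>Completion of a positive form\<close>

text \<open>Semidefiniteness is expressed by the Cauchy--Schwarz inequality, which makes sense
  without an order on the scalars and is inherited from \<open>ell2\<close> by the
  ultralimit.\<close>

locale psd_form = vector_space smul
  for smul :: "'k::rc_field \<Rightarrow> 'v::ab_group_add \<Rightarrow> 'v" +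
  fixes B :: "'v \<Rightarrow> 'v \<Rightarrow> 'k"
  assumes add_left: "B (S + T) R = B S R + B T R"
    and scale_left: "B (smul c T) R = c * B T R"
    and hermitian: "B R T = scnj (B T R)"
    and cauchy_schwarz: "(norm (B S T))\<^sup>2 \<le> norm (B S S) * norm (B T T)"
begin

definition p :: "'v \<Rightarrow> real" where "p T = sqrt (norm (B T T))"

lemma p_power2: "(p T)\<^sup>2 = norm (B T T)"
  by (simp add: p_def)

lemma p_nonneg [simp]: "0 \<le> p T"
  by (simp add: p_def)

lemma norm_B_le: "norm (B S T) \<le> p S * p T"
  using real_sqrt_le_mono[OF cauchy_schwarz[of S T]] by (simp add: p_def real_sqrt_mult)

lemma add_right: "B R (S + T) = B R S + B R T"
  by (simp add: hermitian[of R] add_left scnj_add)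

lemma zero_left [simp]: "B 0 R = 0"
  using scale_left[of 0 0 R] by simp

lemma minus_left: "B (- T) R = - B T R"
  using add_left[of T "- T" R] by (simp add: eq_neg_iff_add_eq_0 add.commute)

lemma minus_right: "B R (- T) = - B R T"
  by (simp add: hermitian[of R] minus_left)

lemma diff_left: "B (S - T) R = B S R - B T R"
  using add_left[of S "- T" R] by (simp add: minus_left)

lemma diff_right: "B R (S - T) = B R S - B R T"
  using add_right[of R S "- T"] by (simp add: minus_right)

lemma p_0 [simp]: "p 0 = 0"
  by (simp add: p_def)

lemma p_minus [simp]: "p (- T) = p T"
  by (simp add: p_def minus_left minus_right)

lemma p_minus_commute: "p (S - T) = p (T - S)"
  using p_minus[of "S - T"] by simp

lemma p_scale: "p (smul c T) = norm c * p T"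
proof -
  have "B (smul c T) (smul c T) = c * scnj c * B T T"
    using hermitian[of T "smul c T"] hermitian[of T T] by (simp add: scale_left scnj_mult mult_ac)
  then show ?thesis by (simp add: p_def norm_mult real_sqrt_mult)
qed

lemma p_add: "p (S + T) \<le> p S + p T"
proof (rule power2_le_imp_le)
  have "(p (S + T))\<^sup>2 = norm (B S S + B S T + B T S + B T T)"
    by (simp add: p_power2 add_left add_right ac_simps)
  also have "\<dots> \<le> norm (B S S) + norm (B S T) + norm (B T S) + norm (B T T)"
    by (intro order_trans[OF norm_triangle_ineq add_right_mono] norm_triangle_ineq)
  also have "\<dots> \<le> (p S)\<^sup>2 + p S * p T + p T * p S + (p T)\<^sup>2"
    unfolding p_power2 by (intro add_mono norm_B_le order_refl)
  finally show "(p (S + T))\<^sup>2 \<le> (p S + p T)\<^sup>2" by (simp add: power2_eq_square algebra_simps)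
qed simp

lemma p_triangle: "p (S - R) \<le> p (S - T) + p (T - R)"
  using p_add[of "S - T" "T - R"] by simp

lemma p_diff_abs: "\<bar>p S - p T\<bar> \<le> p (S - T)"
  using p_add[of "S - T" T] p_add[of "T - S" S] p_minus_commute[of S T] by simp

section \<open>Classes of Cauchy sequences modulo null sequences\<close>

lemma cauchy_seqs_iff: "X \<in> cauchy_seqs B \<longleftrightarrow> (\<forall>e>0. \<exists>N. \<forall>m\<ge>N. \<forall>n\<ge>N. p (X m - X n) < e)"
proof
  assume X: "X \<in> cauchy_seqs B"
  show "\<forall>e>0. \<exists>N. \<forall>m\<ge>N. \<forall>n\<ge>N. p (X m - X n) < e"
  proof (intro allI impI)
    fix e :: real assume e: "0 < e"
    then have "0 < e\<^sup>2" by simp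
    then obtain N where "\<And>m n. m \<ge> N \<Longrightarrow> n \<ge> N \<Longrightarrow> norm (B (X m - X n) (X m - X n)) < e\<^sup>2"
      using X unfolding cauchy_seqs_def mem_Collect_eq by blast
    then have "p (X m - X n) < e" if "m \<ge> N" "n \<ge> N" for m n
      using e that unfolding p_power2[symmetric] by (metis power2_less_imp_less less_imp_le)
    then show "\<exists>N. \<forall>m\<ge>N. \<forall>n\<ge>N. p (X m - X n) < e" by blast
  qed
next
  assume X: "\<forall>e>0. \<exists>N. \<forall>m\<ge>N. \<forall>n\<ge>N. p (X m - X n) < e"
  show "X \<in> cauchy_seqs B"
    unfolding cauchy_seqs_def mem_Collect_eq
  proof (intro allI impI)
    fix e :: real assume e: "0 < e"
    then obtain N where "\<And>m n. m \<ge> N \<Longrightarrow> n \<ge> N \<Longrightarrow> p (X m - X n) < sqrt e"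
      using X by (metis real_sqrt_gt_zero)
    then have "norm (B (X m - X n) (X m - X n)) < e" if "m \<ge> N" "n \<ge> N" for m n
      using that unfolding p_def by (simp add: real_sqrt_less_iff)
    then show "\<exists>N. \<forall>m\<ge>N. \<forall>n\<ge>N. norm (B (X m - X n) (X m - X n)) < e" by blast
  qed
qed

lemma null_rel_iff: "(X, Y) \<in> null_rel B \<longleftrightarrow>
  X \<in> cauchy_seqs B \<and> Y \<in> cauchy_seqs B \<and> (\<lambda>n. p (X n - Y n)) \<longlonglongrightarrow> 0"
proof -
  have "(\<lambda>n. B (X n - Y n) (X n - Y n)) \<longlonglongrightarrow> 0 \<longleftrightarrow> (\<lambda>n. norm (B (X n - Y n) (X n - Y n))) \<longlonglongrightarrow> 0"
    by (simp add: tendsto_norm_zero_iff)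
  also have "\<dots> \<longleftrightarrow> (\<lambda>n. p (X n - Y n)) \<longlonglongrightarrow> 0"
  proof
    assume "(\<lambda>n. norm (B (X n - Y n) (X n - Y n))) \<longlonglongrightarrow> 0"
    from tendsto_real_sqrt[OF this] show "(\<lambda>n. p (X n - Y n)) \<longlonglongrightarrow> 0" by (simp add: p_def)
  next
    assume "(\<lambda>n. p (X n - Y n)) \<longlonglongrightarrow> 0"
    from tendsto_power[OF this, of 2] show "(\<lambda>n. norm (B (X n - Y n) (X n - Y n))) \<longlonglongrightarrow> 0"
      by (simp add: p_power2)
  qed
  finally show ?thesis by (simp add: null_rel_def)
qed

abbreviation "CS \<equiv> cauchy_seqs B"

abbreviation "H \<equiv> hilbert_completion smul B"

definition cls :: "(nat \<Rightarrow> 'v) \<Rightarrow> (nat \<Rightarrow> 'v) set" where "cls X = null_rel B `` {X}"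

lemma tendsto_p_sandwich:
  assumes "\<And>n. p (X n) \<le> f n" "f \<longlonglongrightarrow> 0" shows "(\<lambda>n. p (X n)) \<longlonglongrightarrow> 0"
  by (rule tendsto_sandwich[OF _ _ tendsto_const assms(2)]) (auto simp: assms(1))

lemma equiv_null_rel: "equiv CS (null_rel B)"
proof (rule equivI)
  show "null_rel B \<subseteq> CS \<times> CS" by (auto simp: null_rel_iff)
  show "refl_on CS (null_rel B)" by (rule refl_onI) (simp add: null_rel_iff)
  show "sym (null_rel B)" by (rule symI) (simp add: null_rel_iff p_minus_commute)
  show "trans (null_rel B)"
  proof (rule transI)
    fix X Y Z assume XY: "(X, Y) \<in> null_rel B" and YZ: "(Y, Z) \<in> null_rel B"
    have "(\<lambda>n. p (X n - Y n) + p (Y n - Z n)) \<longlonglongrightarrow> 0"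
      using XY YZ tendsto_add[of "\<lambda>n. p (X n - Y n)" 0 sequentially "\<lambda>n. p (Y n - Z n)" 0]
      by (simp add: null_rel_iff)
    then have "(\<lambda>n. p (X n - Z n)) \<longlonglongrightarrow> 0" by (rule tendsto_p_sandwich[OF p_triangle])
    then show "(X, Z) \<in> null_rel B" using XY YZ by (simp add: null_rel_iff)
  qed
qed

lemma cls_eq_iff: "X \<in> CS \<Longrightarrow> Y \<in> CS \<Longrightarrow> cls X = cls Y \<longleftrightarrow> (\<lambda>n. p (X n - Y n)) \<longlonglongrightarrow> 0"
  using eq_equiv_class_iff[OF equiv_null_rel, of X Y] by (simp add: cls_def null_rel_iff)

lemma mem_cls: "X \<in> CS \<Longrightarrow> X \<in> cls X"
  by (simp add: cls_def null_rel_iff)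

lemma mem_clsD: "Y \<in> cls X \<Longrightarrow> X \<in> CS" "Y \<in> cls X \<Longrightarrow> Y \<in> CS" "Y \<in> cls X \<Longrightarrow> cls Y = cls X"
  "Y \<in> cls X \<Longrightarrow> (\<lambda>n. p (Y n - X n)) \<longlonglongrightarrow> 0"
  using cls_eq_iff[of Y X] p_minus_commute by (auto simp: cls_def null_rel_iff)

lemma vec_H: "vec H = cls ` CS"
  by (auto simp: hilbert_completion_def quotient_def cls_def)

lemma UN_cls_const:
  assumes "X \<in> CS" "\<And>Y. Y \<in> cls X \<Longrightarrow> f Y = f X" shows "(\<Union>Y\<in>cls X. f Y) = f X"
  using assms mem_cls[OF assms(1)] by blast

lemma CS_add: "X \<in> CS \<Longrightarrow> Y \<in> CS \<Longrightarrow> (\<lambda>n. X n + Y n) \<in> CS"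
  unfolding cauchy_seqs_iff
proof (intro allI impI)
  fix e :: real
  assume X: "\<forall>e>0. \<exists>N. \<forall>m\<ge>N. \<forall>n\<ge>N. p (X m - X n) < e" and Y: "\<forall>e>0. \<exists>N. \<forall>m\<ge>N. \<forall>n\<ge>N. p (Y m - Y n) < e" and e: "0 < e"
  obtain N where N: "\<forall>m\<ge>N. \<forall>n\<ge>N. p (X m - X n) < e / 2" using X e half_gt_zero by blast
  obtain M where M: "\<forall>m\<ge>M. \<forall>n\<ge>M. p (Y m - Y n) < e / 2" using Y e half_gt_zero by blast
  have "p (X m + Y m - (X n + Y n)) < e" if "m \<ge> max N M" "n \<ge> max N M" for m n
  proof -
    have eq: "X m + Y m - (X n + Y n) = (X m - X n) + (Y m - Y n)" by (simp add: algebra_simps)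
    have "p (X m - X n) < e / 2" "p (Y m - Y n) < e / 2" using N M that by auto
    then show ?thesis unfolding eq using p_add[of "X m - X n" "Y m - Y n"] by linarith
  qed
  then show "\<exists>N. \<forall>m\<ge>N. \<forall>n\<ge>N. p (X m + Y m - (X n + Y n)) < e" by blast
qed

lemma CS_map:
  assumes F: "\<And>S T. F (S - T) = F S - F T" "\<And>T. p (F T) \<le> K * p T" and X: "X \<in> CS"
  shows "(\<lambda>n. F (X n)) \<in> CS"
  unfolding cauchy_seqs_iff
proof (intro allI impI)
  fix e :: real assume e: "0 < e"
  have "0 < e / (\<bar>K\<bar> + 1)" using e by simp
  then obtain N where N: "\<And>m n. m \<ge> N \<Longrightarrow> n \<ge> N \<Longrightarrow> p (X m - X n) < e / (\<bar>K\<bar> + 1)"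
    using X unfolding cauchy_seqs_iff by blast
  have "p (F (X m) - F (X n)) < e" if "m \<ge> N" "n \<ge> N" for m n
  proof -
    have "p (F (X m) - F (X n)) \<le> K * p (X m - X n)" using F(2)[of "X m - X n"] by (simp add: F(1))
    also have "\<dots> \<le> (\<bar>K\<bar> + 1) * p (X m - X n)" by (intro mult_right_mono) auto
    also have "\<dots> < e" using N[OF that] by (simp add: pos_less_divide_eq mult.commute)
    finally show ?thesis .
  qed
  then show "\<exists>N. \<forall>m\<ge>N. \<forall>n\<ge>N. p (F (X m) - F (X n)) < e" by blast
qed

lemma CS_scale: "X \<in> CS \<Longrightarrow> (\<lambda>n. smul c (X n)) \<in> CS"
  by (rule CS_map[of _ "norm c"]) (auto simp: scale_right_diff_distrib p_scale)

lemma CS_diff: "X \<in> CS \<Longrightarrow> Y \<in> CS \<Longrightarrow> (\<lambda>n. X n - Y n) \<in> CS"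
  using CS_add[of X "\<lambda>n. smul (- 1) (Y n)"] CS_scale[of Y "- 1"] by simp

lemma CS_const: "(\<lambda>_. T) \<in> CS"
  by (simp add: cauchy_seqs_iff)

text \<open>The union in the definition ranges over equal classes, so any representatives compute
  the sum.\<close>

lemma vadd_cls: "X \<in> CS \<Longrightarrow> Y \<in> CS \<Longrightarrow> vadd H (cls X) (cls Y) = cls (\<lambda>n. X n + Y n)"
proof -
  assume X: "X \<in> CS" and Y: "Y \<in> CS"
  have "cls (\<lambda>n. X' n + Y' n) = cls (\<lambda>n. X n + Y n)" if X': "X' \<in> cls X" and Y': "Y' \<in> cls Y" for X' Y'
  proof (subst cls_eq_iff)
    show "(\<lambda>n. X' n + Y' n) \<in> CS" "(\<lambda>n. X n + Y n) \<in> CS" using X Y mem_clsD that by (auto intro: CS_add)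
    have "(\<lambda>n. p (X' n - X n) + p (Y' n - Y n)) \<longlonglongrightarrow> 0"
      using tendsto_add[OF mem_clsD(4)[OF X'] mem_clsD(4)[OF Y']] by simp
    then show "(\<lambda>n. p (X' n + Y' n - (X n + Y n))) \<longlonglongrightarrow> 0"
    proof (rule tendsto_p_sandwich[rotated])
      show "p (X' n + Y' n - (X n + Y n)) \<le> p (X' n - X n) + p (Y' n - Y n)" for n
        using p_add[of "X' n - X n" "Y' n - Y n"] by (simp add: algebra_simps)
    qed
  qed
  then have "(\<Union>X'\<in>cls X. \<Union>Y'\<in>cls Y. cls (\<lambda>n. X' n + Y' n)) = cls (\<lambda>n. X n + Y n)"
    using mem_cls[OF X] mem_cls[OF Y] by blast
  then show ?thesis by (simp add: hilbert_completion_def cls_def)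
qed

lemma vscale_cls: "X \<in> CS \<Longrightarrow> vscale H c (cls X) = cls (\<lambda>n. smul c (X n))"
proof -
  assume X: "X \<in> CS"
  have "cls (\<lambda>n. smul c (X' n)) = cls (\<lambda>n. smul c (X n))" if X': "X' \<in> cls X" for X'
  proof (subst cls_eq_iff)
    show "(\<lambda>n. smul c (X' n)) \<in> CS" "(\<lambda>n. smul c (X n)) \<in> CS" using X mem_clsD that by (auto intro: CS_scale)
    show "(\<lambda>n. p (smul c (X' n) - smul c (X n))) \<longlonglongrightarrow> 0"
      using tendsto_mult_right_zero[OF mem_clsD(4)[OF X'], of "norm c"]
      by (simp add: p_scale flip: scale_right_diff_distrib)
  qed
  then have "(\<Union>X'\<in>cls X. cls (\<lambda>n. smul c (X' n))) = cls (\<lambda>n. smul c (X n))" by (rule UN_cls_const[OF X])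
  then show ?thesis by (simp add: hilbert_completion_def cls_def)
qed

lemma CS_bounded: assumes "X \<in> CS" obtains C where "\<And>n. p (X n) \<le> C"
proof -
  obtain N where N: "\<And>m n. m \<ge> N \<Longrightarrow> n \<ge> N \<Longrightarrow> p (X m - X n) < 1"
    using assms unfolding cauchy_seqs_iff by (metis zero_less_one)
  have "p (X n) \<le> Max ((\<lambda>n. p (X n)) ` {..N}) + 1" for n
  proof (cases "n \<le> N")
    case True
    then have "p (X n) \<le> Max ((\<lambda>n. p (X n)) ` {..N})" by (intro Max_ge) auto
    then show ?thesis by simp
  next
    case False
    have "p (X N) \<le> Max ((\<lambda>n. p (X n)) ` {..N})" by (intro Max_ge) auto
    then show ?thesis using p_diff_abs[of "X n" "X N"] N[of n N] False by linarith
  qed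
  then show ?thesis by (rule that)
qed

lemma B_convergent:
  assumes X: "X \<in> CS" and Y: "Y \<in> CS" shows "convergent (\<lambda>n. B (X n) (Y n))"
proof (rule Cauchy_convergent)
  obtain C where C: "\<And>n. p (X n) \<le> C" using CS_bounded[OF X] by blast
  obtain D where D: "\<And>n. p (Y n) \<le> D" using CS_bounded[OF Y] by blast
  define K where "K = \<bar>C\<bar> + \<bar>D\<bar> + 1"
  have K: "0 < K" by (simp add: K_def add_nonneg_pos)
  have XK: "p (X n) \<le> K" and YK: "p (Y n) \<le> K" for n
    unfolding K_def using C[of n] D[of n] by linarith+
  show "Cauchy (\<lambda>n. B (X n) (Y n))"
    unfolding Cauchy_iff
  proof (intro allI impI)
    fix e :: real assume e: "0 < e"
    have e2: "0 < e / (2 * K)" using e K by simp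
    obtain N where N: "\<And>m n. m \<ge> N \<Longrightarrow> n \<ge> N \<Longrightarrow> p (X m - X n) < e / (2 * K)"
      using X e2 unfolding cauchy_seqs_iff by blast
    obtain M where M: "\<And>m n. m \<ge> M \<Longrightarrow> n \<ge> M \<Longrightarrow> p (Y m - Y n) < e / (2 * K)"
      using Y e2 unfolding cauchy_seqs_iff by blast
    have "norm (B (X m) (Y m) - B (X n) (Y n)) < e" if "m \<ge> max N M" "n \<ge> max N M" for m n
    proof -
      have eq: "B (X m) (Y m) - B (X n) (Y n) = B (X m - X n) (Y m) + B (X n) (Y m - Y n)"
        by (simp add: diff_left diff_right)
      have "norm (B (X m - X n) (Y m)) \<le> p (X m - X n) * K"
        by (rule order_trans[OF norm_B_le mult_left_mono[OF YK]]) simp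
      moreover have "norm (B (X n) (Y m - Y n)) \<le> K * p (Y m - Y n)"
        by (rule order_trans[OF norm_B_le mult_right_mono[OF XK]]) simp
      moreover have "p (X m - X n) * K < e / 2" "K * p (Y m - Y n) < e / 2"
        using N[of m n] M[of m n] that K by (auto simp: pos_less_divide_eq mult_ac)
      ultimately show ?thesis
        unfolding eq using norm_triangle_ineq[of "B (X m - X n) (Y m)" "B (X n) (Y m - Y n)"] by linarith
    qed
    then show "\<exists>M. \<forall>m\<ge>M. \<forall>n\<ge>M. norm (B (X m) (Y m) - B (X n) (Y n)) < e" by blast
  qed
qed

text \<open>Cauchy sequences are bounded for \<open>p\<close>, so a change of representatives alters
  the values by a null sequence; the limit in the definite description exists and is unique.\<close>

lemma inner_prod_cls:
  assumes X: "X \<in> CS" and Y: "Y \<in> CS"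
  shows "(\<lambda>n. B (X n) (Y n)) \<longlonglongrightarrow> inner_prod H (cls X) (cls Y)"
proof -
  obtain l where l: "(\<lambda>n. B (X n) (Y n)) \<longlonglongrightarrow> l" using B_convergent[OF X Y] by (auto simp: convergent_def)
  have lim: "(\<lambda>n. B (X' n) (Y' n)) \<longlonglongrightarrow> l" if X': "X' \<in> cls X" and Y': "Y' \<in> cls Y" for X' Y'
  proof -
    obtain C where C: "\<And>n. p (X n) \<le> C" using CS_bounded[OF X] by blast
    obtain D where D: "\<And>n. p (Y' n) \<le> D" using CS_bounded[OF mem_clsD(2)[OF Y']] by blast
    have "(\<lambda>n. p (X' n - X n) * D + C * p (Y' n - Y n)) \<longlonglongrightarrow> 0 * D + C * 0"
      by (intro tendsto_intros mem_clsD(4) X' Y')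
    then have "(\<lambda>n. p (X' n - X n) * D + C * p (Y' n - Y n)) \<longlonglongrightarrow> 0" by simp
    then have "(\<lambda>n. B (X' n) (Y' n) - B (X n) (Y n)) \<longlonglongrightarrow> 0"
    proof (rule Lim_null_comparison[rotated], intro always_eventually allI)
      fix n
      have eq: "B (X' n) (Y' n) - B (X n) (Y n) = B (X' n - X n) (Y' n) + B (X n) (Y' n - Y n)"
        by (simp add: diff_left diff_right)
      show "norm (B (X' n) (Y' n) - B (X n) (Y n)) \<le> p (X' n - X n) * D + C * p (Y' n - Y n)"
        unfolding eq
        by (intro order_trans[OF norm_triangle_ineq] add_mono
            order_trans[OF norm_B_le mult_left_mono[OF D]] order_trans[OF norm_B_le mult_right_mono[OF C]]) auto
    qed
    from tendsto_add[OF this l] show ?thesis by simp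
  qed
  have "inner_prod H (cls X) (cls Y) = l"
    unfolding hilbert_completion_def ip_space.simps
  proof (rule the_equality)
    show "\<forall>X'\<in>cls X. \<forall>Y'\<in>cls Y. (\<lambda>n. B (X' n) (Y' n)) \<longlonglongrightarrow> l" using lim by blast
    fix l' assume "\<forall>X'\<in>cls X. \<forall>Y'\<in>cls Y. (\<lambda>n. B (X' n) (Y' n)) \<longlonglongrightarrow> l'"
    then show "l' = l" using l mem_cls[OF X] mem_cls[OF Y] LIMSEQ_unique by blast
  qed
  with l show ?thesis by simp
qed

lemma vnorm_cls: assumes "X \<in> CS" shows "(\<lambda>n. p (X n)) \<longlonglongrightarrow> vnorm H (cls X)"
  unfolding p_def vnorm_def by (intro tendsto_real_sqrt tendsto_norm inner_prod_cls assms)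

lemma vnorm_cls_const: "vnorm H (cls (\<lambda>_. T)) = p T"
  using vnorm_cls[OF CS_const] by (simp add: LIMSEQ_const_iff)

lemma cls_eq_iff_vnorm:
  assumes "X \<in> CS" "Y \<in> CS" shows "cls X = cls Y \<longleftrightarrow> vnorm H (cls (\<lambda>n. X n - Y n)) = 0"
  unfolding cls_eq_iff[OF assms] using vnorm_cls[OF CS_diff[OF assms]] LIMSEQ_unique by fastforce

lemma vnorm_triangle:
  assumes "X \<in> CS" "Y \<in> CS" "Z \<in> CS"
  shows "vnorm H (cls (\<lambda>n. X n - Z n)) \<le> vnorm H (cls (\<lambda>n. X n - Y n)) + vnorm H (cls (\<lambda>n. Y n - Z n))"
  by (rule LIMSEQ_le[OF vnorm_cls tendsto_add[OF vnorm_cls vnorm_cls]])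
    (use assms p_triangle in \<open>auto intro: CS_diff\<close>)

lemma bounded_ops_diff:
  assumes F: "F \<in> bounded_ops H" and X: "X \<in> CS" "Y \<in> CS" and X': "X' \<in> CS" "Y' \<in> CS"
    "F (cls X) = cls X'" "F (cls Y) = cls Y'"
  shows "F (cls (\<lambda>n. X n - Y n)) = cls (\<lambda>n. X' n - Y' n)"
proof -
  have lin: "\<And>h k. h \<in> vec H \<Longrightarrow> k \<in> vec H \<Longrightarrow> F (vadd H h k) = vadd H (F h) (F k)"
    "\<And>c h. h \<in> vec H \<Longrightarrow> F (vscale H c h) = vscale H c (F h)"
    using F by (auto simp: bounded_ops_def)
  have m: "(\<lambda>n. smul (- 1) (Y n)) \<in> CS" "(\<lambda>n. smul (- 1) (Y' n)) \<in> CS" using CS_scale X X' by blast+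
  have "cls (\<lambda>n. X n - Y n) = vadd H (cls X) (vscale H (- 1) (cls Y))"
    using vadd_cls[OF X(1) m(1)] by (simp add: vscale_cls[OF X(2)])
  moreover have "cls (\<lambda>n. X' n - Y' n) = vadd H (cls X') (vscale H (- 1) (cls Y'))"
    using vadd_cls[OF X'(1) m(2)] by (simp add: vscale_cls[OF X'(2)])
  moreover have "cls X \<in> vec H" "cls Y \<in> vec H" "vscale H (- 1) (cls Y) \<in> vec H"
    using X m by (auto simp: vec_H vscale_cls)
  ultimately show ?thesis by (simp add: lin X')
qed

text \<open>Classes of constant sequences are dense, the class of \<open>X\<close> being the limit
  of those of the constants \<open>X m\<close>; bounded operators that agree there agree
  everywhere.\<close>

lemma bounded_ops_eqI:
  assumes F: "F \<in> bounded_ops H" and G: "G \<in> bounded_ops H" and eq: "\<And>T. F (cls (\<lambda>_. T)) = G (cls (\<lambda>_. T))"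
  shows "F = G"
proof (rule extensionalityI)
  show "F \<in> extensional (vec H)" "G \<in> extensional (vec H)" using F G by (auto simp: bounded_ops_def PiE_def)
  fix h assume "h \<in> vec H"
  then obtain X where X: "X \<in> CS" "h = cls X" by (auto simp: vec_H)
  have maps: "\<And>F h. F \<in> bounded_ops H \<Longrightarrow> h \<in> vec H \<Longrightarrow> F h \<in> vec H" by (auto simp: bounded_ops_def)
  have c: "\<And>T. cls (\<lambda>_. T) \<in> vec H" using CS_const by (auto simp: vec_H)
  obtain Y where Y: "Y \<in> CS" "F (cls X) = cls Y" using maps[OF F] X by (auto simp: vec_H)
  obtain Y' where Y': "Y' \<in> CS" "G (cls X) = cls Y'" using maps[OF G] X by (auto simp: vec_H)
  have "\<forall>m. \<exists>Z. Z \<in> CS \<and> F (cls (\<lambda>_. X m)) = cls Z" using maps[OF F c] by (auto simp: vec_H)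
  then obtain Z where Z: "\<And>m. Z m \<in> CS" "\<And>m. F (cls (\<lambda>_. X m)) = cls (Z m)" by metis
  obtain K where K: "\<And>h. h \<in> vec H \<Longrightarrow> vnorm H (F h) \<le> K * vnorm H h" using F unfolding bounded_ops_def by blast
  obtain L where L: "\<And>h. h \<in> vec H \<Longrightarrow> vnorm H (G h) \<le> L * vnorm H h" using G unfolding bounded_ops_def by blast
  \<comment> \<open>The distance of \<open>h\<close> from the class of the constant sequence
    \<open>X m\<close>.\<close>
  define d where "d = (\<lambda>m. vnorm H (cls (\<lambda>n. X n - X m)))"
  have dv: "cls (\<lambda>n. X n - X m) \<in> vec H" for m using CS_diff[OF X(1) CS_const] by (auto simp: vec_H)
  have d0: "d \<longlonglongrightarrow> 0"
  proof (rule LIMSEQ_I)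
    fix r :: real assume r: "0 < r"
    then obtain N where N: "\<And>m n. m \<ge> N \<Longrightarrow> n \<ge> N \<Longrightarrow> p (X m - X n) < r / 2"
      using X(1) unfolding cauchy_seqs_iff by (meson half_gt_zero)
    have "norm (d m - 0) < r" if m: "m \<ge> N" for m
    proof -
      have "d m \<le> r / 2"
        unfolding d_def by (rule LIMSEQ_le_const2[OF vnorm_cls[OF CS_diff[OF X(1) CS_const]]])
          (use N m less_imp_le in blast)
      moreover have "0 \<le> d m" by (simp add: d_def vnorm_def)
      ultimately show ?thesis using r by simp
    qed
    then show "\<exists>no. \<forall>n\<ge>no. norm (d n - 0) < r" by blast
  qed
  have "vnorm H (cls (\<lambda>n. Y n - Y' n)) \<le> K * d m + L * d m" for m
  proof -
    have "vnorm H (cls (\<lambda>n. Y n - Z m n)) \<le> K * d m"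
      using K[OF dv[of m]] bounded_ops_diff[OF F X(1) CS_const Y(1) Z(1) Y(2) Z(2)] by (simp add: d_def)
    moreover have "vnorm H (cls (\<lambda>n. Y' n - Z m n)) \<le> L * d m"
      using L[OF dv[of m]] bounded_ops_diff[OF G X(1) CS_const Y'(1) Z(1) Y'(2)] Z(2) eq by (simp add: d_def)
    moreover have "vnorm H (cls (\<lambda>n. Z m n - Y' n)) = vnorm H (cls (\<lambda>n. Y' n - Z m n))"
      by (rule LIMSEQ_unique[OF vnorm_cls[OF CS_diff[OF Z(1) Y'(1)]]])
        (use vnorm_cls[OF CS_diff[OF Y'(1) Z(1)]] in \<open>simp add: p_minus_commute[of "Z m _"]\<close>)
    ultimately show ?thesis using vnorm_triangle[OF Y(1) Z(1) Y'(1), of m] by linarith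
  qed
  moreover have "(\<lambda>m. K * d m + L * d m) \<longlonglongrightarrow> K * 0 + L * 0" by (intro tendsto_intros d0)
  ultimately have "vnorm H (cls (\<lambda>n. Y n - Y' n)) \<le> K * 0 + L * 0"
    by (intro tendsto_lowerbound[of _ _ sequentially]) auto
  moreover have "0 \<le> vnorm H (cls (\<lambda>n. Y n - Y' n))" by (simp add: vnorm_def)
  ultimately have "cls Y = cls Y'" using cls_eq_iff_vnorm[OF Y(1) Y'(1)] by simp
  then show "F h = G h" using X Y Y' by simp
qed

text \<open>The choice of representative is immaterial for bounded maps by \<open>ext_cls\<close>;
  the restriction to \<open>vec H\<close> matches the extensional functions in
  \<open>bounded_ops\<close>.\<close>

definition ext :: "('v \<Rightarrow> 'v) \<Rightarrow> (nat \<Rightarrow> 'v) set \<Rightarrow> (nat \<Rightarrow> 'v) set" where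
  "ext F = (\<lambda>h\<in>vec H. cls (\<lambda>n. F ((SOME X. X \<in> CS \<and> h = cls X) n)))"

definition bounded_map :: "('v \<Rightarrow> 'v) \<Rightarrow> bool" where
  "bounded_map F \<longleftrightarrow> (\<forall>S T. F (S + T) = F S + F T) \<and> (\<forall>c T. F (smul c T) = smul c (F T))
     \<and> (\<exists>K. \<forall>T. p (F T) \<le> K * p T)"

lemma bounded_map_diff: "bounded_map F \<Longrightarrow> F (S - T) = F S - F T"
proof -
  assume F: "bounded_map F"
  have "F (S + smul (- 1) T) = F S + smul (- 1) (F T)" using F by (simp only: bounded_map_def)
  then show ?thesis by simp
qed

lemma CS_bounded_map: "bounded_map F \<Longrightarrow> X \<in> CS \<Longrightarrow> (\<lambda>n. F (X n)) \<in> CS"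
proof -
  assume F: "bounded_map F" and X: "X \<in> CS"
  obtain K where K: "\<And>T. p (F T) \<le> K * p T" using F by (auto simp: bounded_map_def)
  show "(\<lambda>n. F (X n)) \<in> CS" by (rule CS_map[OF bounded_map_diff[OF F] K X])
qed

lemma ext_cls: assumes F: "bounded_map F" and X: "X \<in> CS" shows "ext F (cls X) = cls (\<lambda>n. F (X n))"
proof -
  define X' where "X' = (SOME X'. X' \<in> CS \<and> cls X = cls X')"
  have X': "X' \<in> CS" "cls X = cls X'" unfolding X'_def using someI[of "\<lambda>X'. X' \<in> CS \<and> cls X = cls X'" X] X by auto
  have "(\<lambda>n. p (X' n - X n)) \<longlonglongrightarrow> 0" using cls_eq_iff[OF X'(1) X] X' by simp
  obtain K where K: "\<And>T. p (F T) \<le> K * p T" using F by (auto simp: bounded_map_def)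
  have "(\<lambda>n. p (F (X' n) - F (X n))) \<longlonglongrightarrow> 0"
  proof (rule tendsto_p_sandwich)
    show "p (F (X' n) - F (X n)) \<le> K * p (X' n - X n)" for n using K[of "X' n - X n"] by (simp add: bounded_map_diff[OF F])
    show "(\<lambda>n. K * p (X' n - X n)) \<longlonglongrightarrow> 0" by (rule tendsto_mult_right_zero) fact
  qed
  then have "cls (\<lambda>n. F (X' n)) = cls (\<lambda>n. F (X n))"
    using cls_eq_iff[OF CS_bounded_map[OF F X'(1)] CS_bounded_map[OF F X]] by simp
  moreover have "cls X \<in> vec H" using X by (simp add: vec_H)
  ultimately show ?thesis by (simp add: ext_def X'_def)
qed

lemma vnorm_ext_le:
  assumes F: "bounded_map F" and K: "\<And>T. p (F T) \<le> K * p T" and h: "h \<in> vec H"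
  shows "vnorm H (ext F h) \<le> K * vnorm H h"
proof -
  obtain X where X: "X \<in> CS" "h = cls X" using h by (auto simp: vec_H)
  show ?thesis
    unfolding X(2) ext_cls[OF F X(1)]
    by (rule LIMSEQ_le[OF vnorm_cls[OF CS_bounded_map[OF F X(1)]] tendsto_mult[OF tendsto_const vnorm_cls[OF X(1)]]])
      (simp add: K)
qed

lemma ext_bounded_ops: assumes F: "bounded_map F" shows "ext F \<in> bounded_ops H"
  unfolding bounded_ops_def mem_Collect_eq
proof (intro conjI ballI allI)
  have lin: "F (S + T) = F S + F T" "F (smul c T) = smul c (F T)" for S T c using F by (auto simp: bounded_map_def)
  show "ext F \<in> vec H \<rightarrow>\<^sub>E vec H"
  proof (rule PiE_I)
    fix h assume "h \<in> vec H"
    then show "ext F h \<in> vec H" using ext_cls[OF F] CS_bounded_map[OF F] by (auto simp: vec_H)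
  qed (simp add: ext_def)
  show "ext F (vadd H h k) = vadd H (ext F h) (ext F k)" if hk: "h \<in> vec H" "k \<in> vec H" for h k
  proof -
    obtain X Y where X: "X \<in> CS" "h = cls X" "Y \<in> CS" "k = cls Y" using hk by (auto simp: vec_H)
    show ?thesis using X by (simp add: vadd_cls ext_cls[OF F] CS_add CS_bounded_map[OF F] lin)
  qed
  show "ext F (vscale H c h) = vscale H c (ext F h)" if h: "h \<in> vec H" for c h
  proof -
    obtain X where X: "X \<in> CS" "h = cls X" using h by (auto simp: vec_H)
    show ?thesis using X by (simp add: vscale_cls ext_cls[OF F] CS_scale CS_bounded_map[OF F] lin)
  qed
  obtain K where "\<And>T. p (F T) \<le> K * p T" using F by (auto simp: bounded_map_def)
  then show "\<exists>K. \<forall>h\<in>vec H. vnorm H (ext F h) \<le> K * vnorm H h" using vnorm_ext_le[OF F] by blast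
qed

text \<open>A constant that works on the dense set of constant classes works on all of
  \<open>vec H\<close>, so both infima run over the same set.\<close>

lemma op_norm_ext:
  assumes F: "bounded_map F" shows "op_norm H (ext F) = Inf {K. 0 \<le> K \<and> (\<forall>T. p (F T) \<le> K * p T)}"
proof -
  have "(\<forall>h\<in>vec H. vnorm H (ext F h) \<le> K * vnorm H h) \<longleftrightarrow> (\<forall>T. p (F T) \<le> K * p T)" for K
  proof
    assume *: "\<forall>h\<in>vec H. vnorm H (ext F h) \<le> K * vnorm H h"
    show "\<forall>T. p (F T) \<le> K * p T"
    proof
      fix T
      have "cls (\<lambda>_. T) \<in> vec H" using CS_const by (auto simp: vec_H)
      with * show "p (F T) \<le> K * p T" using ext_cls[OF F CS_const] by (force simp: vnorm_cls_const)
    qed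
  qed (use vnorm_ext_le[OF F] in blast)
  then show ?thesis by (simp add: op_norm_def)
qed

text \<open>Tested on the difference of the two vectors.\<close>

lemma inner_prod_nondegenerate:
  assumes X: "X \<in> CS" and Y: "Y \<in> CS" and eq: "\<And>h. h \<in> vec H \<Longrightarrow> inner_prod H h (cls X) = inner_prod H h (cls Y)"
  shows "cls X = cls Y"
proof -
  note D = CS_diff[OF X Y]
  have "inner_prod H (cls (\<lambda>n. X n - Y n)) (cls X) = inner_prod H (cls (\<lambda>n. X n - Y n)) (cls Y)"
    using D by (intro eq) (auto simp: vec_H)
  with tendsto_diff[OF inner_prod_cls[OF D X] inner_prod_cls[OF D Y]]
  have "(\<lambda>n. B (X n - Y n) (X n - Y n)) \<longlonglongrightarrow> 0" by (simp add: diff_right)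
  then have "inner_prod H (cls (\<lambda>n. X n - Y n)) (cls (\<lambda>n. X n - Y n)) = 0" using inner_prod_cls[OF D D] LIMSEQ_unique by blast
  then show ?thesis using cls_eq_iff_vnorm[OF X Y] by (simp add: vnorm_def)
qed

text \<open>The adjoint relation passes to limits of representatives, and
  \<open>inner_prod_nondegenerate\<close> makes the adjoint unique.\<close>

lemma hilbert_adjoint_ext:
  assumes F: "bounded_map F" and G: "bounded_map G" and adj: "\<And>S T. B (F S) T = B S (G T)"
  shows "hilbert_adjoint H (ext F) = ext G"
  unfolding hilbert_adjoint_def
proof (rule the_equality)
  have adj': "inner_prod H (ext F h) k = inner_prod H h (ext G k)" if hk: "h \<in> vec H" "k \<in> vec H" for h k
  proof -
    obtain X Y where X: "X \<in> CS" "h = cls X" "Y \<in> CS" "k = cls Y" using hk by (auto simp: vec_H)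
    show ?thesis
      unfolding X(2,4) ext_cls[OF F X(1)] ext_cls[OF G X(3)]
      by (rule LIMSEQ_unique[OF inner_prod_cls[OF CS_bounded_map[OF F X(1)] X(3)]])
        (use inner_prod_cls[OF X(1) CS_bounded_map[OF G X(3)]] in \<open>simp add: adj\<close>)
  qed
  then show "ext G \<in> bounded_ops H \<and> (\<forall>h\<in>vec H. \<forall>k\<in>vec H. inner_prod H (ext F h) k = inner_prod H h (ext G k))"
    using ext_bounded_ops[OF G] by blast
  fix G' assume G': "G' \<in> bounded_ops H \<and> (\<forall>h\<in>vec H. \<forall>k\<in>vec H. inner_prod H (ext F h) k = inner_prod H h (G' k))"
  show "G' = ext G"
  proof (rule extensionalityI)
    show "G' \<in> extensional (vec H)" "ext G \<in> extensional (vec H)"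
      using G' ext_bounded_ops[OF G] by (auto simp: bounded_ops_def PiE_def)
    fix k assume k: "k \<in> vec H"
    have "G' k \<in> vec H" "ext G k \<in> vec H" using G' ext_bounded_ops[OF G] k by (auto simp: bounded_ops_def)
    then obtain X Y where X: "X \<in> CS" "G' k = cls X" "Y \<in> CS" "ext G k = cls Y" by (auto simp: vec_H)
    show "G' k = ext G k"
      unfolding X(2,4)
    proof (rule inner_prod_nondegenerate[OF X(1,3)])
      fix h assume h: "h \<in> vec H"
      show "inner_prod H h (cls X) = inner_prod H h (cls Y)"
        using G'[THEN conjunct2, rule_format, OF h k] adj'[OF h k] X(2,4) by simp
    qed
  qed
qed

end

section \<open>The Kalton--Swanson form\<close>

global_interpretation z2_op: vector_space "op_scale :: 'k::rc_field \<Rightarrow> 'k z2_op \<Rightarrow> 'k z2_op"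
  by standard (auto intro!: z2_op_eqI simp: z2.scale_right_distrib z2.scale_left_distrib)

text \<open>An explicit formula for the form, which \<open>ks_form_eq\<close> identifies with the
  definite description \<open>ks_form\<close>.\<close>

definition ks_inner :: "nat filter \<Rightarrow> 'k::rc_field z2_op \<Rightarrow> 'k z2_op \<Rightarrow> 'k" where
  "ks_inner U S T = Lim U (\<lambda>n. l2_inner (z2_d (z2_app S (z2_e n))) (z2_d (z2_app T (z2_e n))))"

context
  fixes U :: "nat filter"
  assumes U: "nontrivial_ultrafilter U"
begin

lemma ultrafilter_neq_bot: "U \<noteq> bot"
  using U by (simp add: nontrivial_ultrafilter_def)

lemma z2_d_app_e_bounded:
  obtains C where "\<And>n. norm (z2_d (z2_app T (z2_e n))) \<le> C" "0 \<le> C"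
proof -
  obtain C where C: "\<And>n. norm (z2_d (z2_app T (z2_e n))) \<le> C"
    using z2_null_app_e[of T] by (auto simp: z2_null_def l2_null_def)
  then show ?thesis using that norm_ge_zero order_trans by blast
qed

lemma ks_inner_tendsto:
  "((\<lambda>n. l2_inner (z2_d (z2_app S (z2_e n))) (z2_d (z2_app T (z2_e n)))) \<longlongrightarrow> ks_inner U S T) U"
  unfolding ks_inner_def
proof (rule ultrafilter_tendsto_Lim[OF U])
  obtain C where C: "\<And>n. norm (z2_d (z2_app S (z2_e n))) \<le> C" "0 \<le> C" using z2_d_app_e_bounded by blast
  obtain D where D: "\<And>n. norm (z2_d (z2_app T (z2_e n))) \<le> D" "0 \<le> D" using z2_d_app_e_bounded by blast
  have "norm (l2_inner (z2_d (z2_app S (z2_e n))) (z2_d (z2_app T (z2_e n)))) \<le> C * D" for n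
    by (rule order_trans[OF norm_l2_inner_le mult_mono[OF C(1) D(1)]]) (use C in auto)
  then show "bounded (range (\<lambda>n. l2_inner (z2_d (z2_app S (z2_e n))) (z2_d (z2_app T (z2_e n)))))"
    by (auto simp: bounded_iff)
qed

text \<open>The defect of \<open>z2_d\<close> is controlled by second components, which tend to 0 by
  \<open>z2_y_app_e_tendsto\<close>; this is the source of the additivity of the form.\<close>

lemma z2_d_app_add_tendsto:
  "(\<lambda>n. z2_d (z2_app (S + T) (z2_e n)) - z2_d (z2_app S (z2_e n)) - z2_d (z2_app T (z2_e n))) \<longlonglongrightarrow> 0"
proof (rule Lim_null_comparison[OF always_eventually])
  show "\<forall>n. norm (z2_d (z2_app (S + T) (z2_e n)) - z2_d (z2_app S (z2_e n)) - z2_d (z2_app T (z2_e n)))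
      \<le> 6 * (norm (z2_y (z2_app S (z2_e n))) + norm (z2_y (z2_app T (z2_e n))))"
    by (simp only: z2_app_op_simps z2_d_quasilinear simp_thms)
  have "(\<lambda>n. 6 * (norm (z2_y (z2_app S (z2_e n))) + norm (z2_y (z2_app T (z2_e n))))) \<longlonglongrightarrow> 6 * (0 + 0)"
    by (intro tendsto_mult tendsto_add tendsto_const tendsto_norm_zero z2_y_app_e_tendsto)
  then show "(\<lambda>n. 6 * (norm (z2_y (z2_app S (z2_e n))) + norm (z2_y (z2_app T (z2_e n))))) \<longlonglongrightarrow> 0" by simp
qed

lemma ks_inner_add: "ks_inner U (S + T) R = ks_inner U S R + ks_inner U T R"
proof -
  obtain C where C: "\<And>n. norm (z2_d (z2_app R (z2_e n))) \<le> C" "0 \<le> C" using z2_d_app_e_bounded by blast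
  let ?D = "\<lambda>n. z2_d (z2_app (S + T) (z2_e n)) - z2_d (z2_app S (z2_e n)) - z2_d (z2_app T (z2_e n))"
  have "(\<lambda>n. l2_inner (?D n) (z2_d (z2_app R (z2_e n)))) \<longlonglongrightarrow> 0"
  proof (rule Lim_null_comparison[OF always_eventually])
    show "\<forall>n. norm (l2_inner (?D n) (z2_d (z2_app R (z2_e n)))) \<le> norm (?D n) * C"
      by (intro allI order_trans[OF norm_l2_inner_le] mult_left_mono C) simp
    show "(\<lambda>n. norm (?D n) * C) \<longlonglongrightarrow> 0"
      by (intro tendsto_mult_left_zero tendsto_norm_zero z2_d_app_add_tendsto)
  qed
  from tendsto_add[OF ultrafilter_tendsto[OF U this] tendsto_add[OF ks_inner_tendsto[of S R] ks_inner_tendsto[of T R]]]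
  have "((\<lambda>n. l2_inner (z2_d (z2_app (S + T) (z2_e n))) (z2_d (z2_app R (z2_e n)))) \<longlongrightarrow> ks_inner U S R + ks_inner U T R) U"
    by (simp add: l2_inner_diff)
  then show ?thesis using tendsto_unique[OF ultrafilter_neq_bot ks_inner_tendsto] by blast
qed

lemma ks_inner_scale: "ks_inner U (op_scale c T) R = c * ks_inner U T R"
proof -
  have "((\<lambda>n. l2_inner (z2_d (z2_app (op_scale c T) (z2_e n))) (z2_d (z2_app R (z2_e n)))) \<longlongrightarrow> c * ks_inner U T R) U"
    using tendsto_mult[OF tendsto_const ks_inner_tendsto[of T R], of c] by (simp add: l2_inner_scale_left)
  then show ?thesis using tendsto_unique[OF ultrafilter_neq_bot ks_inner_tendsto] by blast
qed

lemma ks_inner_hermitian: "ks_inner U R T = scnj (ks_inner U T R)"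
proof -
  have "((\<lambda>n. l2_inner (z2_d (z2_app R (z2_e n))) (z2_d (z2_app T (z2_e n)))) \<longlongrightarrow> scnj (ks_inner U T R)) U"
    by (subst l2_inner_commute) (rule tendsto_scnj[OF ks_inner_tendsto])
  then show ?thesis using tendsto_unique[OF ultrafilter_neq_bot ks_inner_tendsto] by blast
qed

lemma z2_norm_app_e_tendsto:
  "((\<lambda>n. z2_norm (z2_app T (z2_e n))) \<longlongrightarrow> sqrt (norm (ks_inner U T T))) U"
proof -
  have "((\<lambda>n. sqrt (norm (l2_inner (z2_d (z2_app T (z2_e n))) (z2_d (z2_app T (z2_e n)))))) \<longlongrightarrow> sqrt (norm (ks_inner U T T))) U"
    by (intro tendsto_real_sqrt tendsto_norm ks_inner_tendsto)
  then have "((\<lambda>n. norm (z2_d (z2_app T (z2_e n)))) \<longlongrightarrow> sqrt (norm (ks_inner U T T))) U"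
    by (simp add: l2_inner_self del: of_real_power)
  from tendsto_add[OF this ultrafilter_tendsto[OF U tendsto_norm_zero[OF z2_y_app_e_tendsto[of T]]]]
  show ?thesis by (simp add: z2_norm_eq)
qed

lemma ks_inner_self: "ks_inner U T T = of_real (Lim U (\<lambda>n. (z2_norm (z2_app T (z2_e n)))\<^sup>2))"
proof -
  have "Lim U (\<lambda>n. (z2_norm (z2_app T (z2_e n)))\<^sup>2) = (sqrt (norm (ks_inner U T T)))\<^sup>2"
    by (intro tendsto_Lim ultrafilter_neq_bot tendsto_power z2_norm_app_e_tendsto)
  \<comment> \<open>A limit of nonnegative real scalars equals its own norm.\<close>
  moreover have "ks_inner U T T = of_real ((sqrt (norm (ks_inner U T T)))\<^sup>2)"
  proof -
    have 1: "((\<lambda>n. of_real ((norm (z2_d (z2_app T (z2_e n))))\<^sup>2)) \<longlongrightarrow> ks_inner U T T) U"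
      using ks_inner_tendsto[of T T] by (simp add: l2_inner_self)
    from tendsto_of_real[OF tendsto_norm[OF this]]
    have 2: "((\<lambda>n. of_real ((norm (z2_d (z2_app T (z2_e n))))\<^sup>2)) \<longlongrightarrow> (of_real (norm (ks_inner U T T)) :: 'a)) U"
      by (simp add: norm_power)
    show ?thesis unfolding real_sqrt_pow2[OF norm_ge_zero] by (rule tendsto_unique[OF ultrafilter_neq_bot 1 2])
  qed
  ultimately show ?thesis by simp
qed

lemma ks_inner_cauchy_schwarz: "(norm (ks_inner U S T))\<^sup>2 \<le> norm (ks_inner U S S) * norm (ks_inner U T T)"
proof (rule tendsto_le[OF ultrafilter_neq_bot])
  let ?s = "\<lambda>n. z2_d (z2_app S (z2_e n))" and ?t = "\<lambda>n. z2_d (z2_app T (z2_e n))"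
  show "((\<lambda>n. (norm (l2_inner (?s n) (?t n)))\<^sup>2) \<longlongrightarrow> (norm (ks_inner U S T))\<^sup>2) U"
    by (intro tendsto_power tendsto_norm ks_inner_tendsto)
  show "((\<lambda>n. norm (l2_inner (?s n) (?s n)) * norm (l2_inner (?t n) (?t n))) \<longlongrightarrow> norm (ks_inner U S S) * norm (ks_inner U T T)) U"
    by (intro tendsto_mult tendsto_norm ks_inner_tendsto)
  show "\<forall>\<^sub>F n in U. (norm (l2_inner (?s n) (?t n)))\<^sup>2 \<le> norm (l2_inner (?s n) (?s n)) * norm (l2_inner (?t n) (?t n))"
  proof (rule always_eventually, rule allI)
    fix n
    have "(norm (l2_inner (?s n) (?t n)))\<^sup>2 \<le> (norm (?s n) * norm (?t n))\<^sup>2"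
      by (intro power_mono norm_l2_inner_le) simp
    then show "(norm (l2_inner (?s n) (?t n)))\<^sup>2 \<le> norm (l2_inner (?s n) (?s n)) * norm (l2_inner (?t n) (?t n))"
      by (simp add: l2_inner_self power_mult_distrib norm_power)
  qed
qed

lemma psd_form_ks_inner: "psd_form op_scale (ks_inner U)"
  by unfold_locales (auto simp: ks_inner_add ks_inner_scale ks_inner_cauchy_schwarz intro: ks_inner_hermitian)

text \<open>Two forms with the same quadratic form differ by a Hermitian \<open>D\<close> with
  \<open>D T T = 0\<close>. Polarization gives \<open>D S T + scnj (D S T) = 0\<close>, and
  multiplying \<open>S\<close> by \<open>scnj (D S T)\<close> turns the value into a squared norm;
  this covers both scalar fields at once.\<close>

lemma ks_form_eq: "ks_form U = (ks_inner U :: 'k::rc_field z2_op \<Rightarrow> _)"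
  unfolding ks_form_def
proof (rule the_equality)
  show "(\<forall>S T R. ks_inner U (S + T) R = ks_inner U S R + ks_inner U T (R :: 'k z2_op)) \<and>
    (\<forall>c T R. ks_inner U (op_scale c T) R = c * ks_inner U T (R :: 'k z2_op)) \<and>
    (\<forall>T R. ks_inner U R T = scnj (ks_inner U T (R :: 'k z2_op))) \<and>
    (\<forall>T :: 'k z2_op. ks_inner U T T = of_real (Lim U (\<lambda>n. (z2_norm (z2_app T (z2_e n)))\<^sup>2)))"
    using ks_inner_add ks_inner_scale ks_inner_hermitian ks_inner_self by blast
  fix B :: "'k z2_op \<Rightarrow> 'k z2_op \<Rightarrow> 'k"
  assume B: "(\<forall>S T R. B (S + T) R = B S R + B T R) \<and> (\<forall>c T R. B (op_scale c T) R = c * B T R) \<and>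
    (\<forall>T R. B R T = scnj (B T R)) \<and> (\<forall>T. B T T = of_real (Lim U (\<lambda>n. (z2_norm (z2_app T (z2_e n)))\<^sup>2)))"
  have Badd: "B (S + T) R = B S R + B T R" and Bscale: "B (op_scale c T) R = c * B T R"
    and Bh: "B R T = scnj (B T R)" and Bself: "B T T = of_real (Lim U (\<lambda>n. (z2_norm (z2_app T (z2_e n)))\<^sup>2))"
    for S T R c using B by blast+
  define D where "D = (\<lambda>S T. B S T - ks_inner U S T)"
  have D: "D (S + T) R = D S R + D T R" "D (op_scale c T) R = c * D T R" "D T T = 0" for S T R c
    by (simp_all add: D_def Badd Bscale Bself ks_inner_add ks_inner_scale ks_inner_self algebra_simps)
  have Dh: "D R T = scnj (D T R)" for R T
    unfolding D_def scnj_diff by (rule arg_cong2[where f = "(-)"], rule Bh, rule ks_inner_hermitian)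
  have real: "D S T + scnj (D S T) = 0" for S T
    using D(3)[of "S + T"] D(1)[of S T "S + T"] Dh[of S "S + T"] Dh[of T "S + T"] D(1)[of S T S] D(1)[of S T T]
      D(3)[of S] D(3)[of T] Dh[of T S] by (simp add: scnj_add)
  have "D S T = 0" for S T
  proof -
    have "scnj (D S T) * D S T + scnj (scnj (D S T) * D S T) = 0"
      using real[of "op_scale (scnj (D S T)) S" T] by (simp add: D(2))
    then have "2 * (D S T * scnj (D S T)) = 0" by (simp add: scnj_mult mult.commute)
    then show ?thesis by (simp add: mult_scnj)
  qed
  then show "B = ks_inner U" by (simp add: D_def fun_eq_iff)
qed

end

section \<open>The norm of \<open>Lambda A\<close> and the seminorm \<open>norm_S\<close>\<close>

abbreviation ks_norm :: "nat filter \<Rightarrow> 'k::rc_field z2_op \<Rightarrow> real" where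
  "ks_norm U T \<equiv> sqrt (norm (ks_inner U T T))"

context
  fixes U :: "nat filter"
  assumes U: "nontrivial_ultrafilter U"
begin

lemma ks_norm_mult_le:
  assumes "\<And>u. z2_norm (z2_app A u) \<le> L * z2_norm u"
  shows "ks_norm U (A * T) \<le> L * ks_norm U T"
  by (rule tendsto_le[OF ultrafilter_neq_bot[OF U] tendsto_mult[OF tendsto_const z2_norm_app_e_tendsto[OF U]]
        z2_norm_app_e_tendsto[OF U]])
    (simp add: assms)

lemma infdim_closed_nonzero:
  assumes "infdim_closed_subspace Z" obtains u where "u \<in> Z" "0 < z2_norm u"
proof -
  obtain u where "u \<in> Z" "u \<noteq> 0" using infdim_nonzero assms unfolding infdim_closed_subspace_def by blast
  then show ?thesis using that z2_norm_zero_iff[of u] z2_norm_nonneg[of u] by (simp add: less_le)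
qed

lemma ks_bound_on_subspace:
  assumes K: "\<And>T. ks_norm U (A * T) \<le> K * ks_norm U T" "0 \<le> K" and \<epsilon>: "K < \<epsilon>"
    and Y: "infdim_closed_subspace Y"
  shows "\<exists>Z\<subseteq>Y. infdim_closed_subspace Z \<and> (\<forall>u\<in>Z. z2_norm (z2_app A u) \<le> \<epsilon> * z2_norm u)"
proof -
  have "a \<le> K * t"
    if t: "((\<lambda>n. z2_norm (z2_app T (z2_e n))) \<longlongrightarrow> t) U"
      and a: "((\<lambda>n. z2_norm (z2_app (A * T) (z2_e n))) \<longlongrightarrow> a) U" for T t a
    using tendsto_unique[OF ultrafilter_neq_bot[OF U] t z2_norm_app_e_tendsto[OF U]]
      tendsto_unique[OF ultrafilter_neq_bot[OF U] a z2_norm_app_e_tendsto[OF U]] K(1)[of T] by simp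
  then obtain Z where "Z \<subseteq> Y" "infdim_closed_subspace Z" "\<And>u. u \<in> Z \<Longrightarrow> z2_norm (z2_app A u) \<le> \<epsilon> * z2_norm u"
    using ultrafilter_bound_on_subspace[OF U _ K(2) \<epsilon> Y] by metis
  then show ?thesis by blast
qed

text \<open>A failure at \<open>T\<close> would make \<open>A\<close> bounded below by some
  \<open>\<epsilon>' > \<epsilon>\<close> on a whole subspace \<open>Y\<close>, and no further
  subspace of \<open>Y\<close> could then satisfy the assumption.\<close>

lemma ks_norm_le_of_small_on_subspaces:
  assumes \<epsilon>: "0 < \<epsilon>" and small: "\<And>Y. infdim_closed_subspace Y \<Longrightarrow>
      \<exists>Z\<subseteq>Y. infdim_closed_subspace Z \<and> (\<forall>u\<in>Z. z2_norm (z2_app A u) \<le> \<epsilon> * z2_norm u)"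
  shows "ks_norm U (A * T) \<le> \<epsilon> * ks_norm U T"
proof (rule ccontr)
  assume "\<not> ?thesis"
  then have gt: "\<epsilon> * ks_norm U T < ks_norm U (A * T)" by simp
  moreover have "0 \<le> \<epsilon> * ks_norm U T" using \<epsilon> by simp
  ultimately have pos: "0 < ks_norm U (A * T)" by linarith
  obtain Y \<epsilon>' where Y: "infdim_closed_subspace Y" "\<epsilon> < \<epsilon>'" "\<And>u. u \<in> Y \<Longrightarrow> \<epsilon>' * z2_norm u \<le> z2_norm (z2_app A u)"
    using ultrafilter_limit_large_on_subspace[OF U z2_norm_app_e_tendsto[OF U] z2_norm_app_e_tendsto[OF U] less_imp_le[OF \<epsilon>] gt pos]
    by metis
  obtain Z where Z: "Z \<subseteq> Y" "infdim_closed_subspace Z" "\<And>u. u \<in> Z \<Longrightarrow> z2_norm (z2_app A u) \<le> \<epsilon> * z2_norm u"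
    using small[OF Y(1)] by blast
  obtain u where u: "u \<in> Z" "0 < z2_norm u" using infdim_closed_nonzero[OF Z(2)] by blast
  have "\<epsilon>' * z2_norm u \<le> \<epsilon> * z2_norm u" using Y(3)[of u] Z(1) Z(3)[OF u(1)] u(1) by fastforce
  then show False using u(2) Y(2) by simp
qed

text \<open>Identifies the kernel of \<open>Lambda\<close>. A nonzero limit produces a subspace on
  which \<open>A\<close> is bounded below; if all limits vanish, every subspace contains another one
  on which \<open>A\<close> is as small as desired.\<close>

lemma strictly_singular_iff: "A \<in> strictly_singular \<longleftrightarrow> (\<forall>T. ks_norm U (A * T) = 0)"
proof
  assume A: "A \<in> strictly_singular"
  show "\<forall>T. ks_norm U (A * T) = 0"
  proof (rule ccontr)
    assume "\<not> ?thesis"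
    then obtain T where "ks_norm U (A * T) \<noteq> 0" by blast
    then have pos: "0 < ks_norm U (A * T)" by simp
    then have gt: "0 * ks_norm U T < ks_norm U (A * T)" by simp
    obtain Y e where Y: "infdim_closed_subspace Y" "0 < e" "\<And>u. u \<in> Y \<Longrightarrow> e * z2_norm u \<le> z2_norm (z2_app A u)"
      using ultrafilter_limit_large_on_subspace[OF U z2_norm_app_e_tendsto[OF U] z2_norm_app_e_tendsto[OF U] order_refl gt pos]
      by metis
    have "\<forall>u\<in>Y. z2_norm u \<le> (1 / e) * z2_norm (z2_app A u)" using Y(2,3) by (simp add: field_simps)
    then show False using A Y(1) unfolding strictly_singular_def by blast
  qed
next
  assume 0: "\<forall>T. ks_norm U (A * T) = 0"
  show "A \<in> strictly_singular"
    unfolding strictly_singular_def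
  proof (intro CollectI allI impI notI)
    fix Y assume Y: "infdim_closed_subspace Y" and "\<exists>K. \<forall>u\<in>Y. z2_norm u \<le> K * z2_norm (z2_app A u)"
    then obtain K where K: "\<And>u. u \<in> Y \<Longrightarrow> z2_norm u \<le> K * z2_norm (z2_app A u)" by blast
    \<comment> \<open>Makes \<open>(\<bar>K\<bar> + 1) * e\<close> equal to one half.\<close>
    define e where "e = 1 / (2 * (\<bar>K\<bar> + 1))"
    have e: "0 < e" by (simp add: e_def)
    obtain Z where Z: "Z \<subseteq> Y" "infdim_closed_subspace Z" "\<And>u. u \<in> Z \<Longrightarrow> z2_norm (z2_app A u) \<le> e * z2_norm u"
      using ks_bound_on_subspace[of A 0 e Y] 0 e Y by auto
    obtain u where u: "u \<in> Z" "0 < z2_norm u" using infdim_closed_nonzero[OF Z(2)] by blast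
    have "z2_norm u \<le> K * z2_norm (z2_app A u)" using K Z(1) u(1) by blast
    also have "\<dots> \<le> (\<bar>K\<bar> + 1) * (e * z2_norm u)"
      by (intro mult_mono Z(3) u(1)) (auto simp: z2_norm_nonneg)
    also have "\<dots> = z2_norm u / 2" by (simp add: e_def field_simps)
    finally show False using u(2) by simp
  qed
qed

lemma norm_S_eq: "norm_S A = Inf {K. 0 \<le> K \<and> (\<forall>T. ks_norm U (A * T) \<le> K * ks_norm U T)}"
proof -
  define P where "P = {K. 0 \<le> K \<and> (\<forall>T. ks_norm U (A * T) \<le> K * ks_norm U T)}"
  define S where "S = {\<epsilon>. \<epsilon> > 0 \<and> (\<forall>Y. infdim_closed_subspace Y \<longrightarrow>
       (\<exists>Z\<subseteq>Y. infdim_closed_subspace Z \<and> (\<forall>u\<in>Z. z2_norm (z2_app A u) \<le> \<epsilon> * z2_norm u)))}"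
  have SP: "S \<subseteq> P" using ks_norm_le_of_small_on_subspaces by (auto simp: S_def P_def)
  have PS: "\<epsilon> \<in> S" if "K \<in> P" "K < \<epsilon>" for K \<epsilon>
    using that ks_bound_on_subspace[of A K \<epsilon>] by (auto simp: S_def P_def)
  obtain L where L: "0 \<le> L" "\<And>u. z2_norm (z2_app A u) \<le> L * z2_norm u" using z2_op_bounded by blast
  have P: "L \<in> P" using L ks_norm_mult_le[OF L(2)] by (simp add: P_def)
  have ne: "S \<noteq> {}" using PS[OF P, of "L + 1"] by auto
  have bd: "bdd_below P" "bdd_below S" by (rule bdd_belowI[of _ 0]; simp add: P_def S_def)+
  have "Inf P \<le> Inf S" by (rule cInf_superset_mono[OF ne bd(1) SP])
  moreover have "Inf S \<le> Inf P"
  proof (rule cInf_greatest)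
    show "P \<noteq> {}" using P by blast
    fix K assume K: "K \<in> P"
    show "Inf S \<le> K" by (rule dense_ge) (use PS[OF K] bd(2) in \<open>auto intro: cInf_lower\<close>)
  qed
  ultimately show ?thesis by (simp add: norm_S_def P_def S_def)
qed

lemma ks_inner_adjoint: "ks_inner U (A * T) R = ks_inner U T (op_star A * R)"
proof -
  have "((\<lambda>n. l2_inner (z2_d (z2_app (A * T) (z2_e n))) (z2_d (z2_app R (z2_e n)))
    - l2_inner (z2_d (z2_app T (z2_e n))) (z2_d (z2_app (op_star A * R) (z2_e n))))
    \<longlongrightarrow> ks_inner U (A * T) R - ks_inner U T (op_star A * R)) U"
    by (intro tendsto_diff ks_inner_tendsto[OF U])
  from tendsto_unique[OF ultrafilter_neq_bot[OF U] this ultrafilter_tendsto[OF U l2_inner_adjoint_tendsto]]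
  show ?thesis by simp
qed

text \<open>Cauchy--Schwarz applied to \<open>(A* R, A* R) = (A A* R, R)\<close>, where
  \<open>A A* R\<close> has seminorm 0.\<close>

lemma op_star_strictly_singular:
  assumes "A \<in> strictly_singular" shows "op_star A \<in> strictly_singular"
  unfolding strictly_singular_iff
proof
  fix R
  interpret psd_form op_scale "ks_inner U :: 'a z2_op \<Rightarrow> 'a z2_op \<Rightarrow> 'a" by (rule psd_form_ks_inner[OF U])
  have "ks_inner U (op_star A * R) (op_star A * R) = ks_inner U (A * (op_star A * R)) R"
    using ks_inner_adjoint[of A "op_star A * R" R] by simp
  also have "norm \<dots> \<le> p (A * (op_star A * R)) * p R" by (rule norm_B_le)
  also have "p (A * (op_star A * R)) = 0" using assms by (simp add: strictly_singular_iff p_def)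
  finally show "ks_norm U (op_star A * R) = 0" by simp
qed

end

section \<open>The quotient algebra\<close>

lemma ring_L_Z2: "ring (L_Z2 :: 'k::rc_field z2_op ring)"
proof (rule ringI)
  show "abelian_group (L_Z2 :: 'k z2_op ring)"
    by (rule abelian_groupI) (auto simp: L_Z2_def algebra_simps intro: exI[of _ "- _"] left_minus)
  show "Group.monoid (L_Z2 :: 'k z2_op ring)"
    by (rule monoidI) (auto simp: L_Z2_def mult.assoc)
qed (auto simp: L_Z2_def algebra_simps)

context
  fixes U :: "nat filter"
  assumes U: "nontrivial_ultrafilter U"
begin

text \<open>All closure properties are read off from \<open>strictly_singular_iff\<close>; closure
  under sums, not evident from the definition, becomes the triangle inequality for
  \<open>p\<close>.\<close>

lemma strictly_singular_closed:
  fixes A B :: "'k::rc_field z2_op"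
  shows strictly_singular_0: "0 \<in> (strictly_singular :: 'k z2_op set)"
    and strictly_singular_add: "A \<in> strictly_singular \<Longrightarrow> B \<in> strictly_singular \<Longrightarrow> A + B \<in> strictly_singular"
    and strictly_singular_scale: "A \<in> strictly_singular \<Longrightarrow> op_scale c A \<in> strictly_singular"
    and strictly_singular_mult_left: "A \<in> strictly_singular \<Longrightarrow> B * A \<in> strictly_singular"
    and strictly_singular_mult_right: "A \<in> strictly_singular \<Longrightarrow> A * B \<in> strictly_singular"
proof -
  interpret psd_form op_scale "ks_inner U :: 'k z2_op \<Rightarrow> 'k z2_op \<Rightarrow> 'k" by (rule psd_form_ks_inner[OF U])
  have iff: "A \<in> strictly_singular \<longleftrightarrow> (\<forall>T. p (A * T) = 0)" for A :: "'k z2_op"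
    unfolding p_def by (rule strictly_singular_iff[OF U])
  show "0 \<in> (strictly_singular :: 'k z2_op set)" unfolding iff by simp
  show "A + B \<in> strictly_singular" if "A \<in> strictly_singular" "B \<in> strictly_singular"
    unfolding iff
  proof
    fix T
    have "p (A * T + B * T) \<le> 0" using p_add[of "A * T" "B * T"] that by (simp add: iff)
    from antisym[OF this p_nonneg] show "p ((A + B) * T) = 0" by (simp add: distrib_right)
  qed
  have sm: "op_scale c A * T = op_scale c (A * T)" for c and A T :: "'k z2_op" by (rule z2_op_eqI) simp
  show "op_scale c A \<in> strictly_singular" if "A \<in> strictly_singular"
    using that unfolding iff by (simp add: sm p_scale)
  show "B * A \<in> strictly_singular" if A: "A \<in> strictly_singular"
    unfolding iff
  proof
    fix T
    obtain L where L: "\<And>u. z2_norm (z2_app B u) \<le> L * z2_norm u" using z2_op_bounded by blast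
    have "p (B * (A * T)) \<le> L * p (A * T)" unfolding p_def by (rule ks_norm_mult_le[OF U L])
    then have "p (B * (A * T)) \<le> 0" using A by (simp add: iff)
    from antisym[OF this p_nonneg] show "p (B * A * T) = 0" by (simp add: mult.assoc)
  qed
  show "A * B \<in> strictly_singular" if "A \<in> strictly_singular"
    using that unfolding iff by (simp add: mult.assoc)
qed

lemma strictly_singular_minus:
  fixes A :: "'k::rc_field z2_op"
  assumes "A \<in> strictly_singular" shows "- A \<in> strictly_singular"
  using strictly_singular_mult_left[OF assms, of "- 1"] by simp

lemma ideal_strictly_singular: "ideal strictly_singular (L_Z2 :: 'k::rc_field z2_op ring)"
proof (rule idealI[OF ring_L_Z2])
  interpret ring "L_Z2 :: 'k z2_op ring" by (rule ring_L_Z2)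
  have inv: "inv\<^bsub>add_monoid L_Z2\<^esub> A = - A" for A :: "'k z2_op"
    unfolding a_inv_def[symmetric] by (rule minus_equality) (auto simp: L_Z2_def)
  show "subgroup strictly_singular (add_monoid (L_Z2 :: 'k z2_op ring))"
  proof (rule subgroup.intro)
    fix A :: "'k z2_op" assume "A \<in> strictly_singular"
    then show "inv\<^bsub>add_monoid L_Z2\<^esub> A \<in> strictly_singular" unfolding inv by (rule strictly_singular_minus)
  qed (auto simp: L_Z2_def strictly_singular_0 strictly_singular_add)
qed (auto simp: L_Z2_def strictly_singular_mult_left strictly_singular_mult_right)

abbreviation (input) coset :: "'k::rc_field z2_op \<Rightarrow> 'k z2_op set" where
  "coset A \<equiv> strictly_singular +>\<^bsub>L_Z2\<^esub> A"

lemma mem_coset_iff: "B \<in> coset A \<longleftrightarrow> B - A \<in> strictly_singular"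
  for A B :: "'k::rc_field z2_op"
  unfolding a_r_coset_def' by (auto simp: L_Z2_def intro!: bexI[of _ "B - A"])

lemma coset_self: "A \<in> coset A" for A :: "'k::rc_field z2_op"
  by (simp add: mem_coset_iff strictly_singular_0)

lemma coset_eqI:
  fixes A B :: "'k::rc_field z2_op"
  assumes "A - B \<in> strictly_singular" shows "coset A = coset B"
proof -
  have "C - A \<in> strictly_singular \<longleftrightarrow> C - B \<in> strictly_singular" for C
    using strictly_singular_add[of "C - A" "A - B"] strictly_singular_add[of "C - B" "- (A - B)"]
      strictly_singular_minus[OF assms] assms by auto
  then show ?thesis by (auto simp: mem_coset_iff)
qed

text \<open>The operations of the quotient are unions over representatives; for an additive map
  preserving the ideal all these cosets coincide.\<close>

lemma UN_coset:
  fixes A :: "'k::rc_field z2_op" and f :: "'k z2_op \<Rightarrow> 'k z2_op"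
  assumes "\<And>A B. f (A - B) = f A - f B" "\<And>A. A \<in> strictly_singular \<Longrightarrow> f A \<in> strictly_singular"
  shows "(\<Union>B\<in>coset A. coset (f B)) = coset (f A)"
proof -
  have "coset (f B) = coset (f A)" if "B \<in> coset A" for B
    using that assms by (intro coset_eqI) (simp add: mem_coset_iff flip: assms(1))
  then show ?thesis using coset_self[of A] by blast
qed

lemma L_mod_S_simps:
  fixes A B :: "'k::rc_field z2_op"
  shows "carrier L_mod_S = range (coset :: 'k z2_op \<Rightarrow> _)"
    "coset A \<otimes>\<^bsub>L_mod_S\<^esub> coset B = coset (A * B)" "coset A \<oplus>\<^bsub>L_mod_S\<^esub> coset B = coset (A + B)"
    "\<one>\<^bsub>L_mod_S\<^esub> = coset (1 :: 'k z2_op)" "c \<odot>\<^bsub>L_mod_S\<^esub> coset A = coset (op_scale c A)"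
    "star L_mod_S (coset A) = coset (op_star A)"
proof -
  interpret ideal strictly_singular "L_Z2 :: 'k z2_op ring" by (rule ideal_strictly_singular)
  show "carrier L_mod_S = range (coset :: 'k z2_op \<Rightarrow> _)"
    by (auto simp: L_mod_S_def FactRing_def A_RCOSETS_def' L_Z2_def)
  show "coset A \<otimes>\<^bsub>L_mod_S\<^esub> coset B = coset (A * B)"
    using rcoset_mult_add[of A B] by (simp add: L_mod_S_def FactRing_def) (simp add: L_Z2_def)
  show "coset A \<oplus>\<^bsub>L_mod_S\<^esub> coset B = coset (A + B)"
    using a_rcos_sum[of A B] by (simp add: L_mod_S_def FactRing_def) (simp add: L_Z2_def)
  show "\<one>\<^bsub>L_mod_S\<^esub> = coset (1 :: 'k z2_op)" by (simp add: L_mod_S_def FactRing_def L_Z2_def)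
  show "c \<odot>\<^bsub>L_mod_S\<^esub> coset A = coset (op_scale c A)"
    using UN_coset[of "op_scale c" A] by (simp add: L_mod_S_def z2_op.scale_right_diff_distrib strictly_singular_scale)
  have "op_star (A - B) = op_star A - op_star B" for A B :: "'k z2_op"
    using op_star_add[of "A - B" B] by simp
  then show "star L_mod_S (coset A) = coset (op_star A)"
    using UN_coset[of op_star A, OF _ op_star_strictly_singular[OF U]] by (simp add: L_mod_S_def)
qed

end

lemma (in psd_form) ext_eqI:
  assumes "bounded_map F" "bounded_map G" "\<And>T. p (F T - G T) = 0" shows "ext F = ext G"
  by (rule bounded_ops_eqI)
    (use assms in \<open>auto simp: ext_bounded_ops ext_cls CS_const cls_eq_iff\<close>)

theorem corollary6p15:
  fixes U :: "nat filter"
  assumes "nontrivial_ultrafilter U"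
  shows "\<exists>Lambda_hat \<in> isometric_star_hom
            (L_mod_S :: ('k::rc_field, 'k z2_op set) normed_star_algebra) (L_alg (ks_H U)).
           \<forall>A. Lambda_hat (strictly_singular +>\<^bsub>L_Z2\<^esub> A) = ks_Lambda U A"
proof -
  note U = assms
  interpret psd_form op_scale "ks_inner U :: 'k z2_op \<Rightarrow> 'k z2_op \<Rightarrow> 'k" by (rule psd_form_ks_inner[OF U])
  have H: "ks_H U = H" by (simp add: ks_H_def ks_form_eq[OF U])
  have tilde: "ks_tilde U T = cls (\<lambda>_. T)" for T by (simp add: ks_tilde_def ks_form_eq[OF U] cls_def)
  define L where "L = (\<lambda>A :: 'k z2_op. (*) A)"
  have bm: "bounded_map (L A)" for A
  proof -
    obtain K where "\<And>u. z2_norm (z2_app A u) \<le> K * z2_norm u" using z2_op_bounded by blast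
    then have "p (L A T) \<le> K * p T" for T unfolding p_def L_def by (rule ks_norm_mult_le[OF U])
    moreover have "L A (op_scale c T) = op_scale c (L A T)" for c T unfolding L_def by (rule z2_op_eqI) simp
    ultimately show ?thesis unfolding bounded_map_def by (auto simp: L_def distrib_left)
  qed
  have Lambda: "ks_Lambda U A = ext (L A)" for A
    unfolding ks_Lambda_def H tilde
  proof (rule the_equality)
    show *: "ext (L A) \<in> bounded_ops H \<and> (\<forall>T. ext (L A) (cls (\<lambda>_. T)) = cls (\<lambda>_. A * T))"
      using ext_bounded_ops[OF bm] ext_cls[OF bm CS_const] by (simp add: L_def)
    show "F = ext (L A)" if "F \<in> bounded_ops H \<and> (\<forall>T. F (cls (\<lambda>_. T)) = cls (\<lambda>_. A * T))" for F
      using that * by (intro bounded_ops_eqI) auto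
  qed
  \<comment> \<open>Operators that differ by a strictly singular one have the same extension by
    \<open>ext_eqI\<close>, so the chosen representative does not matter.\<close>
  define h where "h = (\<lambda>a. ext (L (SOME A. A \<in> a)))"
  have h: "h (strictly_singular +>\<^bsub>L_Z2\<^esub> A) = ext (L A)" for A
  proof -
    define A' where "A' = (SOME B. B \<in> strictly_singular +>\<^bsub>L_Z2\<^esub> A)"
    have "A' \<in> strictly_singular +>\<^bsub>L_Z2\<^esub> A" unfolding A'_def using coset_self[OF U] by (rule someI)
    then have "A' - A \<in> strictly_singular" by (simp add: mem_coset_iff[OF U])
    then have "p ((A' - A) * T) = 0" for T unfolding p_def strictly_singular_iff[OF U] by blast
    then have "p (L A' T - L A T) = 0" for T by (simp add: L_def left_diff_distrib)
    then show ?thesis unfolding h_def A'_def[symmetric] by (rule ext_eqI[OF bm bm])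
  qed
  have vec: "ip_space.vec H = cls ` CS" by (rule vec_H)
  note L_alg_simps = L_alg_def H
  \<comment> \<open>The algebraic identities are checked on classes of Cauchy sequences, outside of
    which both sides are \<open>undefined\<close>.\<close>
  have extI: "G = ext (L A)"
    if "G \<in> extensional (ip_space.vec H)" "\<And>X. X \<in> CS \<Longrightarrow> G (cls X) = cls (\<lambda>n. A * X n)" for G A
  proof (rule extensionalityI[OF that(1)])
    show "ext (L A) \<in> extensional (ip_space.vec H)" by (simp add: ext_def)
  qed (use that(2) ext_cls[OF bm] in \<open>auto simp: vec L_def\<close>)
  note simps = L_mod_S_simps[OF U]
  have "h \<in> isometric_star_hom L_mod_S (L_alg (ks_H U))"
    unfolding isometric_star_hom_def
  proof (intro CollectI conjI ring_hom_memI allI ballI)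
    fix a b :: "'k z2_op set" and c :: 'k
    assume a: "a \<in> carrier L_mod_S"
    then obtain A where A: "a = strictly_singular +>\<^bsub>L_Z2\<^esub> A" by (auto simp: simps)
    show "h a \<in> carrier (L_alg (ks_H U))" by (simp add: A h L_alg_simps ext_bounded_ops bm)
    show "h (c \<odot>\<^bsub>L_mod_S\<^esub> a) = c \<odot>\<^bsub>L_alg (ks_H U)\<^esub> h a"
    proof -
      have "op_scale c A * X = op_scale c (A * X)" for X by (rule z2_op_eqI) simp
      then have "(\<lambda>h\<in>ip_space.vec H. vscale H c (ext (L A) h)) = ext (L (op_scale c A))"
        by (intro extI) (auto simp: vec ext_cls[OF bm] vscale_cls L_def
            ext_cls[OF bm, unfolded L_def] CS_bounded_map[OF bm, unfolded L_def])
      then show ?thesis by (simp add: A h simps L_alg_simps)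
    qed
    show "h (star L_mod_S a) = star (L_alg (ks_H U)) (h a)"
    proof -
      have "hilbert_adjoint H (ext (L A)) = ext (L (op_star A))"
        by (rule hilbert_adjoint_ext[OF bm bm]) (simp add: L_def ks_inner_adjoint[OF U])
      then show ?thesis by (simp add: A h simps L_alg_simps)
    qed
    show "alg_norm (L_alg (ks_H U)) (h a) = alg_norm L_mod_S a"
    proof -
      \<comment> \<open>By \<open>op_norm_ext\<close> and \<open>norm_S_eq\<close> both sides are
        the infimum of the same set.\<close>
      have norm: "norm_S B = op_norm H (ext (L B))" for B
        unfolding op_norm_ext[OF bm] norm_S_eq[OF U] by (simp add: L_def p_def)
      \<comment> \<open>The \<open>the_elem\<close> in the quotient norm requires
        \<open>norm_S\<close> to be constant on the coset.\<close>
      have "norm_S B = op_norm H (h a)" if "B \<in> a" for B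
      proof -
        have "B - A \<in> strictly_singular" using that by (simp add: A mem_coset_iff[OF U])
        then have "a = strictly_singular +>\<^bsub>L_Z2\<^esub> B" using coset_eqI[OF U, of B A] by (simp add: A)
        then show ?thesis by (simp add: norm h)
      qed
      moreover have "A \<in> a" using coset_self[OF U] by (simp add: A)
      ultimately have "norm_S ` a = {op_norm H (h a)}" by auto
      then show ?thesis by (simp add: L_mod_S_def L_alg_simps)
    qed
    assume "b \<in> carrier L_mod_S"
    then obtain B where B: "b = strictly_singular +>\<^bsub>L_Z2\<^esub> B" by (auto simp: simps)
    show "h (a \<otimes>\<^bsub>L_mod_S\<^esub> b) = h a \<otimes>\<^bsub>L_alg (ks_H U)\<^esub> h b"
    proof -
      have "compose (ip_space.vec H) (ext (L A)) (ext (L B)) = ext (L (A * B))"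
        by (intro extI) (auto simp: vec compose_def ext_cls[OF bm] CS_bounded_map[OF bm] L_def mult.assoc
            ext_cls[OF bm, unfolded L_def] CS_bounded_map[OF bm, unfolded L_def])
      then show ?thesis by (simp add: A B h simps L_alg_simps)
    qed
    show "h (a \<oplus>\<^bsub>L_mod_S\<^esub> b) = h a \<oplus>\<^bsub>L_alg (ks_H U)\<^esub> h b"
    proof -
      have "(\<lambda>h\<in>ip_space.vec H. vadd H (ext (L A) h) (ext (L B) h)) = ext (L (A + B))"
        by (intro extI) (auto simp: vec vadd_cls ext_cls[OF bm] CS_bounded_map[OF bm] L_def distrib_right
            ext_cls[OF bm, unfolded L_def] CS_bounded_map[OF bm, unfolded L_def])
      then show ?thesis by (simp add: A B h simps L_alg_simps)
    qed
  next
    have "(\<lambda>h\<in>ip_space.vec H. h) = ext (L 1)" by (intro extI) (auto simp: vec)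
    then show "h \<one>\<^bsub>L_mod_S\<^esub> = \<one>\<^bsub>L_alg (ks_H U)\<^esub>" by (simp add: simps h L_alg_simps)
  qed
  then show ?thesis using h Lambda by (intro bexI[of _ h]) auto
qed

end
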